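(* For every integer $m\ge1$, \[ \triangle(q)^{2m(m+1)}=\frac{1}{\left(\prod_{i=1}^m i!\right)^2}\sum_{J\subset\{1,\dots,m\}}(-1)^{|J|}\sum_{\vec k,\vec r\in\mathbb{Z}^m_J}q^{2\sum_{1\le i\le j\le m}k_ik_j+\sum_{j=1}^m(2k_j-1)r_j-\frac{m(m+1)}{2}}\prod_{i=1}^m(k_i+r_i+|\vec k|)\prod_{1\le i<j\le m}(k_i+r_i-k_j-r_j)(r_i-r_j). \]
   Context: $\triangle(q)=\sum_{n\ge0}q^{n(n+1)/2}$. For $J\subset\{1,\dots,m\}$, $\mathbb{Z}^m_J=\{\vec k=(k_1,\dots,k_m)\in\mathbb{Z}^m : J=\{j: k_j\le 0\}\}$; the inner sum is over pairs $\vec k=(k_1,\dots,k_m)$, $\vec r=(r_1,\dots,r_m)$ both in $\mathbb{Z}^m_J$. $|\vec k|=k_1+\cdots+k_m$. *)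

theory Defs
  imports "HOL-Analysis.Analysis"
begin

definition triangle_gf :: "complex \<Rightarrow> complex" where
  "triangle_gf q = (\<Sum>n. q ^ (n * (n + 1) div 2))"

(* An integer vector (k_1,...,k_m) is a function on {1..m}, undefined outside, so that
   distinct elements of the set are distinct vectors. *)
definition int_vecs :: "nat \<Rightarrow> nat set \<Rightarrow> (nat \<Rightarrow> int) set" where
  "int_vecs m J = {k \<in> {1..m} \<rightarrow>\<^sub>E UNIV. J = {j \<in> {1..m}. k j \<le> 0}}"

definition vec_total :: "nat \<Rightarrow> (nat \<Rightarrow> int) \<Rightarrow> int" where
  "vec_total m k = (\<Sum>i=1..m. k i)"

(* The exponent can be negative where the coefficient is not zero; such terms only cancel
   in the total sum (e.g. m = 3, k = (1,0,0), r = (1,0,-2) gives -1). *)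
definition tri_exponent :: "nat \<Rightarrow> (nat \<Rightarrow> int) \<Rightarrow> (nat \<Rightarrow> int) \<Rightarrow> int" where
  "tri_exponent m k r =
     2 * (\<Sum>i=1..m. \<Sum>j=i..m. k i * k j) + (\<Sum>j=1..m. (2 * k j - 1) * r j)
       - int (m * (m + 1) div 2)"

definition tri_coeff :: "nat \<Rightarrow> (nat \<Rightarrow> int) \<Rightarrow> (nat \<Rightarrow> int) \<Rightarrow> int" where
  "tri_coeff m k r =
     (\<Prod>i=1..m. k i + r i + vec_total m k) *
     (\<Prod>i=1..m. \<Prod>j\<in>{i<..m}. (k i + r i - k j - r j) * (r i - r j))"

end

theory Submission
  imports Defs "HOL-Complex_Analysis.Complex_Analysis" "HOL-Combinatorics.Permutations"
begin

text \<open>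
  Put \<open>p = q\<^sup>2\<close> and let \<open>\<theta>\<close> be the theta function with zeros \<open>p\<^sup>\<int>\<close>. The identity is the limit
  \<open>x\<^sub>i, y\<^sub>j \<rightarrow> 1\<close> of an expansion of
  \<open>\<Prod>\<^sub>i\<^sub><\<^sub>j \<theta>(x\<^sub>i/x\<^sub>j) \<Prod>\<^sub>i\<^sub><\<^sub>j \<theta>(y\<^sub>i/y\<^sub>j) / \<Prod>\<^sub>i\<^sub>,\<^sub>j \<theta>(x\<^sub>i y\<^sub>j/q)\<close> with \<open>m + 1\<close> variables \<open>x\<^sub>i\<close>
  and \<open>m\<close> variables \<open>y\<^sub>j\<close> on the unit circle (the denominator identity of affine \<open>sl(m+1|m)\<close>). As a function
  of \<open>y\<^sub>m\<close> the quotient is quasiperiodic of degree \<open>-2\<close>, hence is the sum of its partial fractions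
  over the poles \<open>q p\<^sup>-\<^sup>k / x\<^sub>i\<close>, and each residue is a quotient of the same kind with \<open>x\<^sub>i\<close> and \<open>y\<^sub>m\<close>
  removed, times the \<open>(-k)\<close>-th power of \<open>y\<^sub>1 \<cdots> y\<^sub>m\<^sub>-\<^sub>1\<close>. Iterating gives a sum over permutations and
  over \<open>k \<in> \<int>\<^sup>m\<close>; expanding the factors \<open>1/(1 - z)\<close> geometrically produces the vectors \<open>r\<close>, the sign of
  \<open>k\<^sub>j\<close> deciding in which direction.

  For \<open>x\<^sub>i = t\<^sup>i\<close> and \<open>y\<^sub>j = t\<^sup>j\<close> the sums over permutations become Vandermonde determinants, and
  \<open>\<bar>t\<^sup>a - t\<^sup>b\<bar> \<le> \<bar>a - b\<bar> \<bar>t - 1\<bar>\<close> for \<open>\<bar>t\<bar> = 1\<close> justifies dividing by the appropriate power of \<open>t - 1\<close> and letting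
  \<open>t \<rightarrow> 1\<close> under the sum. The other side tends to a power of \<open>(p;p) / (q;p)\<close>, which is \<open>\<triangle>(q)\<close> by Gauss.
\<close>

subsection \<open>Infinite products and theta functions\<close>

text \<open>Parity keeps the denominators away from zero: the zeros of theta with p = q^2 have
  modulus an even power of |q|, while \<open>x i * y j / q\<close> has modulus 1/|q| on the unit
  circle. The degree -2 drives the partial fractions: on the pole-free circles of radius |q|^(2n)
  the function is Gaussian small in n in both directions, and so are the residues.

  The expansion cannot be evaluated at t = 1, since its terms have the product of all theta(x_i/x_j)
  as denominator. After multiplication by this product and antisymmetrization in both sets of
  variables, each term contains two Vandermonde products, and both sides carry m(m+1)/2 + m(m-1)/2 =
  m^2 factors that vanish at t = 1.

  In the limit the theta products leave the products of j - i over 0 <= i < j <= m and over 1 <= i <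
  j <= m. The second lacks a factor m! compared with the first; antisymmetrizing in y supplies it,
  whence the square of 1! 2! ... m!.\<close>

definition qpoch :: "complex \<Rightarrow> complex \<Rightarrow> complex" where
  "qpoch p x = (\<Prod>j. 1 - p ^ j * x)"

definition theta :: "complex \<Rightarrow> complex \<Rightarrow> complex" where
  "theta p x = qpoch p x * qpoch p (p / x)"

lemma convergent_prod_qpoch:
  assumes "norm (p :: complex) < 1"
  shows "convergent_prod (\<lambda>j. 1 - p ^ j * x)"
proof -
  have "summable (\<lambda>j. norm (p ^ j * x))"
    using assms by (auto simp: norm_mult norm_power intro!: summable_mult2 summable_geometric)
  hence "abs_convergent_prod (\<lambda>j. 1 - p ^ j * x)"
    by (intro summable_imp_abs_convergent_prod) simp
  thus ?thesis by (rule abs_convergent_prod_imp_convergent_prod)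
qed

lemma qpoch_LIMSEQ:
  assumes "norm p < 1"
  shows "(\<lambda>n. \<Prod>j<n. 1 - p ^ j * x) \<longlonglongrightarrow> qpoch p x"
  using convergent_prod_LIMSEQ[OF convergent_prod_qpoch[OF assms, of x]]
  by (simp add: qpoch_def LIMSEQ_lessThan_iff_atMost)

lemma qpoch_rec:
  assumes "norm p < 1"
  shows "qpoch p x = (1 - x) * qpoch p (p * x)"
proof (rule LIMSEQ_unique)
  show "(\<lambda>n. \<Prod>j<Suc n. 1 - p ^ j * x) \<longlonglongrightarrow> qpoch p x"
    using qpoch_LIMSEQ[OF assms, of x] by (rule LIMSEQ_Suc)
  have "(\<lambda>n. (1 - x) * (\<Prod>j<n. 1 - p ^ j * (p * x))) \<longlonglongrightarrow> (1 - x) * qpoch p (p * x)"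
    by (intro tendsto_intros qpoch_LIMSEQ assms)
  thus "(\<lambda>n. \<Prod>j<Suc n. 1 - p ^ j * x) \<longlonglongrightarrow> (1 - x) * qpoch p (p * x)"
    by (simp add: prod.lessThan_Suc_shift mult_ac del: prod.lessThan_Suc)
qed

lemma qpoch_eq_0_iff:
  assumes "norm p < 1"
  shows "qpoch p x = 0 \<longleftrightarrow> (\<exists>j. p ^ j * x = 1)"
proof -
  have "(\<lambda>j. 1 - p ^ j * x) has_prod qpoch p x"
    unfolding qpoch_def by (intro convergent_prod_has_prod convergent_prod_qpoch assms)
  from has_prod_eq_0_iff[OF this] show ?thesis
    by (metis (no_types, lifting) eq_iff_diff_eq_0 image_iff rangeI)
qed

lemma qpoch_holomorphic:
  assumes "norm p < 1"
  shows "qpoch p holomorphic_on A"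
proof (rule holomorphic_on_subset)
  show "qpoch p holomorphic_on UNIV"
  proof (rule holomorphic_uniform_sequence)
    fix z :: complex
    define P where "P = (\<lambda>n x. \<Prod>j<n. 1 - p ^ j * x)"
    have "uniformly_convergent_on (cball z 1) P"
      unfolding P_def
    proof (rule uniformly_convergent_on_prod')
      show "uniformly_convergent_on (cball z 1) (\<lambda>N x. \<Sum>n<N. norm (1 - p ^ n * x - 1))"
      proof (rule Weierstrass_m_test')
        fix n x assume "x \<in> cball z 1"
        hence "norm x \<le> norm z + 1"
          using norm_triangle_ineq2[of x z] by (auto simp: dist_norm norm_minus_commute)
        thus "norm (norm (1 - p ^ n * x - 1)) \<le> norm p ^ n * (norm z + 1)"
          by (auto simp: norm_mult norm_power intro!: mult_left_mono)
      next
        show "summable (\<lambda>n. norm p ^ n * (norm z + 1))"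
          using assms by (intro summable_mult2 summable_geometric) auto
      qed
    qed (auto intro!: continuous_intros)
    then obtain g where g: "uniform_limit (cball z 1) P g sequentially"
      by (auto simp: uniformly_convergent_on_def)
    have "g x = qpoch p x" if "x \<in> cball z 1" for x
      using tendsto_uniform_limitI[OF g that] qpoch_LIMSEQ[OF assms, of x]
      unfolding P_def by (rule LIMSEQ_unique)
    hence "uniform_limit (cball z 1) P (qpoch p) sequentially"
      using g by (subst uniform_limit_cong'[where g = P and i = g]) auto
    thus "\<exists>d>0. cball z d \<subseteq> UNIV \<and> uniform_limit (cball z d) (\<lambda>n x. \<Prod>j<n. 1 - p ^ j * x) (qpoch p) sequentially"
      unfolding P_def by (intro exI[of _ 1]) auto
    fix n
    show "(\<lambda>x. \<Prod>j<n. 1 - p ^ j * x) holomorphic_on UNIV" by (intro holomorphic_intros)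
  qed auto
qed auto

lemma qpoch_holomorphic' [holomorphic_intros]:
  assumes "norm p < 1" "f holomorphic_on A"
  shows "(\<lambda>x. qpoch p (f x)) holomorphic_on A"
  using holomorphic_on_compose[OF assms(2) qpoch_holomorphic[OF assms(1)]] by (simp add: o_def)

lemma tendsto_qpoch [tendsto_intros]:
  assumes "norm p < 1" "(f \<longlongrightarrow> l) F"
  shows "((\<lambda>x. qpoch p (f x)) \<longlongrightarrow> qpoch p l) F"
proof -
  have "isCont (qpoch p) l"
    using holomorphic_on_imp_continuous_on[OF qpoch_holomorphic[OF assms(1), of UNIV]]
    by (simp add: continuous_on_eq_continuous_at)
  thus ?thesis using assms(2) by (rule isCont_tendsto_compose)
qed

section \<open>Zeros and quasi-periodicity of theta\<close>

lemma theta_holomorphic [holomorphic_intros]: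
  assumes "norm p < 1" "f holomorphic_on A" "\<And>x. x \<in> A \<Longrightarrow> f x \<noteq> 0"
  shows "(\<lambda>x. theta p (f x)) holomorphic_on A"
  unfolding theta_def using assms by (auto intro!: holomorphic_intros)

lemma tendsto_theta [tendsto_intros]:
  assumes "norm p < 1" "(f \<longlongrightarrow> l) F" "l \<noteq> 0"
  shows "((\<lambda>x. theta p (f x)) \<longlongrightarrow> theta p l) F"
  unfolding theta_def using assms by (auto intro!: tendsto_intros)

text \<open>Splits off the simple zero at x = 1. The cofactor equals
  \<open>(qpoch p p)\<^sup>2\<close> there, which is the constant in every residue and in the final
  limit.\<close>

lemma theta_eq:
  assumes "norm p < 1"
  shows "theta p x = (1 - x) * (qpoch p (p * x) * qpoch p (p / x))"
  unfolding theta_def using qpoch_rec[OF assms, of x] by simp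

lemma theta_inverse:
  assumes "norm p < 1" "x \<noteq> 0"
  shows "theta p (1 / x) = - theta p x / x"
proof -
  have "theta p (1 / x) = (1 - 1 / x) * (qpoch p (p / x) * qpoch p (p * x))"
    unfolding theta_eq[OF assms(1), of "1 / x"] by simp
  moreover have "1 - 1 / x = - (1 - x) / x" using assms(2) by (simp add: field_simps)
  ultimately show ?thesis unfolding theta_eq[OF assms(1), of x] by (simp only: mult_ac times_divide_eq_right minus_mult_left minus_divide_left times_divide_eq_left)
qed

lemma theta_shift:
  assumes "norm p < 1" "p \<noteq> 0" "x \<noteq> 0"
  shows "theta p (p * x) = - theta p x / x"
proof -
  have "theta p (p * x) = qpoch p (p * x) * ((1 - 1 / x) * qpoch p (p / x))"
    unfolding theta_def using qpoch_rec[OF assms(1), of "1 / x"] assms by simp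
  moreover have "1 - 1 / x = - (1 - x) / x" using assms(3) by (simp add: field_simps)
  ultimately show ?thesis unfolding theta_eq[OF assms(1), of x] by (simp only: mult_ac times_divide_eq_right minus_mult_left minus_divide_left times_divide_eq_left)
qed

lemma theta_shift_inverse:
  assumes "norm p < 1" "p \<noteq> 0" "x \<noteq> 0"
  shows "theta p (x / p) = - (x / p) * theta p x"
proof -
  have "theta p x = - theta p (x / p) / (x / p)" using theta_shift[OF assms(1,2), of "x / p"] assms by simp
  moreover have "x / p \<noteq> 0" using assms by simp
  ultimately show ?thesis by (metis minus_mult_commute minus_minus nonzero_mult_div_cancel_left times_divide_eq_right)
qed

lemma theta_eq_0D:
  assumes "norm p < 1" "p \<noteq> 0" "x \<noteq> 0" "theta p x = 0"
  shows "\<exists>k. x = p powi k"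
proof -
  have "(\<exists>j. p ^ j * x = 1) \<or> (\<exists>j. p ^ j * (p / x) = 1)"
    using assms by (auto simp: theta_def qpoch_eq_0_iff)
  thus ?thesis
  proof
    assume "\<exists>j. p ^ j * x = 1"
    then obtain j where "p ^ j * x = 1" by blast
    hence "x = p powi (- int j)" using assms by (simp add: power_int_minus field_simps)
    thus ?thesis by blast
  next
    assume "\<exists>j. p ^ j * (p / x) = 1"
    then obtain j where "p ^ j * (p / x) = 1" by blast
    hence "x = p powi (int (Suc j))" using assms by (simp only: power_int_of_nat) (simp add: field_simps)
    thus ?thesis by blast
  qed
qed

lemma qpoch_nonzero:
  assumes "norm p < 1" "norm x < 1"
  shows "qpoch p x \<noteq> 0"
proof
  assume "qpoch p x = 0"
  then obtain j where "p ^ j * x = 1" using assms qpoch_eq_0_iff by blast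
  hence "norm p ^ j * norm x = 1" by (metis norm_mult norm_one norm_power)
  moreover have "norm p ^ j * norm x \<le> 1 * norm x"
    using assms by (intro mult_right_mono power_le_one) auto
  ultimately show False using assms by simp
qed

subsection \<open>Gauss' product for the generating function of triangular numbers\<close>

definition gauss_prod :: "complex \<Rightarrow> nat \<Rightarrow> complex" where
  "gauss_prod q n = (\<Prod>j<n. (1 - q ^ (2 * j + 2)) / (1 - q ^ (2 * j + 1)))"

lemma power_neq_1_of_norm_less_1:
  assumes "norm (q :: complex) < 1" "n > 0"
  shows "q ^ n \<noteq> 1"
proof
  assume "q ^ n = 1"
  hence "norm q ^ n = 1" by (metis norm_power norm_one)
  thus False using assms power_less_one_iff[of "norm q" n] by simp
qed

lemma gauss_prod_nonzero: "norm q < 1 \<Longrightarrow> gauss_prod q n \<noteq> 0"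
  using power_neq_1_of_norm_less_1[of q "2 * j + 2" for j] power_neq_1_of_norm_less_1[of q "2 * j + 1" for j]
  by (fastforce simp: gauss_prod_def)

text \<open>Passing from n to n + 1 in \<open>triangle_partial_sum\<close> changes every summand,
  and these changes telescope in s. It is applied at k = n; the upper limit k is kept free for the
  induction.\<close>

lemma gauss_prod_telescope:
  assumes q: "norm q < 1"
  shows "(\<Sum>s<k. gauss_prod q (Suc n) / gauss_prod q s * q ^ (s * (2 * n + 3)) -
                 gauss_prod q n / gauss_prod q s * q ^ (s * (2 * n + 1))) =
         gauss_prod q n / gauss_prod q k * q ^ (k * (2 * n + 1)) * (1 - q ^ (2 * k)) / (1 - q ^ (2 * n + 1))"
proof (induction k)
  case (Suc k)
  define P where "P = gauss_prod q"
  define u v w where "u = q ^ (2 * k)" and "v = q ^ (2 * n)" and "w = q ^ (k * (2 * n + 1))"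
  have nz: "1 - q * u \<noteq> 0" "1 - q ^ 2 * u \<noteq> 0" "1 - q * v \<noteq> 0" "P k \<noteq> 0"
    using power_neq_1_of_norm_less_1[OF q, of "2 * k + 1"] power_neq_1_of_norm_less_1[OF q, of "2 * k + 2"]
      power_neq_1_of_norm_less_1[OF q, of "2 * n + 1"] gauss_prod_nonzero[OF q]
    by (auto simp: u_def v_def P_def power_add power2_eq_square mult_ac)
  have P1: "P (Suc k) = P k * ((1 - q^2 * u) / (1 - q * u))" "P (Suc n) = P n * ((1 - q^2 * v) / (1 - q * v))"
    by (simp_all add: P_def gauss_prod_def u_def v_def power_add power2_eq_square mult_ac)
  have e: "q ^ (k * (2 * n + 3)) = w * u" "q ^ (Suc k * (2 * n + 1)) = w * v * q" "q ^ (2 * n + 1) = q * v"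
     "q ^ (2 * Suc k) = q ^ 2 * u"
  proof -
    have "k * (2 * n + 3) = k * (2 * n + 1) + 2 * k" by (simp add: algebra_simps)
    thus "q ^ (k * (2 * n + 3)) = w * u" by (simp only: w_def u_def power_add)
    have "Suc k * (2 * n + 1) = k * (2 * n + 1) + 2 * n + 1" by simp
    thus "q ^ (Suc k * (2 * n + 1)) = w * v * q" by (simp only: w_def v_def power_add power_one_right)
  qed (simp_all add: u_def v_def power2_eq_square)
  define T where "T = P n / P k * w"
  \<comment> \<open>Over the common denominator the numerator collapses to v q (1 - q u), and the
    factor 1 - q u turns 1 / P k into (1 - q^2 u) / P (k + 1).\<close>
  have "T * (1 - u) / (1 - q * v) + (T * u * ((1 - q^2 * v) / (1 - q * v)) - T) =
        T * ((1 - u) + u * (1 - q^2 * v) - (1 - q * v)) / (1 - q * v)"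
    using nz by (simp add: divide_simps) (simp add: algebra_simps)
  also have "(1 - u) + u * (1 - q^2 * v) - (1 - q * v) = v * q * (1 - q * u)"
    by (simp add: algebra_simps power2_eq_square)
  also have "T * (v * q * (1 - q * u)) / (1 - q * v) =
        P n / P (Suc k) * (w * v * q) * (1 - q ^ 2 * u) / (1 - q * v)"
    unfolding P1 T_def using nz by simp
  finally have "P n / P k * w * (1 - u) / (1 - q * v) + (P (Suc n) / P k * (w * u) - P n / P k * w) =
        P n / P (Suc k) * (w * v * q) * (1 - q ^ 2 * u) / (1 - q * v)"
    unfolding P1(2) T_def by (simp add: mult_ac)
  thus ?case using Suc.IH unfolding sum.lessThan_Suc e unfolding P_def[symmetric] w_def[symmetric] u_def[symmetric]
    by simp
qed simp

text \<open>Shanks' finite form of Gauss' identity.\<close>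

lemma triangle_partial_sum:
  assumes q: "norm q < 1"
  shows "(\<Sum>j<2 * n. q ^ (j * (j + 1) div 2)) =
         (\<Sum>s<n. gauss_prod q n / gauss_prod q s * q ^ (s * (2 * n + 1)))"
proof (induction n)
  case (Suc n)
  define P where "P = gauss_prod q"
  define v w where "v = q ^ (2 * n)" and "w = q ^ (n * (2 * n + 1))"
  have nz: "1 - q * v \<noteq> 0" "P n \<noteq> 0"
    using power_neq_1_of_norm_less_1[OF q, of "2 * n + 1"] gauss_prod_nonzero[OF q] by (auto simp: v_def P_def)
  have P1: "P (Suc n) = P n * ((1 - q^2 * v) / (1 - q * v))"
    by (simp add: P_def gauss_prod_def v_def power_add power2_eq_square mult_ac)
  have e: "q ^ (2 * n * (2 * n + 1) div 2) = w" "q ^ (Suc (2 * n) * (Suc (2 * n) + 1) div 2) = w * v * q"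
    "q ^ (n * (2 * n + 3)) = w * v"
  proof -
    have "2 * n * (2 * n + 1) div 2 = n * (2 * n + 1)" by simp
    thus "q ^ (2 * n * (2 * n + 1) div 2) = w" by (simp only: w_def)
    have "Suc (2 * n) * (Suc (2 * n) + 1) = 2 * (n * (2 * n + 1) + 2 * n + 1)" by (simp add: algebra_simps)
    hence "Suc (2 * n) * (Suc (2 * n) + 1) div 2 = n * (2 * n + 1) + 2 * n + 1" by simp
    thus "q ^ (Suc (2 * n) * (Suc (2 * n) + 1) div 2) = w * v * q"
      by (simp only: w_def v_def power_add power_one_right mult_ac)
    have "n * (2 * n + 3) = n * (2 * n + 1) + 2 * n" by (simp add: algebra_simps)
    thus "q ^ (n * (2 * n + 3)) = w * v" by (simp only: w_def v_def power_add)
  qed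
  have "(\<Sum>s<n. P (Suc n) / P s * q ^ (s * (2 * n + 3))) =
        (\<Sum>s<n. P n / P s * q ^ (s * (2 * n + 1))) + w * (1 - v) / (1 - q * v)"
    using gauss_prod_telescope[OF q, of n n, folded P_def] nz
    by (simp add: sum_subtractf w_def v_def algebra_simps)
  moreover have "w * (1 - v) / (1 - q * v) + P (Suc n) / P n * (w * v) = w + w * v * q"
  proof -
    have "P (Suc n) / P n * (w * v) = w * v * (1 - q^2 * v) / (1 - q * v)" unfolding P1 using nz by simp
    hence "w * (1 - v) / (1 - q * v) + P (Suc n) / P n * (w * v) =
           (w * (1 - v) + w * v * (1 - q^2 * v)) / (1 - q * v)" by (simp add: add_divide_distrib)
    also have "w * (1 - v) + w * v * (1 - q^2 * v) = (w + w * v * q) * (1 - q * v)"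
      by (simp add: algebra_simps power2_eq_square)
    finally show ?thesis using nz by simp
  qed
  moreover have "2 * Suc n + 1 = 2 * n + 3" by simp
  moreover have "(\<Sum>j<2 * Suc n. q ^ (j * (j + 1) div 2)) =
    (\<Sum>j<2 * n. q ^ (j * (j + 1) div 2)) + (w + w * v * q)"
    using e(1,2) by (simp add: add.assoc)
  ultimately have "(\<Sum>j<2 * Suc n. q ^ (j * (j + 1) div 2)) =
    (\<Sum>s<n. P (Suc n) / P s * q ^ (s * (2 * n + 3))) + P (Suc n) / P n * (w * v)"
    using Suc.IH[folded P_def] by (simp only: add.assoc)
  thus ?case using \<open>2 * Suc n + 1 = 2 * n + 3\<close> e(3) by (simp only: P_def sum.lessThan_Suc)
qed simp

lemma gauss_prod_LIMSEQ:
  assumes "norm q < 1"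
  shows "gauss_prod q \<longlonglongrightarrow> qpoch (q\<^sup>2) (q\<^sup>2) / qpoch (q\<^sup>2) q"
proof -
  have p: "norm (q\<^sup>2) < 1" using assms by (simp add: norm_power power_less_one_iff)
  have "q ^ (2 * j + 2) = (q\<^sup>2) ^ j * q\<^sup>2" "q ^ (2 * j + 1) = (q\<^sup>2) ^ j * q" for j
    by (simp_all add: power_mult power2_eq_square)
  hence "gauss_prod q = (\<lambda>n. (\<Prod>j<n. 1 - (q\<^sup>2) ^ j * q\<^sup>2) / (\<Prod>j<n. 1 - (q\<^sup>2) ^ j * q))"
    by (simp only: gauss_prod_def fun_eq_iff prod_dividef simp_thms)
  thus ?thesis using assms p by (simp only:) (intro tendsto_divide qpoch_LIMSEQ qpoch_nonzero)
qed

text \<open>As n grows, the exponents s(2n+1) in \<open>triangle_partial_sum\<close> kill every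
  summand except s = 0, so only the factor \<open>gauss_prod q n\<close> survives. Tannery's theorem
  applies because 1 / P s is bounded, P having a nonzero limit.\<close>

lemma triangle_gf_eq:
  assumes q: "norm q < 1"
  shows "triangle_gf q = qpoch (q\<^sup>2) (q\<^sup>2) / qpoch (q\<^sup>2) q"
proof -
  define P where "P = gauss_prod q"
  define L where "L = qpoch (q\<^sup>2) (q\<^sup>2) / qpoch (q\<^sup>2) q"
  have p: "norm (q\<^sup>2) < 1" using assms by (simp add: norm_power power_less_one_iff)
  have L0: "L \<noteq> 0" using assms p by (simp add: L_def qpoch_nonzero)
  have PL: "P \<longlonglongrightarrow> L" unfolding P_def L_def by (rule gauss_prod_LIMSEQ[OF q])
  have nz: "P n \<noteq> 0" for n using gauss_prod_nonzero[OF q] by (simp add: P_def)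
  have "(\<lambda>n. 1 / P n) \<longlonglongrightarrow> 1 / L" using PL L0 by (intro tendsto_intros)
  hence "Bseq (\<lambda>n. 1 / P n)" by (intro convergent_imp_Bseq convergentI)
  then obtain B where B: "\<And>n. norm (1 / P n) \<le> B" by (auto simp: Bseq_def)
  \<comment> \<open>Padding by zeros makes the range of s independent of n.\<close>
  define a where "a = (\<lambda>s n. if s < n then q ^ (s * (2 * n + 1)) / P s else 0)"
  have "(\<lambda>n. suminf (\<lambda>s. a s n)) \<longlonglongrightarrow> suminf (\<lambda>s. if s = 0 then 1 else 0)"
  proof (rule tannerys_theorem[THEN conjunct2, THEN conjunct2])
    fix s
    show "(\<lambda>n. a s n) \<longlonglongrightarrow> (if s = 0 then 1 else 0)"
    proof (cases "s = 0")
      case True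
      have "eventually (\<lambda>n. a s n = 1) sequentially"
        using eventually_gt_at_top[of 0] by eventually_elim (auto simp: a_def True P_def gauss_prod_def)
      thus ?thesis using True by (simp add: tendsto_eventually)
    next
      case False
      have "(\<lambda>n. (q ^ s) ^ (2 * n + 1)) \<longlonglongrightarrow> 0"
      proof -
        have "(\<lambda>n. (q ^ s) ^ n) \<longlonglongrightarrow> 0"
          using q False by (intro LIMSEQ_power_zero) (simp add: norm_power power_less_one_iff)
        moreover have "strict_mono (\<lambda>n::nat. 2 * n + 1)" by (auto simp: strict_mono_def)
        ultimately show ?thesis by (rule LIMSEQ_subseq_LIMSEQ[unfolded o_def])
      qed
      hence "(\<lambda>n. q ^ (s * (2 * n + 1)) / P s) \<longlonglongrightarrow> 0 / P s"
        unfolding power_mult by (intro tendsto_intros nz)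
      moreover have "eventually (\<lambda>n. q ^ (s * (2 * n + 1)) / P s = a s n) sequentially"
        using eventually_gt_at_top[of s] by eventually_elim (auto simp: a_def)
      ultimately show ?thesis using False by (auto intro: Lim_transform_eventually)
    qed
  next
    have "norm (a s n) \<le> B * norm q ^ s" for s n
    proof -
      have "norm q ^ (s * (2 * n + 1)) \<le> norm q ^ s" using q by (intro power_decreasing) auto
      hence "norm (1 / P s) * norm q ^ (s * (2 * n + 1)) \<le> B * norm q ^ s"
        using B[of s] by (intro mult_mono) (auto intro: order_trans[OF norm_ge_zero])
      moreover have "B \<ge> 0" using B[of 0] by (rule order_trans[OF norm_ge_zero])
      ultimately show ?thesis by (auto simp: a_def norm_divide norm_power)
    qed
    thus "\<forall>\<^sub>F (s, n) in sequentially \<times>\<^sub>F sequentially. norm (a s n) \<le> B * norm q ^ s"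
      by (intro always_eventually) auto
    show "summable (\<lambda>s. B * norm q ^ s)" using q by (intro summable_mult summable_geometric) auto
  qed auto
  moreover have "suminf (\<lambda>s. a s n) = (\<Sum>s<n. q ^ (s * (2 * n + 1)) / P s)" for n
    by (subst suminf_finite[of "{..<n}"]) (auto simp: a_def)
  moreover have "suminf (\<lambda>s::nat. if s = 0 then 1 else 0) = (1::complex)"
    by (subst suminf_finite[of "{0}"]) auto
  ultimately have "(\<lambda>n. \<Sum>s<n. q ^ (s * (2 * n + 1)) / P s) \<longlonglongrightarrow> 1" by simp
  from tendsto_mult[OF PL this]
  have "(\<lambda>n. \<Sum>j<2 * n. q ^ (j * (j + 1) div 2)) \<longlonglongrightarrow> L"
    unfolding triangle_partial_sum[OF q] P_def by (simp add: sum_distrib_left)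
  moreover have "(\<lambda>n. \<Sum>j<2 * n. q ^ (j * (j + 1) div 2)) \<longlonglongrightarrow> triangle_gf q"
  proof -
    have "summable (\<lambda>j. q ^ (j * (j + 1) div 2))"
    proof (rule summable_comparison_test')
      show "summable (\<lambda>j. norm q ^ j)" using q by (intro summable_geometric) auto
      fix j :: nat
      have "j \<le> j * (j + 1) div 2" by (cases j) auto
      thus "norm (q ^ (j * (j + 1) div 2)) \<le> norm q ^ j"
        unfolding norm_power using q by (intro power_decreasing) auto
    qed
    hence "(\<lambda>n. \<Sum>j<n. q ^ (j * (j + 1) div 2)) \<longlonglongrightarrow> triangle_gf q"
      unfolding triangle_gf_def by (rule summable_LIMSEQ)
    moreover have "strict_mono (\<lambda>n::nat. 2 * n)" by (auto simp: strict_mono_def)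
    ultimately show ?thesis by (rule LIMSEQ_subseq_LIMSEQ[unfolded o_def])
  qed
  ultimately show ?thesis unfolding L_def by (metis LIMSEQ_unique)
qed

subsection \<open>Partial fractions of quasiperiodic functions\<close>

lemma summable_on_int_abs:
  fixes g :: "nat \<Rightarrow> real"
  assumes "summable g" "\<And>n. g n \<ge> 0"
  shows "(\<lambda>k::int. g (nat \<bar>k\<bar>)) summable_on UNIV"
proof -
  have g: "g summable_on UNIV" using assms by (intro summable_nonneg_imp_summable_on) auto
  have "(\<lambda>k. g (nat \<bar>k\<bar>)) summable_on (range int)"
    using g by (subst summable_on_reindex) (auto simp: o_def)
  moreover have "(\<lambda>k. g (nat \<bar>k\<bar>)) summable_on (range (\<lambda>n. - int n))"
    using g by (subst summable_on_reindex) (auto simp: o_def inj_def)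
  ultimately have "(\<lambda>k. g (nat \<bar>k\<bar>)) summable_on (range int \<union> range (\<lambda>n. - int n))"
    by (rule summable_on_union)
  moreover have "range int \<union> range (\<lambda>n. - int n) = UNIV"
  proof -
    have "k \<in> range int \<union> range (\<lambda>n. - int n)" for k
      by (cases "k \<ge> 0") (auto simp: image_iff intro: exI[of _ "nat k"] exI[of _ "nat (-k)"])
    thus ?thesis by blast
  qed
  ultimately show ?thesis by simp
qed

lemma summable_gaussian:
  fixes \<rho> B :: real
  assumes "0 < \<rho>" "\<rho> < 1" "B \<ge> 0"
  shows "summable (\<lambda>n. \<rho> ^ (n\<^sup>2) * B ^ n)"
proof (rule summable_comparison_test_ev)
  have "(\<lambda>n. \<rho> ^ n * B) \<longlonglongrightarrow> 0 * B"
    using assms by (intro tendsto_intros LIMSEQ_power_zero) auto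
  hence "eventually (\<lambda>n. \<rho> ^ n * B < 1/2) sequentially"
    by (intro order_tendstoD(2)) auto
  thus "eventually (\<lambda>n. norm (\<rho> ^ (n\<^sup>2) * B ^ n) \<le> (1/2) ^ n) sequentially"
  proof eventually_elim
    case (elim n)
    have "\<rho> ^ (n\<^sup>2) * B ^ n = (\<rho> ^ n * B) ^ n"
      by (simp add: power_mult_distrib power2_eq_square power_mult)
    also have "\<dots> \<le> (1/2) ^ n" using elim assms by (intro power_mono) auto
    finally show ?case using assms by simp
  qed
  show "summable (\<lambda>n. (1/2::real) ^ n)" by (rule summable_geometric) auto
qed

lemma summable_on_gaussian_int:
  fixes \<rho> B :: real
  assumes "0 < \<rho>" "\<rho> < 1" "B > 0"
  shows "(\<lambda>k::int. \<rho> powi (k\<^sup>2) * B powi k) summable_on UNIV"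
proof (rule summable_on_comparison_test)
  \<comment> \<open>One base that serves both signs of k.\<close>
  define B' where "B' = max B (1 / B)"
  have B': "B' \<ge> 0" using assms by (auto simp: B'_def)
  show "(\<lambda>k. \<rho> ^ ((nat \<bar>k\<bar>)\<^sup>2) * B' ^ (nat \<bar>k\<bar>)) summable_on UNIV"
    using assms B' by (intro summable_on_int_abs summable_gaussian) auto
  fix k :: int
  have "\<rho> powi (k\<^sup>2) = \<rho> ^ ((nat \<bar>k\<bar>)\<^sup>2)"
  proof -
    have "k\<^sup>2 = int ((nat \<bar>k\<bar>)\<^sup>2)" by simp
    thus ?thesis by (simp only: power_int_of_nat)
  qed
  moreover have "B powi k \<le> B' ^ (nat \<bar>k\<bar>)"
  proof (cases "k \<ge> 0")
    case True thus ?thesis using assms by (auto simp: power_int_def B'_def intro!: power_mono)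
  next
    case False thus ?thesis using assms
      by (auto simp: power_int_def B'_def inverse_eq_divide intro!: power_mono)
  qed
  ultimately show "\<rho> powi (k\<^sup>2) * B powi k \<le> \<rho> ^ ((nat \<bar>k\<bar>)\<^sup>2) * B' ^ (nat \<bar>k\<bar>)"
    using assms by (simp add: mult_left_mono)
qed (use assms in auto)

text \<open>The exponent 2n(n-1) is the sum of 4j over 0 <= j < n, since the j-th shift contributes
  the square of q^(2j) y. Negative n is obtained by solving the same relation backwards.\<close>

lemma quasiperiodic_powi:
  fixes f :: "complex \<Rightarrow> complex"
  assumes "q \<noteq> 0" "A \<noteq> 0" "y \<noteq> 0"
    and shift: "\<And>y. y \<noteq> 0 \<Longrightarrow> f (q\<^sup>2 * y) = A * y\<^sup>2 * f y"
  shows "f (q powi (2 * n) * y) = A powi n * q powi (2 * n * (n - 1)) * y powi (2 * n) * f y"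
proof (induction n rule: int_induct[where k = 0])
  case (step1 i)
  have "f (q powi (2 * (i + 1)) * y) = f (q\<^sup>2 * (q powi (2 * i) * y))"
    using assms by (simp add: distrib_left power_int_add mult_ac)
  also have "\<dots> = A * (q powi (2 * i) * y)\<^sup>2 * f (q powi (2 * i) * y)"
    using assms by (intro shift) auto
  also have "(q powi (2 * i) * y)\<^sup>2 = q powi (4 * i) * y\<^sup>2"
    using power_int_add[of q "2 * i" "2 * i"] assms by (simp add: power_mult_distrib power2_eq_square)
  also note step1.IH
  also have "A * (q powi (4 * i) * y\<^sup>2) * (A powi i * q powi (2 * i * (i - 1)) * y powi (2 * i) * f y) =
     (A powi i * A) * (q powi (4 * i) * q powi (2 * i * (i - 1))) * (y powi (2 * i) * y powi 2) * f y"
    by simp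
  also have "A powi i * A = A powi (i + 1)" using assms by (simp add: power_int_add)
  also have "q powi (4 * i) * q powi (2 * i * (i - 1)) = q powi (2 * (i + 1) * (i + 1 - 1))"
    using assms by (subst power_int_add[symmetric]) (auto simp: algebra_simps)
  also have "y powi (2 * i) * y powi 2 = y powi (2 * (i + 1))"
    using assms by (subst power_int_add[symmetric]) (auto simp: algebra_simps)
  finally show ?case .
next
  case (step2 i)
  define u where "u = q powi (2 * (i - 1)) * y"
  have "f (q powi (2 * i) * y) = f (q\<^sup>2 * u)"
    using assms by (simp add: u_def right_diff_distrib power_int_diff)
  also have "\<dots> = A * u\<^sup>2 * f u" using assms by (intro shift) (auto simp: u_def)
  also have "u\<^sup>2 = q powi (4 * (i - 1)) * y powi 2"
    using power_int_add[of q "2 * (i - 1)" "2 * (i - 1)"] assms by (simp add: u_def power_mult_distrib power2_eq_square)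
  finally have "A * (q powi (4 * (i - 1)) * y powi 2) * f u =
      A powi i * q powi (2 * i * (i - 1)) * y powi (2 * i) * f y"
    using step2.IH by simp
  also have "A powi i = A * A powi (i - 1)" using assms by (simp add: power_int_diff)
  also have "q powi (2 * i * (i - 1)) = q powi (4 * (i - 1)) * q powi (2 * (i - 1) * (i - 1 - 1))"
    using assms by (subst power_int_add[symmetric]) (auto simp: algebra_simps)
  also have "y powi (2 * i) = y powi 2 * y powi (2 * (i - 1))"
    using assms by (subst power_int_add[symmetric]) (auto simp: algebra_simps)
  finally show ?case using assms unfolding u_def by simp
qed auto

text \<open>An odd exponent separates |z| from 1: either |z| <= \<rho> or |z| >= 1/\<rho>, so the
  bounds do not depend on j. It is applied with z = 1 at a pole on an odd circle and y on an even
  one. The bound on z/(1-z) yields the decay at infinity.\<close>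

lemma norm_one_minus_ge:
  fixes z :: complex and j :: int
  assumes "0 < \<rho>" "\<rho> < 1" "norm z = \<rho> powi j" "odd j"
  shows "z \<noteq> 1" "norm (1 / (1 - z)) \<le> 1 / (1 - \<rho>)" "norm (z / (1 - z)) \<le> 1 / (1 - \<rho>)"
proof -
  have "z \<noteq> 1 \<and> norm (1 / (1 - z)) \<le> 1 / (1 - \<rho>) \<and> norm (z / (1 - z)) \<le> 1 / (1 - \<rho>)"
  proof (cases "j \<ge> 1")
    case True
    have "\<rho> powi j \<le> \<rho> powi 1" using True assms by (intro power_int_decreasing) auto
    hence z: "norm z \<le> \<rho>" using assms by simp
    have "norm (1 - z) \<ge> 1 - norm z" using norm_triangle_ineq2[of 1 z] by simp
    hence "norm (1 - z) \<ge> 1 - \<rho>" using z by simp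
    moreover from this have "z \<noteq> 1" using assms by auto
    ultimately show ?thesis using assms z by (auto simp: norm_divide intro!: frac_le)
  next
    case False
    hence "j \<le> -1" using assms by presburger
    hence "\<rho> powi (-1) \<le> \<rho> powi j" using assms by (intro power_int_decreasing) auto
    hence z: "norm z * \<rho> \<ge> 1" using assms by (simp add: field_simps)
    have zn: "norm z \<ge> 1"
    proof (rule ccontr)
      assume "\<not> norm z \<ge> 1"
      hence "norm z * \<rho> < 1 * 1" using assms by (intro mult_strict_mono) auto
      thus False using z by simp
    qed
    have "norm (1 - z) \<ge> norm z - 1" using norm_triangle_ineq3[of 1 z] by simp
    moreover have "norm z - 1 \<ge> norm z * (1 - \<rho>)" using z by (simp add: algebra_simps)
    ultimately have d: "norm (1 - z) \<ge> norm z * (1 - \<rho>)" by simp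
    moreover have "norm z * (1 - \<rho>) \<ge> 1 * (1 - \<rho>)" using zn assms by (intro mult_right_mono) auto
    ultimately have d': "norm (1 - z) \<ge> 1 - \<rho>" by simp
    hence "z \<noteq> 1" using assms by auto
    moreover have "norm (1 / (1 - z)) \<le> 1 / (1 - \<rho>)"
      using d' assms by (auto simp: norm_divide intro!: frac_le)
    moreover have "norm (z / (1 - z)) \<le> 1 / (1 - \<rho>)"
      using d \<open>z \<noteq> 1\<close> assms by (simp add: norm_divide divide_simps mult_ac)
    ultimately show ?thesis by simp
  qed
  thus "z \<noteq> 1" "norm (1 / (1 - z)) \<le> 1 / (1 - \<rho>)" "norm (z / (1 - z)) \<le> 1 / (1 - \<rho>)" by auto
qed

lemma powi_inject_of_less_1:
  fixes \<rho> :: real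
  assumes "0 < \<rho>" "\<rho> < 1" "\<rho> powi j = \<rho> powi k"
  shows "j = k"
  using assms power_int_strict_decreasing[of j k \<rho>] power_int_strict_decreasing[of k j \<rho>]
  by (cases j k rule: linorder_cases) auto

text \<open>The poles form one orbit under multiplication by q^2 for each i, so \<open>lim\<close>
  describes f at one pole per orbit and \<open>shift\<close> carries this to the others. Distinct x
  i of modulus 1 give disjoint orbits, hence simple poles.\<close>

locale quasiperiodic_poles =
  fixes q A :: complex and f :: "complex \<Rightarrow> complex" and I :: "'a set" and x :: "'a \<Rightarrow> complex"
    and R :: "'a \<Rightarrow> complex"
  assumes q0: "q \<noteq> 0" and q1: "norm q < 1" and I: "finite I"
    and x: "\<And>i. i \<in> I \<Longrightarrow> norm (x i) = 1" and inj: "inj_on x I"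
    and A: "A \<noteq> 0"
    and hol: "f holomorphic_on {y. y \<noteq> 0 \<and> (\<forall>i\<in>I. \<forall>k. q powi (2 * k - 1) * x i * y \<noteq> 1)}"
    and shift: "\<And>y. y \<noteq> 0 \<Longrightarrow> f (q\<^sup>2 * y) = A * y\<^sup>2 * f y"
    and lim: "\<And>i. i \<in> I \<Longrightarrow> ((\<lambda>y. (1 - x i * y / q) * f y) \<longlongrightarrow> R i) (at (q / x i))"
begin

text \<open>This is the limit of f times 1 - y / \<open>node i k\<close>, that is, the ordinary
  residue divided by - \<open>node i k\<close>. With this normalization the principal part is
  \<open>res i k / (1 - ...)\<close> and behaves well both at 0 and at infinity.\<close>

definition res :: "'a \<Rightarrow> int \<Rightarrow> complex" where
  "res i k = R i * A powi (- k) * q powi (2 * k\<^sup>2) * x i powi (2 * k)"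

definition node :: "'a \<Rightarrow> int \<Rightarrow> complex" where
  "node i k = q powi (1 - 2 * k) / x i"

definition cut :: "nat \<Rightarrow> complex \<Rightarrow> complex" where
  "cut N y = (\<Sum>(i, k)\<in>I \<times> {- int N..int N}. res i k / (1 - q powi (2 * k - 1) * x i * y))"

lemma x0: "i \<in> I \<Longrightarrow> x i \<noteq> 0" using x by force

lemma norm_node: "i \<in> I \<Longrightarrow> norm (node i k) = norm q powi (1 - 2 * k)"
  using x by (simp add: node_def norm_divide norm_power_int)

lemma node_iff: "i \<in> I \<Longrightarrow> q powi (2 * k - 1) * x i * y = 1 \<longleftrightarrow> y = node i k"
  using x0[of i] q0 by (auto simp: node_def field_simps power_int_diff)

lemma node_inj: "i \<in> I \<Longrightarrow> j \<in> I \<Longrightarrow> node i k = node j l \<longleftrightarrow> i = j \<and> k = l"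
proof
  assume ij: "i \<in> I" "j \<in> I" and eq: "node i k = node j l"
  hence "norm q powi (1 - 2 * k) = norm q powi (1 - 2 * l)" by (metis norm_node)
  hence "1 - 2 * k = 1 - 2 * l" using q0 q1 by (intro powi_inject_of_less_1[of "norm q"]) auto
  hence kl: "k = l" by simp
  with eq have "x i = x j" using q0 x0 ij by (auto simp: node_def field_simps)
  thus "i = j \<and> k = l" using inj ij kl by (auto dest: inj_onD)
qed auto

text \<open>The substitution u = q^(2k) y takes \<open>node i k\<close> to q / x i, and
  \<open>quasiperiodic_powi\<close> expresses f y through f u. The function g is the resulting
  expression in u.\<close>

lemma tendsto_residue:
  assumes i: "i \<in> I"
  shows "((\<lambda>y. (1 - q powi (2 * k - 1) * x i * y) * f y) \<longlongrightarrow> res i k) (at (node i k))"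
proof -
  have lim1: "filterlim (\<lambda>y. q powi (2 * k) * y) (at (q / x i)) (at (node i k))"
  proof (rule filterlim_atI)
    have *: "q powi (2 * k) * node i k = q / x i"
      using q0 x0[OF i] by (simp add: node_def power_int_diff)
    show "((\<lambda>y. q powi (2 * k) * y) \<longlongrightarrow> q / x i) (at (node i k))"
      unfolding *[symmetric] by (intro tendsto_intros)
    have "\<forall>\<^sub>F y in at (node i k). y \<noteq> node i k" by (simp add: eventually_at_filter)
    thus "\<forall>\<^sub>F y in at (node i k). q powi (2 * k) * y \<noteq> q / x i"
      by eventually_elim (use q0 x0[OF i] in \<open>auto simp: node_def power_int_diff field_simps\<close>)
  qed
  define g where "g u = A powi (- k) * q powi (2 * k * (k + 1)) * u powi (- (2 * k)) * ((1 - x i * u / q) * f u)" for u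
  have "q / x i \<noteq> 0" using q0 x0[OF i] by auto
  hence "(g \<longlongrightarrow> A powi (- k) * q powi (2 * k * (k + 1)) * (q / x i) powi (- (2 * k)) * R i) (at (q / x i))"
    unfolding g_def by (intro tendsto_intros lim[OF i]) auto
  also have "A powi (- k) * q powi (2 * k * (k + 1)) * (q / x i) powi (- (2 * k)) * R i = res i k"
  proof -
    have "(q / x i) powi (- (2 * k)) = q powi (- (2 * k)) * x i powi (2 * k)"
      using q0 x0[OF i] by (simp add: power_int_divide_distrib power_int_minus field_simps)
    moreover have "q powi (2 * k * (k + 1)) * q powi (- (2 * k)) = q powi (2 * k\<^sup>2)"
      using q0 by (subst power_int_add[symmetric]) (auto simp: algebra_simps power2_eq_square)
    ultimately show ?thesis by (simp add: res_def)
  qed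
  finally have "((\<lambda>y. g (q powi (2 * k) * y)) \<longlongrightarrow> res i k) (at (node i k))"
    using lim1 by (rule filterlim_compose)
  moreover have "\<forall>\<^sub>F y in at (node i k). g (q powi (2 * k) * y) = (1 - q powi (2 * k - 1) * x i * y) * f y"
  proof -
    have "node i k \<noteq> 0" using q0 x0[OF i] by (auto simp: node_def)
    hence "\<forall>\<^sub>F y in at (node i k). y \<noteq> 0"
      using tendsto_imp_eventually_ne[OF tendsto_ident_at] by blast
    thus ?thesis
    proof eventually_elim
      case (elim y)
      define u where "u = q powi (2 * k) * y"
      have u: "u \<noteq> 0" using elim q0 by (simp add: u_def)
      have "q powi (2 * (- k)) * u = y" using q0 by (simp add: u_def flip: power_int_add)
      hence "f y = A powi (- k) * q powi (2 * (- k) * (- k - 1)) * u powi (2 * (- k)) * f u"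
        using quasiperiodic_powi[OF q0 A u shift, of "- k"] by simp
      also have "2 * (- k) * (- k - 1) = 2 * k * (k + 1)" by (simp add: algebra_simps)
      finally have "f y = A powi (- k) * q powi (2 * k * (k + 1)) * u powi (- (2 * k)) * f u" by simp
      moreover have "q powi (2 * k - 1) * x i * y = x i * u / q" using q0 by (simp add: u_def power_int_diff)
      ultimately show ?case by (simp add: g_def u_def)
    qed
  qed
  ultimately show ?thesis by (rule Lim_transform_eventually)
qed

text \<open>Gaussian decay absorbs any geometric weight. The weight 1 is needed near 0 and the
  weight 1/|q|^2 pays for a factor y near infinity.\<close>

lemma summable_res:
  assumes "\<sigma> > (0::real)"
  shows "(\<lambda>(i, k). norm (res i k) * \<sigma> powi k) summable_on (I \<times> UNIV)"
proof -
  have "(\<lambda>k. norm (res i k) * \<sigma> powi k) summable_on UNIV" if i: "i \<in> I" for i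
  proof -
    have "norm (res i k) * \<sigma> powi k = norm (R i) * ((norm q ^ 2) powi (k\<^sup>2) * (\<sigma> / norm A) powi k)" for k
    proof -
      have "norm (res i k) = norm (R i) * inverse (norm A powi k) * norm q powi (2 * k\<^sup>2)"
        unfolding res_def norm_mult norm_power_int x[OF i] power_int_minus norm_inverse by simp
      moreover have "norm q powi (2 * k\<^sup>2) = (norm q ^ 2) powi (k\<^sup>2)"
        unfolding power_int_mult by simp
      ultimately show ?thesis unfolding power_int_divide_distrib by (simp only: divide_inverse mult_ac)
    qed
    moreover have "(\<lambda>k. norm (R i) * ((norm q ^ 2) powi (k\<^sup>2) * (\<sigma> / norm A) powi k)) summable_on UNIV"
      using q0 q1 A assms by (intro summable_on_cmult_right summable_on_gaussian_int) (auto simp: power_less_one_iff)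
    ultimately show ?thesis by presburger
  qed
  thus ?thesis
    using I assms by (intro summable_on_SigmaI[where g = "\<lambda>i. infsum (\<lambda>k. norm (res i k) * \<sigma> powi k) UNIV"])
      (auto intro!: has_sum_infsum simp: split_beta)
qed

text \<open>Both boundary circles of S pass through poles. The poles inside S have -N < k <= N and
  are cancelled by \<open>cut N\<close>; the summand with k = -N has its pole on the inner boundary
  circle and is holomorphic in S.\<close>

lemma extends_holomorphic:
  fixes N :: nat
  defines "S \<equiv> {y. norm q powi (2 * int N + 1) < norm y \<and> norm y < norm q powi (- (2 * int N + 1))}"
  shows "\<exists>h. h holomorphic_on S \<and> (\<forall>y\<in>S. (\<forall>i\<in>I. \<forall>k. y \<noteq> node i k) \<longrightarrow> h y = f y - cut N y)"
proof -
  define W where "W = {w \<in> S. \<exists>i\<in>I. \<exists>k\<in>{- int N..int N}. w = node i k}"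
  have \<rho>: "0 < norm q" "norm q < 1" using q0 q1 by auto
  have S0: "y \<noteq> 0" if "y \<in> S" for y
  proof -
    have "0 < norm q powi (2 * int N + 1)" using \<rho> by (intro zero_less_power_int)
    also have "\<dots> < norm y" using that by (simp add: S_def)
    finally show ?thesis by simp
  qed
  have "open S"
    unfolding S_def by (intro open_Collect_conj open_Collect_less continuous_intros)
  have "W \<subseteq> (\<lambda>(i, k). node i k) ` (I \<times> {- int N..int N})" by (auto simp: W_def)
  hence "finite W" by (rule finite_subset) (use I in auto)
  have node_W: "k \<in> {- int N..int N}" if "i \<in> I" "node i k \<in> S" for i k
  proof -
    have less: "norm q powi (2 * int N + 1) < norm q powi (1 - 2 * k)"
      "norm q powi (1 - 2 * k) < norm q powi (- (2 * int N + 1))"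
      using that by (simp_all add: S_def norm_node)
    have "norm q powi b \<le> norm q powi a" if "a \<le> b" for a b
      using that \<rho> by (intro power_int_decreasing) auto
    hence "\<not> (1 - 2 * k \<ge> 2 * int N + 1)" "\<not> (- (2 * int N + 1) \<ge> 1 - 2 * k)"
      using less by (meson not_less)+
    thus ?thesis by auto
  qed
  have SW: "y \<noteq> node i k" if "y \<in> S - W" "i \<in> I" for y i k
    using that node_W[of i k] unfolding W_def by blast
  have "(\<lambda>y. f y - cut N y) holomorphic_on S - W"
  proof (intro holomorphic_on_diff)
    show "f holomorphic_on S - W"
      using hol by (rule holomorphic_on_subset) (use S0 SW node_iff in auto)
    show "cut N holomorphic_on S - W"
      unfolding cut_def split_beta using SW node_iff by (auto intro!: holomorphic_intros)
  qed
  \<comment> \<open>Multiplied by 1 - z, both f and the summand of \<open>cut N\<close> with index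
    (i, k) tend to \<open>res i k\<close> at w, so their difference tends to 0 and Riemann's theorem
    removes the singularity.\<close>
  moreover have "(\<lambda>y. f y - cut N y) \<in> O[at w](\<lambda>_. 1)" if w: "w \<in> W" for w
  proof -
    from w obtain i k where i: "i \<in> I" and k: "k \<in> {- int N..int N}" and wik: "w = node i k"
      by (auto simp: W_def)
    define z where "z y = q powi (2 * k - 1) * x i * y" for y
    have nz: "(1 - z y) \<noteq> 0" if "y \<noteq> w" for y using that node_iff[OF i, of k y] by (auto simp: z_def wik)
    have zw: "z w = 1" using node_iff[OF i, of k w] by (simp add: z_def wik)
    have zlim: "((\<lambda>y. 1 - z y) \<longlongrightarrow> 0) (at w)"
    proof -
      have "((\<lambda>y. 1 - z y) \<longlongrightarrow> 1 - z w) (at w)" unfolding z_def by (intro tendsto_intros)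
      thus ?thesis by (simp add: zw)
    qed
    let ?J = "I \<times> {- int N..int N} - {(i, k)}"
    have fin: "finite (I \<times> {- int N..int N})" using I by auto
    have rest: "((\<lambda>y. (1 - z y) * (\<Sum>(j, l)\<in>?J. res j l / (1 - q powi (2 * l - 1) * x j * y)))
        \<longlongrightarrow> 0 * (\<Sum>(j, l)\<in>?J. res j l / (1 - q powi (2 * l - 1) * x j * w))) (at w)"
    proof -
      have "1 - q powi (2 * l - 1) * x j * w \<noteq> 0" if "(j, l) \<in> ?J" for j l
        using that node_iff[of j l w] node_inj[of i j k l] i by (auto simp: wik)
      thus ?thesis unfolding split_beta
        by (intro tendsto_mult zlim tendsto_sum tendsto_divide tendsto_intros) (metis prod.collapse)
    qed
    have "((\<lambda>y. (1 - z y) * f y - res i k -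
        (1 - z y) * (\<Sum>(j, l)\<in>?J. res j l / (1 - q powi (2 * l - 1) * x j * y))) \<longlongrightarrow> res i k - res i k - 0) (at w)"
      using tendsto_diff[OF tendsto_diff[OF tendsto_residue[OF i, of k] tendsto_const[of "res i k"]] rest[unfolded wik mult_zero_left]]
      by (simp add: z_def wik)
    moreover have "\<forall>\<^sub>F y in at w. (1 - z y) * f y - res i k -
        (1 - z y) * (\<Sum>(j, l)\<in>?J. res j l / (1 - q powi (2 * l - 1) * x j * y)) = (1 - z y) * (f y - cut N y)"
    proof -
      have "\<forall>\<^sub>F y in at w. y \<noteq> w" by (simp add: eventually_at_filter)
      thus ?thesis
      proof eventually_elim
        case (elim y)
        have "cut N y = res i k / (1 - z y) + (\<Sum>(j, l)\<in>?J. res j l / (1 - q powi (2 * l - 1) * x j * y))"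
          unfolding cut_def by (subst sum.remove[OF fin, of "(i, k)"]) (use i k in \<open>auto simp: z_def\<close>)
        thus ?case using nz[OF elim] by (simp only: right_diff_distrib[of "1 - z y"] distrib_left) simp
      qed
    qed
    ultimately have "((\<lambda>y. (1 - z y) * (f y - cut N y)) \<longlongrightarrow> 0) (at w)"
      by (auto intro: Lim_transform_eventually)
    hence "((\<lambda>y. - w * ((1 - z y) * (f y - cut N y))) \<longlongrightarrow> - w * 0) (at w)"
      by (intro tendsto_mult tendsto_const)
    moreover have "- w * ((1 - z y) * (f y - cut N y)) = (y - w) * (f y - cut N y)" for y
    proof -
      have "w * z y = y" using q0 x0[OF i] by (simp add: wik z_def node_def power_int_diff)
      hence "- w * (1 - z y) = y - w" by (simp add: algebra_simps)
      thus ?thesis by (metis mult.assoc)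
    qed
    ultimately have lim0: "((\<lambda>y. (y - w) * (f y - cut N y)) \<longlongrightarrow> 0) (at w)" by simp
    define V where "V = S - (W - {w})"
    have "open V" unfolding V_def using \<open>open S\<close> \<open>finite W\<close> by (intro open_Diff finite_imp_closed) auto
    have "w \<in> V" using w by (auto simp: V_def W_def)
    have "(\<lambda>y. f y - cut N y) holomorphic_on V - {w}"
      using \<open>(\<lambda>y. f y - cut N y) holomorphic_on S - W\<close> by (rule holomorphic_on_subset) (auto simp: V_def)
    from holomorphic_on_extend_lim[OF this] holomorphic_on_extend_bounded[OF this] lim0 \<open>w \<in> V\<close> \<open>open V\<close>
    obtain B where "eventually (\<lambda>y. norm (f y - cut N y) \<le> B) (at w)"
      by (auto simp: interior_open)
    thus ?thesis by (intro bigoI[of _ B]) simp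
  qed
  ultimately have "\<exists>h. h holomorphic_on S \<and> (\<forall>y\<in>S - W. h y = f y - cut N y)"
    using \<open>finite W\<close> \<open>open S\<close> by (intro removable_singularities) (auto simp: W_def interior_open)
  moreover have "y \<in> S - W" if "y \<in> S" "\<forall>i\<in>I. \<forall>k. y \<noteq> node i k" for y
    using that by (auto simp: W_def)
  ultimately show ?thesis by blast
qed

text \<open>A power of q^2 moves each such circle to the unit circle, which carries no pole by
  parity, so compactness bounds f there.\<close>

lemma norm_on_circle:
  obtains B where "B \<ge> 0"
    "\<And>y n. norm y = norm q powi (2 * n) \<Longrightarrow> norm (f y) \<le> B * norm A powi n * norm q powi (2 * n * (n - 1))"
proof -
  have \<rho>: "0 < norm q" "norm q < 1" using q0 q1 by auto
  have "continuous_on (sphere 0 1) f"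
  proof (rule continuous_on_subset[OF holomorphic_on_imp_continuous_on[OF hol]], safe)
    fix y :: complex and i k assume y: "y \<in> sphere 0 1" and i: "i \<in> I" and "q powi (2 * k - 1) * x i * y = 1"
    moreover have "norm (q powi (2 * k - 1) * x i * y) = norm q powi (2 * k - 1)"
      using x[OF i] y by (simp add: norm_mult norm_power_int)
    ultimately show False using norm_one_minus_ge(1)[OF \<rho>, of _ "2 * k - 1"] by auto
  qed auto
  hence "compact (f ` sphere 0 1)" by (intro compact_continuous_image) auto
  then obtain B where B: "\<And>y. norm y = 1 \<Longrightarrow> norm (f y) \<le> B"
    using compact_imp_bounded bounded_iff by (metis dist_0_norm imageI mem_sphere)
  have "norm (f y) \<le> B * norm A powi n * norm q powi (2 * n * (n - 1))"
    if y: "norm y = norm q powi (2 * n)" for y n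
  proof -
    define u where "u = y / q powi (2 * n)"
    have u: "norm u = 1" using y q0 by (simp add: u_def norm_divide norm_power_int)
    hence "u \<noteq> 0" by auto
    have "y = q powi (2 * n) * u" using q0 by (simp add: u_def)
    hence "f y = A powi n * q powi (2 * n * (n - 1)) * u powi (2 * n) * f u"
      using quasiperiodic_powi[OF q0 A \<open>u \<noteq> 0\<close> shift, of n] by simp
    hence "norm (f y) = norm A powi n * norm q powi (2 * n * (n - 1)) * norm (f u)"
      using u by (simp only: norm_mult norm_power_int power_int_1_left mult_1_right)
    also have "\<dots> \<le> norm A powi n * norm q powi (2 * n * (n - 1)) * B"
      by (intro mult_left_mono B u) auto
    finally show ?thesis by (simp only: mult_ac)
  qed
  moreover have "B \<ge> 0" using order_trans[OF norm_ge_zero B[of 1]] by simp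
  ultimately show thesis using that by blast
qed

text \<open>Both bounds are independent of n and of N: the truncations are bounded near 0 and of
  order 1/y at infinity, uniformly on the even circles.\<close>

lemma norm_cut_le:
  assumes y: "norm y = norm q powi (2 * n)"
  shows "norm (cut N y) \<le> (\<Sum>\<^sub>\<infinity>(i, k)\<in>I \<times> UNIV. norm (res i k) * 1 powi k) / (1 - norm q)"
    and "norm (cut N y) * norm y \<le>
      (\<Sum>\<^sub>\<infinity>(i, k)\<in>I \<times> UNIV. norm (res i k) * (1 / (norm q)\<^sup>2) powi k) / (1 - norm q)"
proof -
  have \<rho>: "0 < norm q" "norm q < 1" using q0 q1 by auto
  have fin: "finite (I \<times> {- int N..int N})" using I by auto
  have z: "norm (q powi (2 * k - 1) * x i * y) = norm q powi (2 * k - 1 + 2 * n)" if "i \<in> I" for i k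
    using x[OF that] y \<rho> by (simp add: norm_mult norm_power_int power_int_add)
  have "norm (cut N y) \<le> (\<Sum>(i, k)\<in>I \<times> {- int N..int N}. norm (res i k) * 1 powi k * (1 / (1 - norm q)))"
    unfolding cut_def
  proof (rule order_trans[OF norm_sum], rule sum_mono, safe)
    fix i k assume i: "i \<in> I"
    have "norm (res i k * (1 / (1 - q powi (2 * k - 1) * x i * y))) \<le> norm (res i k) * (1 / (1 - norm q))"
      unfolding norm_mult using norm_one_minus_ge(2)[OF \<rho> z[OF i, of k]] by (intro mult_left_mono) auto
    thus "norm (res i k / (1 - q powi (2 * k - 1) * x i * y)) \<le> norm (res i k) * 1 powi k * (1 / (1 - norm q))"
      by simp
  qed
  also have "\<dots> = (\<Sum>(i, k)\<in>I \<times> {- int N..int N}. norm (res i k) * 1 powi k) / (1 - norm q)"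
    by (simp add: sum_divide_distrib split_beta)
  also have "\<dots> \<le> (\<Sum>\<^sub>\<infinity>(i, k)\<in>I \<times> UNIV. norm (res i k) * 1 powi k) / (1 - norm q)"
    using \<rho> by (intro divide_right_mono finite_sum_le_infsum summable_res fin) auto
  finally show "norm (cut N y) \<le> (\<Sum>\<^sub>\<infinity>(i, k)\<in>I \<times> UNIV. norm (res i k) * 1 powi k) / (1 - norm q)" .
  have "norm (cut N y) * norm y \<le>
      (\<Sum>(i, k)\<in>I \<times> {- int N..int N}. norm (res i k) * (1 / (norm q)\<^sup>2) powi k * (1 / (1 - norm q)))"
    unfolding cut_def norm_mult[symmetric] sum_distrib_right
  proof (rule order_trans[OF norm_sum], rule sum_mono, safe)
    fix i k assume i: "i \<in> I"
    \<comment> \<open>Since |y| = |q|^(1-2k) |z|, the factor y can be traded for z, and z/(1-z) is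
      bounded. The price |q|^(-2k), up to one harmless factor |q|, goes into the weight of
      \<open>summable_res\<close>.\<close>
    define z where "z = q powi (2 * k - 1) * x i * y"
    have "norm (z / (1 - z)) \<le> 1 / (1 - norm q)"
      using norm_one_minus_ge(3)[OF \<rho> z[OF i, of k]] by (simp add: z_def)
    hence "norm (res i k) * norm q powi (1 - 2 * k) * norm (z / (1 - z)) \<le>
           norm (res i k) * norm q powi (1 - 2 * k) * (1 / (1 - norm q))"
      by (intro mult_left_mono) auto
    also have "\<dots> \<le> norm (res i k) * norm q powi (- 2 * k) * (1 / (1 - norm q))"
      using \<rho> by (intro mult_right_mono mult_left_mono power_int_decreasing) auto
    also have "norm q powi (- 2 * k) = (1 / (norm q)\<^sup>2) powi k"
      by (simp add: power_int_minus power_int_mult power_int_divide_distrib inverse_eq_divide)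
    finally have "norm (res i k) * norm q powi (1 - 2 * k) * norm (z / (1 - z)) \<le>
        norm (res i k) * (1 / (norm q)\<^sup>2) powi k * (1 / (1 - norm q))" .
    moreover have "norm (res i k / (1 - z) * y) = norm (res i k) * norm q powi (1 - 2 * k) * norm (z / (1 - z))"
    proof -
      have "norm q powi (1 - 2 * k) * norm q powi (2 * k - 1) = 1" using \<rho> by (simp flip: power_int_add)
      moreover have "norm z = norm q powi (2 * k - 1) * norm y"
        using x[OF i] by (simp add: z_def norm_mult norm_power_int)
      ultimately have "norm q powi (1 - 2 * k) * norm z = norm y" by (metis mult.assoc mult_1)
      hence "norm y / norm (1 - z) = norm q powi (1 - 2 * k) * norm z / norm (1 - z)" by simp
      hence "norm (res i k) * (norm y / norm (1 - z)) = norm (res i k) * (norm q powi (1 - 2 * k) * norm z / norm (1 - z))"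
        by (rule arg_cong)
      thus ?thesis by (simp only: norm_mult norm_divide times_divide_eq_left times_divide_eq_right mult_ac)
    qed
    ultimately show "norm (res i k / (1 - q powi (2 * k - 1) * x i * y) * y)
        \<le> norm (res i k) * (1 / (norm q)\<^sup>2) powi k * (1 / (1 - norm q))" by (simp add: z_def)
  qed
  also have "\<dots> = (\<Sum>(i, k)\<in>I \<times> {- int N..int N}. norm (res i k) * (1 / (norm q)\<^sup>2) powi k) / (1 - norm q)"
    by (simp add: sum_divide_distrib split_beta)
  also have "\<dots> \<le> (\<Sum>\<^sub>\<infinity>(i, k)\<in>I \<times> UNIV. norm (res i k) * (1 / (norm q)\<^sup>2) powi k) / (1 - norm q)"
    using \<rho> by (intro divide_right_mono finite_sum_le_infsum summable_res fin) auto
  finally show "norm (cut N y) * norm y \<le>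
      (\<Sum>\<^sub>\<infinity>(i, k)\<in>I \<times> UNIV. norm (res i k) * (1 / (norm q)\<^sup>2) powi k) / (1 - norm q)" .
qed

text \<open>Maximum modulus on an annulus between two even circles. The two lines of the bound come
  from the outer and the inner circle, each weighted by the square root of |y| there; squaring h
  replaces the multivalued square root of y by y.\<close>

lemma norm_diff_cut_le:
  assumes B: "\<And>y n. norm y = norm q powi (2 * n) \<Longrightarrow> norm (f y) \<le> B * norm A powi n * norm q powi (2 * n * (n - 1))"
    and C0: "\<And>y n. norm y = norm q powi (2 * n) \<Longrightarrow> norm (cut N y) \<le> C0"
    and C1: "\<And>y n. norm y = norm q powi (2 * n) \<Longrightarrow> norm (cut N y) * norm y \<le> C1"
    and y: "norm y = 1"
  shows "norm (f y - cut N y) \<le>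
           norm q powi (- int N) * (B * norm A powi (- int N) * norm q powi (2 * int N * (int N + 1))) + norm q powi int N * C1
         + norm q powi int N * (B * norm A powi int N * norm q powi (2 * int N * (int N - 1)) + C0)"
    (is "_ \<le> ?e1 + ?e2")
proof -
  define \<rho> where "\<rho> = norm q"
  have \<rho>: "0 < \<rho>" "\<rho> < 1" using q0 q1 by (auto simp: \<rho>_def)
  have dec: "\<rho> powi b \<le> \<rho> powi a" if "a \<le> b" for a b using that \<rho> by (intro power_int_decreasing) auto
  have sdec: "\<rho> powi b < \<rho> powi a" if "a < b" for a b using that \<rho> by (intro power_int_strict_decreasing) auto
  define S where "S = {y :: complex. \<rho> powi (2 * int N + 1) < norm y \<and> norm y < \<rho> powi (- (2 * int N + 1))}"
  define K where "K = {y :: complex. \<rho> powi (2 * int N) \<le> norm y \<and> norm y \<le> \<rho> powi (- (2 * int N))}"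
  obtain h where h: "h holomorphic_on S"
    and h_eq: "\<And>y. y \<in> S \<Longrightarrow> (\<forall>i\<in>I. \<forall>k. y \<noteq> node i k) \<Longrightarrow> h y = f y - cut N y"
    using extends_holomorphic[of N] unfolding S_def \<rho>_def by blast
  have not_node: "\<forall>i\<in>I. \<forall>k. z \<noteq> node i k" if "norm z = \<rho> powi (2 * n)" for z n
  proof (intro ballI allI notI)
    fix i k assume "i \<in> I" "z = node i k"
    hence "\<rho> powi (2 * n) = \<rho> powi (1 - 2 * k)" using that norm_node[of i k] by (simp add: \<rho>_def)
    hence "2 * n = 1 - 2 * k" using \<rho> by (intro powi_inject_of_less_1[of \<rho>])
    thus False by presburger
  qed
  have "K \<subseteq> S"
    unfolding K_def S_def using sdec[of "2 * int N" "2 * int N + 1"] sdec[of "- (2 * int N + 1)" "- (2 * int N)"]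
    by auto
  have "closed K" unfolding K_def by (intro closed_Collect_conj closed_Collect_le continuous_intros)
  have e: "?e1 \<ge> 0" "?e2 \<ge> 0"
  proof -
    have "norm (1::complex) = norm q powi (2 * 0)" by simp
    from order_trans[OF norm_ge_zero B[OF this]] order_trans[OF norm_ge_zero C0[OF this]]
      order_trans[OF mult_nonneg_nonneg[OF norm_ge_zero norm_ge_zero] C1[OF this]]
    have "B \<ge> 0" "C0 \<ge> 0" "C1 \<ge> 0" by auto
    thus "?e1 \<ge> 0" "?e2 \<ge> 0" by auto
  qed
  \<comment> \<open>\<open>cut N\<close> is only bounded near \<open>0\<close> but decays like \<open>1/y\<close> at infinity; with the factor \<open>y\<close> the square
    is small on both boundary circles.\<close>
  have "norm (y * (h y)\<^sup>2) \<le> (?e1 + ?e2)\<^sup>2"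
  proof (rule maximum_modulus_frontier[where S = K and f = "\<lambda>y. y * (h y)\<^sup>2"])
    have "h holomorphic_on K" using h \<open>K \<subseteq> S\<close> by (rule holomorphic_on_subset)
    hence H: "(\<lambda>y. y * (h y)\<^sup>2) holomorphic_on K" by (intro holomorphic_intros)
    thus "(\<lambda>y. y * (h y)\<^sup>2) holomorphic_on interior K" using interior_subset by (rule holomorphic_on_subset)
    show "continuous_on (closure K) (\<lambda>y. y * (h y)\<^sup>2)"
      using holomorphic_on_imp_continuous_on[OF H] \<open>closed K\<close> by simp
    show "bounded K" unfolding bounded_iff K_def by auto
    show "y \<in> K" using y dec[of 0 "2 * int N"] dec[of "- (2 * int N)" 0] by (auto simp: K_def)
    fix z assume z: "z \<in> frontier K"
    define U where "U = {y :: complex. \<rho> powi (2 * int N) < norm y \<and> norm y < \<rho> powi (- (2 * int N))}"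
    have "open U" unfolding U_def by (intro open_Collect_conj open_Collect_less continuous_intros)
    hence "U \<subseteq> interior K" by (intro interior_maximal) (auto simp: U_def K_def)
    hence "z \<notin> U" "z \<in> K" using z \<open>closed K\<close> by (auto simp: frontier_def)
    hence cases: "norm z = \<rho> powi (2 * int N) \<or> norm z = \<rho> powi (2 * (- int N))" by (auto simp: U_def K_def)
    hence hz: "h z = f z - cut N z" using h_eq not_node \<open>z \<in> K\<close> \<open>K \<subseteq> S\<close> by blast
    have tri: "norm (h z) \<le> norm (f z) + norm (cut N z)" unfolding hz by (rule norm_triangle_ineq4)
    from cases show "norm (z * (h z)\<^sup>2) \<le> (?e1 + ?e2)\<^sup>2"
    proof
      assume nz: "norm z = \<rho> powi (2 * int N)"
      have sq: "norm z = (\<rho> powi int N)\<^sup>2" using power_int_add[of \<rho> "int N" "int N"] \<rho> by (simp add: nz power2_eq_square)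
      have "\<rho> powi int N * norm (h z) \<le> ?e2"
        using tri B[of z "int N"] C0[of z "int N"] nz \<rho> unfolding \<rho>_def[symmetric] by (intro mult_left_mono) auto
      hence "\<rho> powi int N * norm (h z) \<le> ?e1 + ?e2" using e by linarith
      hence "(\<rho> powi int N * norm (h z))\<^sup>2 \<le> (?e1 + ?e2)\<^sup>2" using \<rho> by (intro power_mono) auto
      thus ?thesis by (simp add: norm_mult norm_power sq power_mult_distrib)
    next
      assume nz: "norm z = \<rho> powi (2 * (- int N))"
      have sq: "norm z = (\<rho> powi (- int N))\<^sup>2"
        using power_int_add[of \<rho> "- int N" "- int N"] \<rho> by (simp add: nz power2_eq_square)
      have "norm (cut N z) * norm z \<le> C1" using C1[of z "- int N"] nz by (simp add: \<rho>_def)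
      hence "\<rho> powi int N * (norm (cut N z) * norm z) \<le> \<rho> powi int N * C1"
        using \<rho> by (intro mult_left_mono) auto
      moreover have "\<rho> powi int N * norm z = \<rho> powi (- int N)"
        unfolding nz using \<rho> by (subst power_int_add[symmetric]) auto
      ultimately have c: "\<rho> powi (- int N) * norm (cut N z) \<le> \<rho> powi int N * C1"
        by (metis mult.assoc mult.commute)
      have "2 * (- int N) * (- int N - 1) = 2 * int N * (int N + 1)" by (simp add: algebra_simps)
      hence "norm (f z) \<le> B * norm A powi (- int N) * norm q powi (2 * int N * (int N + 1))"
        using B[of z "- int N"] nz unfolding \<rho>_def by metis
      hence "\<rho> powi (- int N) * norm (f z) \<le>
          \<rho> powi (- int N) * (B * norm A powi (- int N) * norm q powi (2 * int N * (int N + 1)))"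
        using \<rho> by (intro mult_left_mono) auto
      moreover have "\<rho> powi (- int N) * norm (h z) \<le> \<rho> powi (- int N) * (norm (f z) + norm (cut N z))"
        using \<rho> tri by (intro mult_left_mono) auto
      ultimately have "\<rho> powi (- int N) * norm (h z) \<le> ?e1"
        using c unfolding \<rho>_def[symmetric] by (simp add: distrib_left)
      hence "\<rho> powi (- int N) * norm (h z) \<le> ?e1 + ?e2" using e by linarith
      hence "(\<rho> powi (- int N) * norm (h z))\<^sup>2 \<le> (?e1 + ?e2)\<^sup>2" using \<rho> by (intro power_mono) auto
      thus ?thesis by (simp add: norm_mult norm_power sq power_mult_distrib)
    qed
  qed
  hence "(norm (h y))\<^sup>2 \<le> (?e1 + ?e2)\<^sup>2" using y by (simp add: norm_mult norm_power)
  hence "norm (h y) \<le> ?e1 + ?e2" by (rule power2_le_imp_le) (rule add_nonneg_nonneg[OF e])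
  moreover have "h y = f y - cut N y"
  proof (rule h_eq)
    show "y \<in> S" using y sdec[of 0 "2 * int N + 1"] sdec[of "- (2 * int N + 1)" 0] by (auto simp: S_def)
    show "\<forall>i\<in>I. \<forall>k. y \<noteq> node i k" using not_node[of y 0] y by simp
  qed
  ultimately show ?thesis by simp
qed

theorem partial_fractions:
  assumes y: "norm y = 1"
  shows "((\<lambda>(i, k). res i k / (1 - q powi (2 * k - 1) * x i * y)) has_sum f y) (I \<times> UNIV)"
proof -
  define \<rho> where "\<rho> = norm q"
  have \<rho>: "0 < \<rho>" "\<rho> < 1" using q0 q1 by (auto simp: \<rho>_def)
  define t where "t = (\<lambda>(i, k). res i k / (1 - q powi (2 * k - 1) * x i * y))"
  obtain B where B: "B \<ge> 0"
    "\<And>y n. norm y = norm q powi (2 * n) \<Longrightarrow> norm (f y) \<le> B * norm A powi n * norm q powi (2 * n * (n - 1))"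
    using norm_on_circle by blast
  define C0 where "C0 = (\<Sum>\<^sub>\<infinity>(i, k)\<in>I \<times> UNIV. norm (res i k) * 1 powi k) / (1 - norm q)"
  define C1 where "C1 = (\<Sum>\<^sub>\<infinity>(i, k)\<in>I \<times> UNIV. norm (res i k) * (1 / (norm q)\<^sup>2) powi k) / (1 - norm q)"
  define e where "e N = norm q powi (- int N) * (B * norm A powi (- int N) * norm q powi (2 * int N * (int N + 1))) + norm q powi int N * C1
         + norm q powi int N * (B * norm A powi int N * norm q powi (2 * int N * (int N - 1)) + C0)" for N
  have le: "norm (f y - cut N y) \<le> e N" for N
    unfolding e_def unfolding C0_def C1_def by (rule norm_diff_cut_le[OF B(2) norm_cut_le y])
  have "e \<longlonglongrightarrow> 0"
  proof -
    define a where "a = norm A"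
    have a: "a > 0" using A by (simp add: a_def)
    \<comment> \<open>Written this way, each term is visibly a Gaussian times a geometric factor, or
      a multiple of \<rho>^N.\<close>
    have e_eq: "e = (\<lambda>N. B * ((\<rho>\<^sup>2) ^ (N\<^sup>2) * (\<rho> / a) ^ N) + \<rho> ^ N * C1 + (B * ((\<rho>\<^sup>2) ^ (N\<^sup>2) * (a / \<rho>) ^ N) + \<rho> ^ N * C0))"
    proof
      fix N
      have *: "\<rho> powi (2 * int N * int N) = (\<rho>\<^sup>2) ^ (N\<^sup>2)"
      proof -
        have "2 * int N * int N = int (2 * N\<^sup>2)" by (simp add: power2_eq_square)
        thus ?thesis by (simp only: power_int_of_nat power_mult)
      qed
      have h1: "\<rho> powi (- int N) * \<rho> powi (2 * int N * (int N + 1)) = \<rho> powi (2 * int N * int N) * \<rho> powi int N"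
        using \<rho> by (subst (1 2) power_int_add[symmetric]) (auto simp: algebra_simps)
      have h2: "\<rho> powi int N * \<rho> powi (2 * int N * (int N - 1)) = \<rho> powi (2 * int N * int N) * \<rho> powi (- int N)"
        using \<rho> by (subst (1 2) power_int_add[symmetric]) (auto simp: algebra_simps)
      have h3: "\<rho> powi (- int N) = inverse (\<rho> ^ N)" "a powi (- int N) = inverse (a ^ N)" by (simp_all add: power_int_minus)
      have h4: "e N = B * a powi (- int N) * (\<rho> powi (- int N) * \<rho> powi (2 * int N * (int N + 1))) + \<rho> powi int N * C1
         + (B * a powi int N * (\<rho> powi int N * \<rho> powi (2 * int N * (int N - 1))) + \<rho> powi int N * C0)"
        unfolding e_def \<rho>_def[symmetric] a_def[symmetric] by (simp add: algebra_simps)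
      show "e N = B * ((\<rho>\<^sup>2) ^ (N\<^sup>2) * (\<rho> / a) ^ N) + \<rho> ^ N * C1 + (B * ((\<rho>\<^sup>2) ^ (N\<^sup>2) * (a / \<rho>) ^ N) + \<rho> ^ N * C0)"
        unfolding h4 h1 h2 unfolding h3 * power_int_of_nat power_divide unfolding divide_inverse by (simp only: mult_ac)
    qed
    have "(\<lambda>N. (\<rho>\<^sup>2) ^ (N\<^sup>2) * (\<rho> / a) ^ N) \<longlonglongrightarrow> 0" "(\<lambda>N. (\<rho>\<^sup>2) ^ (N\<^sup>2) * (a / \<rho>) ^ N) \<longlonglongrightarrow> 0"
      using \<rho> a by (auto intro!: summable_LIMSEQ_zero summable_gaussian simp: power_less_one_iff simp del: power_mult_distrib)
    moreover have "(\<lambda>N. \<rho> ^ N) \<longlonglongrightarrow> 0" using \<rho> by (intro LIMSEQ_power_zero) auto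
    ultimately have "e \<longlonglongrightarrow> B * 0 + 0 * C1 + (B * 0 + 0 * C0)"
      unfolding e_eq by (intro tendsto_intros) (use \<rho> in auto)
    thus ?thesis by simp
  qed
  hence "(\<lambda>N. f y - cut N y) \<longlonglongrightarrow> 0"
    by (rule Lim_null_comparison[OF always_eventually[OF allI[OF le]]])
  hence "(\<lambda>N. f y - (f y - cut N y)) \<longlonglongrightarrow> f y - 0" by (intro tendsto_intros)
  hence cut: "(\<lambda>N. cut N y) \<longlonglongrightarrow> f y" by simp
  have "t summable_on (I \<times> UNIV)"
  proof (rule Infinite_Sum.abs_summable_summable, rule Infinite_Sum.abs_summable_on_comparison_test')
    show "(\<lambda>(i, k). norm (res i k) * 1 powi k * (1 / (1 - \<rho>))) summable_on (I \<times> UNIV)"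
      using summable_on_cmult_left[OF summable_res[of 1], of "1 / (1 - \<rho>)"] by (simp add: case_prod_unfold)
    fix ik assume "ik \<in> I \<times> (UNIV :: int set)"
    then obtain i k where ik: "ik = (i, k)" "i \<in> I" by auto
    have "norm (q powi (2 * k - 1) * x i * y) = norm q powi (2 * k - 1)"
      using x[OF ik(2)] y by (simp add: norm_mult norm_power_int)
    from norm_one_minus_ge(2)[OF _ _ this] have "norm (res i k * (1 / (1 - q powi (2 * k - 1) * x i * y))) \<le> norm (res i k) * (1 / (1 - \<rho>))"
      unfolding norm_mult using \<rho> by (intro mult_left_mono) (auto simp: \<rho>_def)
    thus "norm (t ik) \<le> (case ik of (i, k) \<Rightarrow> norm (res i k) * 1 powi k * (1 / (1 - \<rho>)))"
      by (simp add: ik t_def)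
  qed
  then obtain T where T: "(t has_sum T) (I \<times> UNIV)" by (auto simp: summable_on_def)
  \<comment> \<open>The boxes exhaust the index set, so the unordered sum T is the limit of the
    symmetric truncations.\<close>
  have "filterlim (\<lambda>N. I \<times> {- int N..int N}) (finite_subsets_at_top (I \<times> UNIV)) sequentially"
    unfolding filterlim_finite_subsets_at_top
  proof safe
    fix X assume X: "finite X" "X \<subseteq> I \<times> (UNIV :: int set)"
    define N where "N = Max (insert 0 ((\<lambda>(i, k). nat \<bar>k\<bar>) ` X))"
    have N: "nat \<bar>k\<bar> \<le> N" if "(i, k) \<in> X" for i k
      unfolding N_def using X that by (intro Max_ge) force+
    show "\<forall>\<^sub>F n in sequentially. finite (I \<times> {- int n..int n}) \<and> X \<subseteq> I \<times> {- int n..int n} \<and> I \<times> {- int n..int n} \<subseteq> I \<times> UNIV"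
      using eventually_ge_at_top[of N]
    proof eventually_elim
      case (elim n)
      have "X \<subseteq> I \<times> {- int n..int n}"
      proof safe
        fix i k assume ik: "(i, k) \<in> X"
        thus "i \<in> I" using X by auto
        show "k \<in> {- int n..int n}" using N[OF ik] elim by auto
      qed
      thus ?case using I by auto
    qed
  qed
  from filterlim_compose[OF T[unfolded has_sum_def] this] have "(\<lambda>N. cut N y) \<longlonglongrightarrow> T"
    by (simp add: cut_def t_def)
  hence "T = f y" using cut LIMSEQ_unique by blast
  thus ?thesis using T by (simp add: t_def)
qed

end

subsection \<open>Expansion of a quotient of theta functions\<close>

text \<open>Theta analogue of b - a: antisymmetric, homogeneous of degree 1, and equal to b - a
  times a cofactor that tends to \<open>(qpoch p p)\<^sup>2\<close> as a / b tends to 1.\<close>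

definition tdiff :: "complex \<Rightarrow> complex \<Rightarrow> complex \<Rightarrow> complex" where
  "tdiff p a b = b * theta p (a / b)"

lemma tdiff_antisym:
  assumes "norm p < 1" "a \<noteq> 0" "b \<noteq> 0"
  shows "tdiff p b a = - tdiff p a b"
proof -
  have "theta p (b / a) = - theta p (a / b) / (a / b)"
    using theta_inverse[OF assms(1), of "a / b"] assms by simp
  thus ?thesis using assms by (simp add: tdiff_def)
qed

lemma theta_nonzero_of_norm_odd:
  assumes "q \<noteq> 0" "norm q < 1" "norm u = norm q powi j" "odd j"
  shows "theta (q\<^sup>2) u \<noteq> 0"
proof
  assume "theta (q\<^sup>2) u = 0"
  moreover have "norm (q\<^sup>2) < 1" using assms by (simp add: norm_power power_less_one_iff)
  moreover have "u \<noteq> 0" using assms by auto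
  ultimately obtain k where "u = (q\<^sup>2) powi k" using theta_eq_0D[of "q\<^sup>2" u] assms by auto
  hence "u = q powi (2 * k)" by (simp add: power_int_mult)
  hence "norm q powi j = norm q powi (2 * k)" using assms by (simp add: norm_power_int)
  hence "j = 2 * k" using assms by (intro powi_inject_of_less_1[of "norm q"]) auto
  thus False using assms by simp
qed

lemma theta_nonzero_of_norm_1:
  assumes "q \<noteq> 0" "norm q < 1" "norm u = 1" "u \<noteq> 1"
  shows "theta (q\<^sup>2) u \<noteq> 0"
proof
  assume "theta (q\<^sup>2) u = 0"
  moreover have "norm (q\<^sup>2) < 1" using assms by (simp add: norm_power power_less_one_iff)
  moreover have "u \<noteq> 0" using assms by auto
  ultimately obtain k where "u = (q\<^sup>2) powi k" using theta_eq_0D[of "q\<^sup>2" u] assms by auto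
  hence uk: "u = q powi (2 * k)" by (simp add: power_int_mult)
  hence "norm q powi (2 * k) = norm q powi 0" using assms by (simp add: norm_power_int)
  hence "2 * k = 0" using assms by (intro powi_inject_of_less_1[of "norm q"]) auto
  thus False using assms uk by simp
qed

text \<open>Partial fractions in one variable w against m other variables y j and m + 2 variables x
  i. In the residue at a pole of x i, the factors theta(x i y j / q) cancel every occurrence of x i
  in the remaining denominators, which is what lets the expansion be iterated.\<close>

lemma theta_quotient_expansion:
  fixes x y :: "nat \<Rightarrow> complex" and m :: nat and c :: int
  assumes q0: "q \<noteq> 0" and q1: "norm q < 1"
    and x: "\<And>i. i \<le> Suc m \<Longrightarrow> norm (x i) = 1" and inj: "inj_on x {..Suc m}"
    and y: "\<And>j. j \<in> {1..m} \<Longrightarrow> norm (y j) = 1" and w: "norm w = 1"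
  shows "((\<lambda>(i, k). q powi (c + int m + 2 * k\<^sup>2 - 2 * c * k + (int m + 2) * k) * x i powi (1 - c + 2 * k) *
             (\<Prod>l\<le>Suc m. x l) powi (- k) * (\<Prod>j=1..m. y j) powi (- k) * (\<Prod>j=1..m. theta (q\<^sup>2) (x i * y j / q)) /
             (qpoch (q\<^sup>2) (q\<^sup>2) ^ 2 * (\<Prod>l\<in>{..Suc m} - {i}. tdiff (q\<^sup>2) (x l) (x i))) /
             (1 - q powi (2 * k - 1) * x i * w))
         has_sum w powi c * (\<Prod>j=1..m. tdiff (q\<^sup>2) (y j) w) / (\<Prod>i\<le>Suc m. theta (q\<^sup>2) (x i * w / q)))
         ({..Suc m} \<times> UNIV)"
proof -
  define p where "p = q\<^sup>2"
  have p: "norm p < 1" "p \<noteq> 0" using q0 q1 by (auto simp: p_def norm_power power_less_one_iff)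
  have x0: "x i \<noteq> 0" if "i \<le> Suc m" for i using x[OF that] by auto
  have y0: "y j \<noteq> 0" if "j \<in> {1..m}" for j using y[OF that] by auto
  define X where "X = (\<Prod>l\<le>Suc m. x l)"
  define Y where "Y = (\<Prod>j=1..m. y j)"
  have XY: "X \<noteq> 0" "Y \<noteq> 0" using x0 y0 by (auto simp: X_def Y_def)
  \<comment> \<open>Under u to q^2 u, the power u^c contributes q^(2c), the m numerators (-1)^m Y /
    u^m, and the m + 2 inverted denominators X (-u/q)^(m+2).\<close>
  define A where "A = q powi (2 * c - (int m + 2)) * X * Y"
  define f where "f u = u powi c * (\<Prod>j=1..m. tdiff p (y j) u) / (\<Prod>i\<le>Suc m. theta p (x i * u / q))" for u
  define R where "R i = q powi (c + int m) * x i powi (1 - c) * (\<Prod>j=1..m. theta p (x i * y j / q)) /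
      (qpoch p p ^ 2 * (\<Prod>l\<in>{..Suc m} - {i}. tdiff p (x l) (x i)))" for i
  interpret quasiperiodic_poles q A f "{..Suc m}" x R
  proof
    show "q \<noteq> 0" "norm q < 1" "finite {..Suc m}" "inj_on x {..Suc m}" by (fact q0 q1 inj finite_atMost)+
    show "norm (x i) = 1" if "i \<in> {..Suc m}" for i using that x by simp
    show "A \<noteq> 0" using XY q0 by (simp add: A_def)
    show "f holomorphic_on {y. y \<noteq> 0 \<and> (\<forall>i\<in>{..Suc m}. \<forall>k. q powi (2 * k - 1) * x i * y \<noteq> 1)}"
      (is "f holomorphic_on ?D")
    proof -
      have th: "theta p (x i * u / q) \<noteq> 0" if u: "u \<in> ?D" and i: "i \<in> {..Suc m}" for i u
      proof
        assume *: "theta p (x i * u / q) = 0"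
        have "x i * u / q \<noteq> 0" using u x0 i q0 by auto
        from theta_eq_0D[OF p this *] obtain k where "x i * u / q = p powi k" by blast
        hence "x i * u / q = q powi (2 * k)" by (simp add: p_def power_int_mult)
        hence "q powi (2 * (- k) - 1) * x i * u = 1" using q0
          by (simp add: power_int_diff power_int_minus field_simps)
        thus False using u i by blast
      qed
      show ?thesis unfolding f_def tdiff_def
        by (intro holomorphic_intros p) (use th x0 y0 q0 in \<open>auto simp del: prod.atMost_Suc\<close>)
    qed
    show "f (q\<^sup>2 * u) = A * u\<^sup>2 * f u" if u: "u \<noteq> 0" for u
    proof -
      have "tdiff p (y j) (p * u) = (- (y j / u)) * tdiff p (y j) u" if "j \<in> {1..m}" for j
      proof -
        have "theta p (y j / (p * u)) = - (y j / u / p) * theta p (y j / u)"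
          using theta_shift_inverse[OF p, of "y j / u"] u y0[OF that] by (simp add: field_simps)
        thus ?thesis using p u by (simp add: tdiff_def)
      qed
      hence num: "(\<Prod>j=1..m. tdiff p (y j) (p * u)) = (- 1) ^ m * Y / u ^ m * (\<Prod>j=1..m. tdiff p (y j) u)"
      proof -
        assume *: "\<And>j. j \<in> {1..m} \<Longrightarrow> tdiff p (y j) (p * u) = (- (y j / u)) * tdiff p (y j) u"
        have "(\<Prod>j=1..m. tdiff p (y j) (p * u)) = (\<Prod>j=1..m. ((- 1 / u) * y j) * tdiff p (y j) u)"
          by (intro prod.cong refl) (use * in auto)
        also have "\<dots> = (- 1 / u) ^ m * Y * (\<Prod>j=1..m. tdiff p (y j) u)"
          by (simp only: prod.distrib prod_constant Y_def) simp
        finally show ?thesis unfolding power_divide by (simp only: times_divide_eq_left)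
      qed
      have "theta p (x i * (p * u) / q) = (- q / u * inverse (x i)) * theta p (x i * u / q)" if "i \<in> {..Suc m}" for i
        using theta_shift[OF p, of "x i * u / q"] u x0[of i] q0 that by (simp add: field_simps)
      hence "(\<Prod>i\<le>Suc m. theta p (x i * (p * u) / q)) = (\<Prod>i\<le>Suc m. (- q / u * inverse (x i)) * theta p (x i * u / q))"
        by (intro prod.cong refl)
      also have "\<dots> = (- q / u) ^ (m + 2) * inverse X * (\<Prod>i\<le>Suc m. theta p (x i * u / q))"
        by (simp only: prod.distrib prod_constant X_def prod_inversef[symmetric] o_def) simp
      finally have den: "(\<Prod>i\<le>Suc m. theta p (x i * (p * u) / q)) =
          (- q / u) ^ (m + 2) * inverse X * (\<Prod>i\<le>Suc m. theta p (x i * u / q))" .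
      have "f (p * u) = (p * u) powi c * ((- 1) ^ m * Y / u ^ m * (\<Prod>j=1..m. tdiff p (y j) u)) /
          ((- q / u) ^ (m + 2) * inverse X * (\<Prod>i\<le>Suc m. theta p (x i * u / q)))"
        unfolding f_def num den ..
      also have "\<dots> = p powi c * (- 1) ^ m * Y / u ^ m * (inverse ((- q / u) ^ (m + 2)) * X) * f u"
        by (simp add: f_def power_int_mult_distrib divide_inverse mult_ac)
      also have "inverse ((- q / u) ^ (m + 2)) = (- 1) ^ m * u ^ (m + 2) / q ^ (m + 2)"
      proof -
        have "(- q / u) = (-1) * (q / u)" by simp
        hence "(- q / u) ^ (m + 2) = (-1) ^ (m + 2) * (q / u) ^ (m + 2)" by (simp only: power_mult_distrib)
        also have "(-1) ^ (m + 2) = ((-1) ^ m :: complex)" by simp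
        finally have "inverse ((- q / u) ^ (m + 2)) = inverse ((-1) ^ m) * inverse ((q / u) ^ (m + 2))"
          by (simp only: inverse_mult_distrib)
        also have "inverse ((-1) ^ m :: complex) = (-1) ^ m" by (simp flip: power_inverse)
        also have "inverse ((q / u) ^ (m + 2)) = u ^ (m + 2) / q ^ (m + 2)"
          by (simp only: power_inverse[symmetric] inverse_divide power_divide)
        finally show ?thesis by (simp only: times_divide_eq_right)
      qed
      also have "p powi c * (- 1) ^ m * Y / u ^ m * ((- 1) ^ m * u ^ (m + 2) / q ^ (m + 2) * X) =
          (p powi c / q ^ (m + 2)) * X * Y * u\<^sup>2 * ((- 1) ^ m * (- 1) ^ m)"
        using u by (simp add: power_add power2_eq_square field_simps)
      also have "(- 1) ^ m * (- 1) ^ m = (1 :: complex)" by (simp flip: power_mult_distrib)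
      also have "p powi c / q ^ (m + 2) = q powi (2 * c - (int m + 2))"
      proof -
        have "q powi (2 * c - int (m + 2)) = q powi (2 * c) / q powi int (m + 2)"
          using q0 by (intro power_int_diff) auto
        thus ?thesis unfolding power_int_of_nat by (simp add: p_def power_int_mult add.commute)
      qed
      finally show ?thesis by (simp add: A_def p_def)
    qed
    show "((\<lambda>u. (1 - x i * u / q) * f u) \<longlongrightarrow> R i) (at (q / x i))" if "i \<in> {..Suc m}" for i
    proof -
      have i: "i \<le> Suc m" using that by simp
      define v where "v = q / x i"
      have v0: "v \<noteq> 0" using q0 x0[OF i] by (simp add: v_def)
      \<comment> \<open>This is (1 - x i u / q) f u with the zero of the i-th theta cancelled by
        \<open>theta_eq\<close>; it is continuous at v and its value there is R i.\<close>
      define g where "g u = u powi c * (\<Prod>j=1..m. tdiff p (y j) u) /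
        (qpoch p (p * (x i * u / q)) * qpoch p (p / (x i * u / q)) * (\<Prod>l\<in>{..Suc m} - {i}. theta p (x l * u / q)))" for u
      have xiv: "x i * v / q = 1" using q0 x0[OF i] by (simp add: v_def)
      have th: "theta p (x l / x i) \<noteq> 0" if "l \<in> {..Suc m} - {i}" for l
        unfolding p_def
      proof (rule theta_nonzero_of_norm_1[OF q0 q1])
        show "norm (x l / x i) = 1" using that x i by (simp add: norm_divide)
        show "x l / x i \<noteq> 1" using that i x0[OF i] inj_onD[OF inj, of l i] by auto
      qed
      have xlv: "x l * v / q = x l / x i" for l using q0 by (simp add: v_def)
      have qp: "qpoch p p \<noteq> 0" using p by (intro qpoch_nonzero)
      have "(g \<longlongrightarrow> g v) (at v)"
        unfolding g_def tdiff_def using v0 y0 th x0 x0[OF i] q0 qp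
        by (intro tendsto_intros p) (auto simp: xiv xlv)
      also have "g v = R i"
      proof -
        have "(\<Prod>j=1..m. tdiff p (y j) v) = (\<Prod>j=1..m. v * theta p (x i * y j / q))"
          by (intro prod.cong refl) (use q0 x0[OF i] in \<open>simp add: tdiff_def v_def mult_ac\<close>)
        hence 1: "(\<Prod>j=1..m. tdiff p (y j) v) = v ^ m * (\<Prod>j=1..m. theta p (x i * y j / q))"
          by (simp add: prod.distrib)
        have "(\<Prod>l\<in>{..Suc m} - {i}. tdiff p (x l) (x i)) = x i ^ Suc m * (\<Prod>l\<in>{..Suc m} - {i}. theta p (x l / x i))"
          unfolding tdiff_def prod.distrib using i by (simp add: card_Diff_singleton)
        hence 2: "(\<Prod>l\<in>{..Suc m} - {i}. theta p (x l / x i)) = (\<Prod>l\<in>{..Suc m} - {i}. tdiff p (x l) (x i)) / x i ^ Suc m"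
          using x0[OF i] by simp
        have "v powi c * v ^ m = v powi (c + int m)" using v0 by (simp add: power_int_add)
        also have "\<dots> = q powi (c + int m) / x i powi (c + int m)" by (simp add: v_def power_int_divide_distrib)
        finally have "v powi c * v ^ m * x i ^ Suc m = q powi (c + int m) * (x i powi int (Suc m) / x i powi (c + int m))"
          unfolding power_int_of_nat by simp
        also have "x i powi int (Suc m) / x i powi (c + int m) = x i powi (1 - c)"
          using x0[OF i] by (subst power_int_diff[symmetric]) auto
        finally have 3: "v powi c * v ^ m * x i ^ Suc m = q powi (c + int m) * x i powi (1 - c)" .
        show ?thesis unfolding g_def xiv xlv 1 2 R_def unfolding 3[symmetric]
          by (simp add: power2_eq_square mult_ac)
      qed
      finally have "(g \<longlongrightarrow> R i) (at v)" .
      moreover have "\<forall>\<^sub>F u in at v. g u = (1 - x i * u / q) * f u"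
      proof -
        have "\<forall>\<^sub>F u in at v. u \<noteq> v" by (simp add: eventually_at_filter)
        thus ?thesis
        proof eventually_elim
          case (elim u)
          define z where "z = x i * u / q"
          have z: "1 - z \<noteq> 0" using elim q0 x0[OF i] by (auto simp: z_def v_def field_simps)
          have "(\<Prod>i\<le>Suc m. theta p (x i * u / q)) = theta p z * (\<Prod>l\<in>{..Suc m} - {i}. theta p (x l * u / q))"
            using i by (subst prod.remove[of _ i]) (auto simp: z_def simp del: prod.atMost_Suc)
          also have "theta p z = (1 - z) * (qpoch p (p * z) * qpoch p (p / z))" using p(1) by (rule theta_eq)
          finally show ?case using z unfolding f_def g_def z_def[symmetric] by simp
        qed
      qed
      ultimately show ?thesis unfolding v_def by (rule Lim_transform_eventually)
    qed
  qed
  have "res i k = q powi (c + int m + 2 * k\<^sup>2 - 2 * c * k + (int m + 2) * k) * x i powi (1 - c + 2 * k) *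
             X powi (- k) * Y powi (- k) * (\<Prod>j=1..m. theta p (x i * y j / q)) /
             (qpoch p p ^ 2 * (\<Prod>l\<in>{..Suc m} - {i}. tdiff p (x l) (x i)))" if "i \<le> Suc m" for i k
  proof -
    have "x i \<noteq> 0" using x0[of i] that by simp
    have "A powi (- k) = q powi ((2 * c - (int m + 2)) * (- k)) * X powi (- k) * Y powi (- k)"
      unfolding A_def power_int_mult_distrib power_int_mult[symmetric] ..
    moreover have "q powi (c + int m + 2 * k\<^sup>2 - 2 * c * k + (int m + 2) * k) =
        q powi (c + int m) * (q powi ((2 * c - (int m + 2)) * (- k)) * q powi (2 * k\<^sup>2))"
    proof -
      have "c + int m + 2 * k\<^sup>2 - 2 * c * k + (int m + 2) * k =
          (c + int m) + ((2 * c - (int m + 2)) * (- k) + 2 * k\<^sup>2)" by (simp add: algebra_simps)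
      thus ?thesis using q0 by (simp only: power_int_add simp_thms)
    qed
    moreover have "x i powi (1 - c + 2 * k) = x i powi (1 - c) * x i powi (2 * k)"
      using \<open>x i \<noteq> 0\<close> by (simp only: power_int_add simp_thms)
    ultimately show ?thesis unfolding res_def R_def
      by (simp only: times_divide_eq_left times_divide_eq_right mult_ac)
  qed
  hence "((\<lambda>(i, k). q powi (c + int m + 2 * k\<^sup>2 - 2 * c * k + (int m + 2) * k) * x i powi (1 - c + 2 * k) *
             X powi (- k) * Y powi (- k) * (\<Prod>j=1..m. theta p (x i * y j / q)) /
             (qpoch p p ^ 2 * (\<Prod>l\<in>{..Suc m} - {i}. tdiff p (x l) (x i))) / (1 - q powi (2 * k - 1) * x i * w)) has_sum f w)
      ({..Suc m} \<times> UNIV)"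
    using partial_fractions[OF w] by (subst has_sum_cong[where g = "\<lambda>(i, k). res i k / (1 - q powi (2 * k - 1) * x i * w)"]) auto
  thus ?thesis unfolding f_def X_def Y_def p_def .
qed

subsection \<open>The multivariable expansion\<close>

text \<open>Grouped by the larger index, so that adjoining a new largest index appends one factor. E
  is left abstract because differences, their quotients by t - 1 and theta differences all
  occur.\<close>

definition alt_prod :: "('a \<Rightarrow> 'a \<Rightarrow> 'b :: comm_monoid_mult) \<Rightarrow> nat set \<Rightarrow> (nat \<Rightarrow> 'a) \<Rightarrow> 'b" where
  "alt_prod E S x = (\<Prod>j\<in>S. \<Prod>i\<in>{i \<in> S. i < j}. E (x i) (x j))"

definition quad :: "nat \<Rightarrow> (nat \<Rightarrow> int) \<Rightarrow> int" where
  "quad m k = (\<Sum>i=1..m. \<Sum>j=i..m. k i * k j)"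

text \<open>Closed form of the power of q collected by m successive residues when the initial
  exponent is c; \<open>gexp_Suc\<close> is the recursion behind it.\<close>

definition gexp :: "nat \<Rightarrow> int \<Rightarrow> (nat \<Rightarrow> int) \<Rightarrow> int" where
  "gexp m c k = 2 * quad m k + 2 * (1 - c) * vec_total m k + int m * c + int (m * (m - 1) div 2)"

text \<open>For 1 <= l <= m, \<open>x l\<close> is the variable removed together with
  \<open>y l\<close>, and \<open>x 0\<close> is the one left over. Each residue carries a negative
  power of the product of all remaining x, which leaves \<open>x 0\<close> with the exponent -
  |k|.\<close>

definition gterm :: "complex \<Rightarrow> nat \<Rightarrow> int \<Rightarrow> (nat \<Rightarrow> complex) \<Rightarrow> (nat \<Rightarrow> complex) \<Rightarrow> (nat \<Rightarrow> int) \<Rightarrow> complex" where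
  "gterm q m c x y k = q powi gexp m c k * (\<Prod>l=1..m. x l powi (1 - c + k l)) * x 0 powi (- vec_total m k) *
     (\<Prod>l=1..m. 1 / (1 - q powi (2 * k l - 1) * x l * y l)) /
     (qpoch (q\<^sup>2) (q\<^sup>2) ^ (2 * m) * alt_prod (tdiff (q\<^sup>2)) {..m} x)"

lemma alt_prod_insert_max:
  assumes "finite S" "\<And>i. i \<in> S \<Longrightarrow> i < n"
  shows "alt_prod E (insert n S) x = alt_prod E S x * (\<Prod>i\<in>S. E (x i) (x n))"
proof -
  have "n \<notin> S" using assms by auto
  have "{i \<in> insert n S. i < j} = {i \<in> S. i < j}" if "j \<in> S" for j using assms(2)[OF that] by auto
  moreover have "{i \<in> insert n S. i < n} = S" using assms by auto
  ultimately show ?thesis using assms(1) \<open>n \<notin> S\<close> by (simp add: alt_prod_def mult.commute)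
qed

section \<open>Recursions in the number of variables\<close>

lemma vec_total_Suc: "vec_total (Suc m) k = vec_total m k + k (Suc m)"
  by (simp add: vec_total_def)

lemma quad_Suc: "quad (Suc m) k = quad m k + k (Suc m) * vec_total (Suc m) k"
proof -
  have "quad (Suc m) k = (\<Sum>i=1..m. \<Sum>j=i..Suc m. k i * k j) + k (Suc m) * k (Suc m)"
    by (simp add: quad_def)
  also have "(\<Sum>i=1..m. \<Sum>j=i..Suc m. k i * k j) = (\<Sum>i=1..m. (\<Sum>j=i..m. k i * k j) + k i * k (Suc m))"
    by (intro sum.cong refl) simp
  also have "\<dots> = quad m k + k (Suc m) * vec_total m k"
    by (simp add: sum.distrib quad_def vec_total_def sum_distrib_left mult.commute)
  finally show ?thesis by (simp add: vec_total_Suc algebra_simps)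
qed

text \<open>Shows that the quadratic form is positive definite; all convergence in k rests on
  it.\<close>

lemma two_quad: "2 * quad m k = (\<Sum>i=1..m. (k i)\<^sup>2) + (vec_total m k)\<^sup>2"
proof (induction m)
  case 0 show ?case by (simp add: quad_def vec_total_def)
next
  case (Suc m)
  thus ?case by (simp add: quad_Suc vec_total_Suc power2_eq_square algebra_simps)
qed

lemma quad_cong: "(\<And>i. i \<in> {1..m} \<Longrightarrow> k i = l i) \<Longrightarrow> quad m k = quad m l"
  unfolding quad_def by (intro sum.cong refl) auto

lemma vec_total_cong: "(\<And>i. i \<in> {1..m} \<Longrightarrow> k i = l i) \<Longrightarrow> vec_total m k = vec_total m l"
  unfolding vec_total_def by (intro sum.cong refl) auto

lemma gexp_Suc:
  "gexp (Suc m) c (k(Suc m := a)) =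
     c + int m + 2 * a\<^sup>2 - 2 * c * a + (int m + 2) * a + gexp m (c - a) k"
proof -
  have q: "quad m (k(Suc m := a)) = quad m k" by (rule quad_cong) auto
  have v: "vec_total m (k(Suc m := a)) = vec_total m k" by (rule vec_total_cong) auto
  have "Suc m * (Suc m - 1) div 2 = m * (m - 1) div 2 + m"
    by (cases m) (auto simp: algebra_simps)
  thus ?thesis unfolding gexp_def quad_Suc vec_total_Suc q v
    by (simp add: power2_eq_square algebra_simps)
qed

lemma prod_powi: "(\<Prod>l\<in>S. x l powi a) = (\<Prod>l\<in>S. x l :: complex) powi a"
  by (induction S rule: infinite_finite_induct) (auto simp: power_int_mult_distrib)

text \<open>Separates the residue in \<open>y (Suc m)\<close>, the first one to be taken, from the
  terms with m variables and exponent c - a.\<close>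

lemma gterm_Suc:
  assumes q0: "q \<noteq> 0" and x0: "\<And>l. l \<le> Suc m \<Longrightarrow> x l \<noteq> 0"
  shows "gterm q (Suc m) c x y (k(Suc m := a)) =
    q powi (c + int m + 2 * a\<^sup>2 - 2 * c * a + (int m + 2) * a) * x (Suc m) powi (1 - c + 2 * a) *
      (\<Prod>l\<le>Suc m. x l) powi (- a) /
      (qpoch (q\<^sup>2) (q\<^sup>2) ^ 2 * (\<Prod>l\<le>m. tdiff (q\<^sup>2) (x l) (x (Suc m)))) /
      (1 - q powi (2 * a - 1) * x (Suc m) * y (Suc m)) * gterm q m (c - a) x y k"
proof -
  have v: "vec_total m (k(Suc m := a)) = vec_total m k" by (rule vec_total_cong) auto
  have X: "(\<Prod>l\<le>Suc m. x l) = x 0 * (\<Prod>l=1..m. x l) * x (Suc m)"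
    by (simp add: atLeast0AtMost[symmetric] prod.atLeast_Suc_atMost)
  have p1: "(\<Prod>l=1..Suc m. x l powi (1 - c + (k(Suc m := a)) l)) =
      (\<Prod>l=1..m. x l powi (1 - c + k l)) * x (Suc m) powi (1 - c + a)"
    by simp
  have "(\<Prod>l=1..m. x l powi (1 - (c - a) + k l)) = (\<Prod>l=1..m. x l powi (1 - c + k l) * x l powi a)"
    by (intro prod.cong refl, subst power_int_add[symmetric]) (use x0 in \<open>auto simp: algebra_simps\<close>)
  hence p2: "(\<Prod>l=1..m. x l powi (1 - (c - a) + k l)) = (\<Prod>l=1..m. x l powi (1 - c + k l)) * (\<Prod>l=1..m. x l) powi a"
    by (simp add: prod.distrib prod_powi)
  have p3: "(\<Prod>l=1..Suc m. 1 / (1 - q powi (2 * (k(Suc m := a)) l - 1) * x l * y l)) =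
      (\<Prod>l=1..m. 1 / (1 - q powi (2 * k l - 1) * x l * y l)) * (1 / (1 - q powi (2 * a - 1) * x (Suc m) * y (Suc m)))"
    by simp
  have p4: "alt_prod (tdiff (q\<^sup>2)) {..Suc m} x = alt_prod (tdiff (q\<^sup>2)) {..m} x * (\<Prod>l\<le>m. tdiff (q\<^sup>2) (x l) (x (Suc m)))"
    unfolding atMost_Suc by (rule alt_prod_insert_max) auto
  have p5: "x 0 powi (- vec_total (Suc m) (k(Suc m := a))) = x 0 powi (- vec_total m k) * x 0 powi (- a)"
    using x0[of 0] by (subst power_int_add[symmetric]) (auto simp: vec_total_Suc v)
  have p6: "x (Suc m) powi (1 - c + a) = x (Suc m) powi (1 - c + 2 * a) * x (Suc m) powi (- a)"
    using x0[of "Suc m"] by (subst power_int_add[symmetric]) (auto simp: add.commute)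
  have p7: "q powi gexp (Suc m) c (k(Suc m := a)) = q powi (c + int m + 2 * a\<^sup>2 - 2 * c * a + (int m + 2) * a) * q powi gexp m (c - a) k"
    unfolding gexp_Suc using q0 by (intro power_int_add) auto
  \<comment> \<open>The factor \<open>P powi a * P powi (- a) = 1\<close> is inserted below: the
    first power changes the exponents 1 - c + k l into those for c - a, the second is part of the
    power - a of the product of all x l.\<close>
  define P where "P = (\<Prod>l=1..m. x l)"
  have "P \<noteq> 0" using x0 by (auto simp: P_def)
  hence p8: "P powi a * P powi (- a) = 1" by (simp flip: power_int_add)
  have p9: "qpoch (q\<^sup>2) (q\<^sup>2) ^ (2 * Suc m) = qpoch (q\<^sup>2) (q\<^sup>2) ^ 2 * qpoch (q\<^sup>2) (q\<^sup>2) ^ (2 * m)"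
    by (simp add: power2_eq_square)
  define r where "r = (\<Prod>l=1..m. x l powi (1 - c + k l))"
  have "r = r * P powi a * P powi (- a)" using p8 by (simp add: mult.assoc)
  show ?thesis
    unfolding gterm_def p1 p2 p3 p4 p5 p6 p7 p9 X power_int_mult_distrib P_def[symmetric] r_def[symmetric]
    by (subst \<open>r = r * P powi a * P powi (- a)\<close>) (simp only: divide_inverse inverse_mult_distrib mult_1_left mult_ac)
qed

section \<open>Absolute summability of the expansion\<close>

lemma summable_on_prod_PiE_int:
  fixes g :: "int \<Rightarrow> real"
  assumes "g summable_on UNIV" "\<And>k. g k \<ge> 0" "finite S"
  shows "(\<lambda>k. \<Prod>l\<in>S. g (k l)) summable_on (S \<rightarrow>\<^sub>E UNIV)"
proof -
  have "Infinite_Sum.abs_summable_on g UNIV" using assms by simp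
  hence "Infinite_Set_Sum.abs_summable_on g UNIV" using abs_summable_equivalent by blast
  hence "Infinite_Set_Sum.abs_summable_on (\<lambda>k. \<Prod>l\<in>S. g (k l)) (S \<rightarrow>\<^sub>E UNIV)"
    using assms(3) by (intro Infinite_Set_Sum.abs_summable_on_prod_PiE) auto
  thus ?thesis by (rule Infinite_Sum.abs_summable_summable[OF abs_summable_equivalent[THEN iffD2]])
qed

text \<open>Dropping the square of |k| in \<open>two_quad\<close> leaves a bound that is a product
  over the coordinates, hence summable by the one-dimensional Gaussian sums.\<close>

lemma norm_gterm_le:
  assumes q0: "q \<noteq> 0" and q1: "norm q < 1"
    and x: "\<And>i. i \<le> m \<Longrightarrow> norm (x i) = 1" and y: "\<And>j. j \<in> {1..m} \<Longrightarrow> norm (y j) = 1"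
  shows "norm (gterm q m c x y k) \<le>
    norm q powi (int m * c + int (m * (m - 1) div 2)) * (1 / (1 - norm q)) ^ m /
      norm (qpoch (q\<^sup>2) (q\<^sup>2) ^ (2 * m) * alt_prod (tdiff (q\<^sup>2)) {..m} x) *
    (\<Prod>l=1..m. norm q powi ((k l)\<^sup>2) * (norm q powi (2 * (1 - c))) powi k l)"
proof -
  define \<rho> where "\<rho> = norm q"
  have \<rho>: "0 < \<rho>" "\<rho> < 1" using q0 q1 by (auto simp: \<rho>_def)
  define D where "D = norm (qpoch (q\<^sup>2) (q\<^sup>2) ^ (2 * m) * alt_prod (tdiff (q\<^sup>2)) {..m} x)"
  define K where "K = int m * c + int (m * (m - 1) div 2)"
  have "(\<Prod>l=1..m. norm (x l powi (1 - c + k l))) = 1"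
    by (intro prod.neutral) (use x in \<open>auto simp: norm_power_int\<close>)
  hence e: "norm (gterm q m c x y k) = \<rho> powi gexp m c k * (\<Prod>l=1..m. norm (1 / (1 - q powi (2 * k l - 1) * x l * y l))) / D"
    unfolding gterm_def norm_mult norm_divide using x[of 0]
    by (simp add: \<rho>_def D_def norm_power_int norm_mult norm_divide prod_norm[symmetric])
  have "(\<Prod>l=1..m. norm (1 / (1 - q powi (2 * k l - 1) * x l * y l))) \<le> (\<Prod>l=1..m. 1 / (1 - \<rho>))"
  proof (intro prod_mono conjI norm_ge_zero)
    fix l assume l: "l \<in> {1..m}"
    have "norm (q powi (2 * k l - 1) * x l * y l) = \<rho> powi (2 * k l - 1)"
      using x[of l] y[OF l] l by (simp add: norm_mult norm_power_int \<rho>_def)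
    from norm_one_minus_ge(2)[OF \<rho> this] show "norm (1 / (1 - q powi (2 * k l - 1) * x l * y l)) \<le> 1 / (1 - \<rho>)" by simp
  qed
  also have "(\<Prod>l=1..m. 1 / (1 - \<rho>)) = (1 / (1 - \<rho>)) ^ m" by simp
  finally have b: "(\<Prod>l=1..m. norm (1 / (1 - q powi (2 * k l - 1) * x l * y l))) \<le> (1 / (1 - \<rho>)) ^ m" .
  have "\<rho> powi gexp m c k \<le> \<rho> powi (K + (\<Sum>l=1..m. (k l)\<^sup>2 + 2 * (1 - c) * k l))"
  proof (rule power_int_decreasing)
    show "K + (\<Sum>l=1..m. (k l)\<^sup>2 + 2 * (1 - c) * k l) \<le> gexp m c k"
      unfolding gexp_def two_quad K_def by (simp add: sum.distrib vec_total_def flip: sum_distrib_left)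
  qed (use \<rho> in auto)
  also have "\<rho> powi (K + (\<Sum>l=1..m. (k l)\<^sup>2 + 2 * (1 - c) * k l)) =
      \<rho> powi K * (\<Prod>l=1..m. \<rho> powi ((k l)\<^sup>2) * (\<rho> powi (2 * (1 - c))) powi k l)"
  proof -
    have "\<rho> powi (\<Sum>l\<in>S. (k l)\<^sup>2 + d * k l) = (\<Prod>l\<in>S. \<rho> powi ((k l)\<^sup>2) * (\<rho> powi d) powi k l)"
      if "finite S" for S d
      using that
    proof induction
      case (insert a S)
      thus ?case using \<rho> by (simp add: power_int_add power_int_mult)
    qed simp
    thus ?thesis using \<rho> by (simp add: power_int_add)
  qed
  finally have "\<rho> powi gexp m c k * (\<Prod>l=1..m. norm (1 / (1 - q powi (2 * k l - 1) * x l * y l))) / D \<le>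
      \<rho> powi K * (\<Prod>l=1..m. \<rho> powi ((k l)\<^sup>2) * (\<rho> powi (2 * (1 - c))) powi k l) * (1 / (1 - \<rho>)) ^ m / D"
    using \<rho> b by (intro divide_right_mono mult_mono) (auto simp: D_def intro!: mult_nonneg_nonneg prod_nonneg)
  thus ?thesis unfolding e \<rho>_def[symmetric] D_def[symmetric] K_def[symmetric]
    by (simp only: times_divide_eq_left times_divide_eq_right mult_ac)
qed

text \<open>Joint summability, which the iterated sums in the induction do not provide by themselves
  and which allows them to be merged.\<close>

lemma summable_gterm:
  assumes q0: "q \<noteq> 0" and q1: "norm q < 1"
    and x: "\<And>i. i \<le> m \<Longrightarrow> norm (x i) = 1" and y: "\<And>j. j \<in> {1..m} \<Longrightarrow> norm (y j) = 1"
  shows "(\<lambda>(\<sigma>, k). gterm q m c (x \<circ> \<sigma>) y k) summable_on ({\<sigma>. \<sigma> permutes {..m}} \<times> ({1..m} \<rightarrow>\<^sub>E UNIV))"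
proof (rule Infinite_Sum.abs_summable_summable, rule Infinite_Sum.abs_summable_on_comparison_test')
  define C where "C \<sigma> = norm q powi (int m * c + int (m * (m - 1) div 2)) * (1 / (1 - norm q)) ^ m /
      norm (qpoch (q\<^sup>2) (q\<^sup>2) ^ (2 * m) * alt_prod (tdiff (q\<^sup>2)) {..m} (x \<circ> \<sigma>))" for \<sigma>
  define g where "g k = (\<Prod>l=1..m. norm q powi ((k l)\<^sup>2) * (norm q powi (2 * (1 - c))) powi k l)" for k :: "nat \<Rightarrow> int"
  have gs: "g summable_on ({1..m} \<rightarrow>\<^sub>E UNIV)"
    unfolding g_def using q0 q1 by (intro summable_on_prod_PiE_int summable_on_gaussian_int) auto
  have g0: "g k \<ge> 0" for k by (auto simp: g_def intro!: prod_nonneg)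
  have C0: "C \<sigma> \<ge> 0" for \<sigma> using q1 by (auto simp: C_def)
  show "(\<lambda>(\<sigma>, k). C \<sigma> * g k) summable_on ({\<sigma>. \<sigma> permutes {..m}} \<times> ({1..m} \<rightarrow>\<^sub>E UNIV))"
    using g0 C0 gs by (intro summable_on_SigmaI[where g = "\<lambda>\<sigma>. C \<sigma> * infsum g ({1..m} \<rightarrow>\<^sub>E UNIV)"])
      (auto intro!: has_sum_cmult_right has_sum_infsum summable_on_finite finite_permutations)
  fix s assume s: "s \<in> {\<sigma>. \<sigma> permutes {..m}} \<times> ({1..m} \<rightarrow>\<^sub>E (UNIV :: int set))"
  obtain \<sigma> k where sk: "s = (\<sigma>, k)" by (cases s)
  have \<sigma>: "\<sigma> permutes {..m}" using s sk by auto
  have "norm (gterm q m c (x \<circ> \<sigma>) y k) \<le> C \<sigma> * g k"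
    unfolding C_def g_def
  proof (rule norm_gterm_le[OF q0 q1 _ y])
    show "norm ((x \<circ> \<sigma>) i) = 1" if "i \<le> m" for i using x permutes_in_image[OF \<sigma>, of i] that by auto
  qed
  thus "norm (case s of (\<sigma>, k) \<Rightarrow> gterm q m c (x \<circ> \<sigma>) y k) \<le> (case s of (\<sigma>, k) \<Rightarrow> C \<sigma> * g k)"
    by (simp add: sk)
qed

text \<open>A permutation of \<open>{..Suc m}\<close> is given by the image i of
  \<open>Suc m\<close> and by what remains on \<open>{..m}\<close> after undoing the transposition;
  likewise the last coordinate is split off from a vector. This matches one residue followed by the
  smaller expansion.\<close>

lemma bij_betw_permutes_PiE_Suc:
  "bij_betw (\<lambda>((i, a), (\<sigma>, k)). (Transposition.transpose (Suc m) i \<circ> \<sigma>, k(Suc m := a)))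
     (({..Suc m} \<times> UNIV) \<times> ({\<sigma>. \<sigma> permutes {..m}} \<times> ({1..m} \<rightarrow>\<^sub>E UNIV)))
     ({\<sigma>. \<sigma> permutes {..Suc m}} \<times> ({1..Suc m} \<rightarrow>\<^sub>E (UNIV :: 'a set)))"
  (is "bij_betw ?h ?A ?B")
  unfolding bij_betw_def
proof
  show "inj_on ?h ?A"
  proof (rule inj_onI)
    fix u v assume uv: "u \<in> ?A" "v \<in> ?A" "?h u = ?h v"
    obtain i a \<sigma> k where u: "u = ((i, a), (\<sigma>, k))" by (metis surj_pair)
    obtain j b \<tau> l where v: "v = ((j, b), (\<tau>, l))" by (metis surj_pair)
    have \<sigma>: "\<sigma> permutes {..m}" and \<tau>: "\<tau> permutes {..m}"
      and k: "k \<in> {1..m} \<rightarrow>\<^sub>E (UNIV :: 'a set)" and l: "l \<in> {1..m} \<rightarrow>\<^sub>E (UNIV :: 'a set)"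
      and e1: "Transposition.transpose (Suc m) i \<circ> \<sigma> = Transposition.transpose (Suc m) j \<circ> \<tau>"
      and e2: "k(Suc m := a) = l(Suc m := b)"
      using uv by (auto simp: u v)
    have "\<sigma> (Suc m) = Suc m" "\<tau> (Suc m) = Suc m"
      using permutes_not_in[OF \<sigma>, of "Suc m"] permutes_not_in[OF \<tau>, of "Suc m"] by auto
    with fun_cong[OF e1, of "Suc m"] have ij: "i = j" by simp
    have "Transposition.transpose (Suc m) i \<circ> (Transposition.transpose (Suc m) i \<circ> \<sigma>) = Transposition.transpose (Suc m) i \<circ> (Transposition.transpose (Suc m) i \<circ> \<tau>)"
      using e1 ij by simp
    hence "\<sigma> = \<tau>" by (simp add: o_assoc)
    moreover have "a = b" using fun_cong[OF e2, of "Suc m"] by simp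
    moreover have "k = l"
    proof
      fix s
      show "k s = l s"
      proof (cases "s = Suc m")
        case True thus ?thesis using PiE_arb[OF k, of s] PiE_arb[OF l, of s] by simp
      next
        case False thus ?thesis using fun_cong[OF e2, of s] by simp
      qed
    qed
    ultimately show "u = v" using ij by (simp add: u v)
  qed
  show "?h ` ?A = ?B"
  proof (intro equalityI subsetI)
    fix u assume "u \<in> ?h ` ?A"
    then obtain i a \<sigma> k where u: "u = (Transposition.transpose (Suc m) i \<circ> \<sigma>, k(Suc m := a))" and i: "i \<le> Suc m"
      and \<sigma>: "\<sigma> permutes {..m}" and k: "k \<in> {1..m} \<rightarrow>\<^sub>E (UNIV :: 'a set)" by auto
    have "\<sigma> permutes {..Suc m}" using \<sigma> by (rule permutes_subset) auto
    hence "Transposition.transpose (Suc m) i \<circ> \<sigma> permutes {..Suc m}"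
      using i by (intro permutes_compose permutes_swap_id) auto
    moreover have "k(Suc m := a) \<in> {1..Suc m} \<rightarrow>\<^sub>E UNIV"
      using k by (auto simp: PiE_def extensional_def)
    ultimately show "u \<in> ?B" by (simp add: u)
  next
    fix u assume "u \<in> ?B"
    then obtain \<tau> l where u: "u = (\<tau>, l)" and \<tau>: "\<tau> permutes {..Suc m}" and l: "l \<in> {1..Suc m} \<rightarrow>\<^sub>E (UNIV :: 'a set)"
      by auto
    have "\<tau> permutes insert (Suc m) {..m}" using \<tau> by (simp only: atMost_Suc)
    hence "\<tau> \<in> (\<lambda>(b, p). Transposition.transpose (Suc m) b \<circ> p) ` {(b, p). b \<in> insert (Suc m) {..m} \<and> p \<in> {p. p permutes {..m}}}"
      unfolding permutes_insert[symmetric] by simp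
    then obtain i \<sigma> where \<sigma>: "\<tau> = Transposition.transpose (Suc m) i \<circ> \<sigma>" "i \<in> {..Suc m}" "\<sigma> permutes {..m}"
      by (auto simp: atMost_Suc)
    have "l = (l(Suc m := undefined))(Suc m := l (Suc m))" by simp
    moreover have "l(Suc m := undefined) \<in> {1..m} \<rightarrow>\<^sub>E UNIV" using l by (auto simp: PiE_def extensional_def)
    ultimately show "u \<in> ?h ` ?A"
      using \<sigma> unfolding u by (intro image_eqI[of _ _ "((i, l (Suc m)), (\<sigma>, l(Suc m := undefined)))"]) auto
  qed
qed

lemma bij_betw_transpose_atMost:
  assumes "i \<le> Suc m"
  shows "bij_betw (Transposition.transpose (Suc m) i) {..m} ({..Suc m} - {i})"
  by (rule bij_betw_byWitness[of _ "Transposition.transpose (Suc m) i"])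
     (use assms in \<open>auto simp: Transposition.transpose_def split: if_splits\<close>)

text \<open>The exponent \<open>c\<close> is needed for the induction: taking the residue with index \<open>k\<close> changes it to \<open>c - k\<close>,
  which is where the mixed terms of \<open>quad\<close> come from.\<close>

theorem theta_expansion:
  fixes x y :: "nat \<Rightarrow> complex" and m :: nat and c :: int
  assumes q0: "q \<noteq> 0" and q1: "norm q < 1"
    and "\<And>i. i \<le> m \<Longrightarrow> norm (x i) = 1" and "inj_on x {..m}"
    and "\<And>j. j \<in> {1..m} \<Longrightarrow> norm (y j) = 1"
  shows "((\<lambda>(\<sigma>, k). gterm q m c (x \<circ> \<sigma>) y k) has_sum
           (\<Prod>j=1..m. y j) powi c * alt_prod (tdiff (q\<^sup>2)) {1..m} y / (\<Prod>i\<le>m. \<Prod>j=1..m. theta (q\<^sup>2) (x i * y j / q)))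
         ({\<sigma>. \<sigma> permutes {..m}} \<times> ({1..m} \<rightarrow>\<^sub>E UNIV))"
  using assms(3-)
proof (induction m arbitrary: x c)
  case 0
  have "{\<sigma>. \<sigma> permutes {..0::nat}} \<times> ({1..0::nat} \<rightarrow>\<^sub>E (UNIV :: int set)) = {(id, \<lambda>_. undefined)}"
    by (simp add: atMost_0)
  thus ?case by (auto intro!: has_sum_finiteI simp: gterm_def gexp_def quad_def vec_total_def alt_prod_def)
next
  case (Suc m)
  define p where "p = q\<^sup>2"
  define n where "n = Suc m"
  define Y where "Y = (\<Prod>j=1..m. y j)"
  define X where "X = (\<Prod>l\<le>n. x l)"
  have x0: "x i \<noteq> 0" if "i \<le> n" for i using Suc.prems(1)[of i] that by (auto simp: n_def)
  have y0: "Y \<noteq> 0" using Suc.prems(3) by (fastforce simp: Y_def)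
  \<comment> \<open>K is the part of the quotient that does not involve \<open>y n\<close>. Times K,
    the one-variable expansion at w = \<open>y n\<close> becomes the full quotient, and each residue
    becomes a quotient with one x and one y fewer.\<close>
  define K where "K = Y powi c * alt_prod (tdiff p) {1..m} y / (\<Prod>i\<le>n. \<Prod>j=1..m. theta p (x i * y j / q))"
  define D where "D i a = q powi (c + int m + 2 * a\<^sup>2 - 2 * c * a + (int m + 2) * a) * x i powi (1 - c + 2 * a) *
      X powi (- a) / (qpoch p p ^ 2 * (\<Prod>l\<in>{..n} - {i}. tdiff p (x l) (x i))) /
      (1 - q powi (2 * a - 1) * x i * y n)" for i a
  define T where "T i a = D i a * Y powi (- a) * (\<Prod>j=1..m. theta p (x i * y j / q))" for i a
  have th0: "theta p (x i * y j / q) \<noteq> 0" if "i \<le> n" "j \<in> {1..n}" for i j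
    unfolding p_def
  proof (rule theta_nonzero_of_norm_odd[OF q0 q1, of _ "-1"])
    show "norm (x i * y j / q) = norm q powi - 1"
      using that Suc.prems by (simp add: n_def norm_mult norm_divide inverse_eq_divide)
  qed auto
  have "((\<lambda>(i, a). T i a) has_sum y n powi c * (\<Prod>j=1..m. tdiff p (y j) (y n)) / (\<Prod>i\<le>n. theta p (x i * y n / q))) ({..n} \<times> UNIV)"
  proof -
    have "norm (y j) = 1" if "j \<in> {1..m}" for j using Suc.prems(3) that by simp
    moreover have "norm (y n) = 1" using Suc.prems(3) by (simp add: n_def)
    ultimately show ?thesis
      using theta_quotient_expansion[OF q0 q1 Suc.prems(1,2), of y "y n" c]
      unfolding T_def D_def p_def n_def X_def Y_def
      by (simp only: divide_inverse mult_ac)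
  qed
  hence "((\<lambda>ia. K * (case ia of (i, a) \<Rightarrow> T i a)) has_sum K * (y n powi c * (\<Prod>j=1..m. tdiff p (y j) (y n)) / (\<Prod>i\<le>n. theta p (x i * y n / q)))) ({..n} \<times> UNIV)"
    by (rule has_sum_cmult_right)
  also have "K * (y n powi c * (\<Prod>j=1..m. tdiff p (y j) (y n)) / (\<Prod>i\<le>n. theta p (x i * y n / q))) =
      (\<Prod>j=1..n. y j) powi c * alt_prod (tdiff p) {1..n} y / (\<Prod>i\<le>n. \<Prod>j=1..n. theta p (x i * y j / q))"
  proof -
    have "{1..n} = insert n {1..m}" by (auto simp: n_def)
    hence "alt_prod (tdiff p) {1..n} y = alt_prod (tdiff p) {1..m} y * (\<Prod>j=1..m. tdiff p (y j) (y n))"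
      by (simp only:) (rule alt_prod_insert_max, auto simp: n_def)
    moreover have "(\<Prod>j=1..n. y j) = Y * y n" by (simp add: n_def Y_def)
    moreover have "(\<Prod>i\<le>n. \<Prod>j=1..n. theta p (x i * y j / q)) =
        (\<Prod>i\<le>n. \<Prod>j=1..m. theta p (x i * y j / q)) * (\<Prod>i\<le>n. theta p (x i * y n / q))"
      unfolding prod.distrib[symmetric] by (intro prod.cong refl) (simp add: n_def)
    ultimately show ?thesis unfolding K_def by (simp add: power_int_mult_distrib)
  qed
  finally have outer: "((\<lambda>ia. K * (case ia of (i, a) \<Rightarrow> T i a)) has_sum
      (\<Prod>j=1..n. y j) powi c * alt_prod (tdiff p) {1..n} y / (\<Prod>i\<le>n. \<Prod>j=1..n. theta p (x i * y j / q))) ({..n} \<times> UNIV)" .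
  define h where "h = (\<lambda>((i, a), (\<sigma> :: nat \<Rightarrow> nat, k)). (Transposition.transpose n i \<circ> \<sigma>, k(n := a :: int)))"
  define F where "F = (\<lambda>(\<sigma>, k). gterm q n c (x \<circ> \<sigma>) y k)"
  have bij: "bij_betw h (({..n} \<times> UNIV) \<times> ({\<sigma>. \<sigma> permutes {..m}} \<times> ({1..m} \<rightarrow>\<^sub>E UNIV)))
     ({\<sigma>. \<sigma> permutes {..n}} \<times> ({1..n} \<rightarrow>\<^sub>E UNIV))"
    unfolding h_def n_def by (rule bij_betw_permutes_PiE_Suc)
  have inner: "((\<lambda>\<sigma>k. F (h (ia, \<sigma>k))) has_sum K * (case ia of (i, a) \<Rightarrow> T i a)) ({\<sigma>. \<sigma> permutes {..m}} \<times> ({1..m} \<rightarrow>\<^sub>E UNIV))"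
    if ia: "ia \<in> {..n} \<times> UNIV" for ia
  proof -
    obtain i a where ia': "ia = (i, a)" by (cases ia)
    have i: "i \<le> n" using ia ia' by simp
    \<comment> \<open>The transposition puts \<open>x i\<close> in the last place; the other
      variables occupy the places 0 to m, so the induction hypothesis applies to x'.\<close>
    define x' where "x' = x \<circ> Transposition.transpose n i"
    have tr: "bij_betw (Transposition.transpose n i) {..m} ({..n} - {i})"
      using bij_betw_transpose_atMost[of i m] i by (simp add: n_def)
    have "norm (x' l) = 1" if "l \<le> m" for l
      using Suc.prems(1)[of "Transposition.transpose n i l"] bij_betwE[OF tr] that by (simp add: x'_def n_def)
    moreover have "inj_on x' {..m}"
      unfolding x'_def using tr Suc.prems(2) by (intro comp_inj_on) (auto simp: bij_betw_def n_def intro: inj_on_subset)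
    moreover have "norm (y j) = 1" if "j \<in> {1..m}" for j using Suc.prems(3)[of j] that by simp
    ultimately have IH: "((\<lambda>(\<sigma>, k). gterm q m (c - a) (x' \<circ> \<sigma>) y k) has_sum
           Y powi (c - a) * alt_prod (tdiff p) {1..m} y / (\<Prod>i\<le>m. \<Prod>j=1..m. theta p (x' i * y j / q)))
         ({\<sigma>. \<sigma> permutes {..m}} \<times> ({1..m} \<rightarrow>\<^sub>E UNIV))"
      unfolding Y_def p_def by (rule Suc.IH)
    have "((\<lambda>\<sigma>k. D i a * (case \<sigma>k of (\<sigma>, k) \<Rightarrow> gterm q m (c - a) (x' \<circ> \<sigma>) y k)) has_sum
           D i a * (Y powi (c - a) * alt_prod (tdiff p) {1..m} y / (\<Prod>i\<le>m. \<Prod>j=1..m. theta p (x' i * y j / q))))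
         ({\<sigma>. \<sigma> permutes {..m}} \<times> ({1..m} \<rightarrow>\<^sub>E UNIV))"
      using IH by (rule has_sum_cmult_right)
    also have "D i a * (Y powi (c - a) * alt_prod (tdiff p) {1..m} y / (\<Prod>i\<le>m. \<Prod>j=1..m. theta p (x' i * y j / q))) = K * T i a"
    proof -
      define P where "P l = (\<Prod>j=1..m. theta p (x l * y j / q))" for l
      have "(\<Prod>l\<le>m. P (Transposition.transpose n i l)) = (\<Prod>l\<in>{..n} - {i}. P l)" by (rule prod.reindex_bij_betw[OF tr])
      hence 1: "(\<Prod>l\<le>m. \<Prod>j=1..m. theta p (x' l * y j / q)) = (\<Prod>l\<in>{..n} - {i}. P l)" by (simp add: P_def x'_def)
      have 2: "(\<Prod>l\<le>n. P l) = P i * (\<Prod>l\<in>{..n} - {i}. P l)"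
        using i by (intro prod.remove) auto
      have 3: "P i \<noteq> 0" using th0 i by (auto simp: P_def n_def)
      have 4: "Y powi (c - a) = Y powi c * Y powi (- a)" using y0 by (simp flip: power_int_add)
      show ?thesis unfolding K_def T_def 1 4 P_def[symmetric] 2 using 3 by (simp add: mult_ac)
    qed
    also have "((\<lambda>\<sigma>k. D i a * (case \<sigma>k of (\<sigma>, k) \<Rightarrow> gterm q m (c - a) (x' \<circ> \<sigma>) y k)) has_sum K * T i a)
         ({\<sigma>. \<sigma> permutes {..m}} \<times> ({1..m} \<rightarrow>\<^sub>E UNIV)) \<longleftrightarrow> ?thesis"
      unfolding ia' prod.case
    proof (rule has_sum_cong, clarify)
      fix \<sigma> k assume \<sigma>: "\<sigma> permutes {..m}"
      define xx where "xx = x \<circ> (Transposition.transpose n i \<circ> \<sigma>)"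
      have xx: "xx = x' \<circ> \<sigma>" by (simp add: xx_def x'_def o_assoc)
      have "\<sigma> permutes {..n}" using \<sigma> by (rule permutes_subset) (auto simp: n_def)
      hence perm: "Transposition.transpose n i \<circ> \<sigma> permutes {..n}"
        using i by (intro permutes_compose permutes_swap_id) auto
      have xxn: "xx n = x i" using permutes_not_in[OF \<sigma>, of n] by (simp add: xx_def n_def)
      have XX: "(\<Prod>l\<le>n. xx l) = X" unfolding X_def xx_def using prod.permute[OF perm, of x] by (simp add: o_def)
      have "(\<Prod>l\<le>m. tdiff p (xx l) (x i)) = (\<Prod>l\<le>m. tdiff p (x' l) (x i))"
        unfolding xx using prod.permute[OF \<sigma>, of "\<lambda>l. tdiff p (x' l) (x i)"] by (simp add: o_def)
      also have "\<dots> = (\<Prod>l\<in>{..n} - {i}. tdiff p (x l) (x i))"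
        unfolding x'_def o_def by (rule prod.reindex_bij_betw[OF tr])
      finally have td: "(\<Prod>l\<le>m. tdiff p (xx l) (x i)) = (\<Prod>l\<in>{..n} - {i}. tdiff p (x l) (x i))" .
      have "xx l \<noteq> 0" if "l \<le> Suc m" for l
        using x0 permutes_in_image[OF perm, of l] that by (simp add: xx_def n_def)
      hence "gterm q n c xx y (k(n := a)) =
        q powi (c + int m + 2 * a\<^sup>2 - 2 * c * a + (int m + 2) * a) * xx n powi (1 - c + 2 * a) *
          (\<Prod>l\<le>n. xx l) powi (- a) / (qpoch p p ^ 2 * (\<Prod>l\<le>m. tdiff p (xx l) (xx n))) /
          (1 - q powi (2 * a - 1) * xx n * y n) * gterm q m (c - a) xx y k"
        unfolding n_def p_def by (intro gterm_Suc q0)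
      hence "gterm q n c xx y (k(n := a)) = D i a * gterm q m (c - a) xx y k"
        unfolding xxn XX td D_def .
      thus "D i a * gterm q m (c - a) (x' \<circ> \<sigma>) y k = F (h ((i, a), \<sigma>, k))"
        by (simp add: F_def h_def xx xx_def[symmetric])
    qed
    finally show ?thesis .
  qed
  have "F summable_on ({\<sigma>. \<sigma> permutes {..n}} \<times> ({1..n} \<rightarrow>\<^sub>E UNIV))"
    unfolding F_def using Suc.prems by (intro summable_gterm[OF q0 q1]) (auto simp: n_def)
  hence "(\<lambda>z. F (h z)) summable_on (({..n} \<times> UNIV) \<times> ({\<sigma>. \<sigma> permutes {..m}} \<times> ({1..m} \<rightarrow>\<^sub>E UNIV)))"
    using summable_on_reindex_bij_betw[OF bij] by blast
  from has_sum_SigmaI[OF inner outer this]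
  have "((\<lambda>z. F (h z)) has_sum
      (\<Prod>j=1..n. y j) powi c * alt_prod (tdiff p) {1..n} y / (\<Prod>i\<le>n. \<Prod>j=1..n. theta p (x i * y j / q)))
      (({..n} \<times> UNIV) \<times> ({\<sigma>. \<sigma> permutes {..m}} \<times> ({1..m} \<rightarrow>\<^sub>E UNIV)))" by simp
  hence "(F has_sum
      (\<Prod>j=1..n. y j) powi c * alt_prod (tdiff p) {1..n} y / (\<Prod>i\<le>n. \<Prod>j=1..n. theta p (x i * y j / q)))
      ({\<sigma>. \<sigma> permutes {..n}} \<times> ({1..n} \<rightarrow>\<^sub>E UNIV))"
    using has_sum_reindex_bij_betw[OF bij] by blast
  thus ?case unfolding F_def n_def p_def .
qed

subsection \<open>Alternating products and the Vandermonde determinant\<close>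

lemma alt_prod_pairs:
  assumes "finite S"
  shows "alt_prod E S x = (\<Prod>(i, j)\<in>{(i, j). i \<in> S \<and> j \<in> S \<and> i < j}. E (x i) (x j))"
proof -
  have "alt_prod E S x = (\<Prod>(j, i)\<in>(SIGMA j:S. {i \<in> S. i < j}). E (x i) (x j))"
    unfolding alt_prod_def using assms by (subst prod.Sigma) auto
  also have "\<dots> = (\<Prod>(i, j)\<in>{(i, j). i \<in> S \<and> j \<in> S \<and> i < j}. E (x i) (x j))"
    by (rule prod.reindex_bij_witness[of _ prod.swap prod.swap]) auto
  finally show ?thesis .
qed

lemma alt_prod_transpose:
  fixes E :: "'a \<Rightarrow> 'a \<Rightarrow> 'b :: comm_ring_1"
  assumes S: "finite S" and ab: "a \<in> S" "b \<in> S" "a \<noteq> b"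
    and antisym: "\<And>i j. i \<in> S \<Longrightarrow> j \<in> S \<Longrightarrow> E (x j) (x i) = - E (x i) (x j)"
  shows "alt_prod E S (x \<circ> Transposition.transpose a b) = - alt_prod E S x"
  using ab
proof (induction a b rule: linorder_wlog)
  case (sym a b)
  thus ?case by (simp add: transpose_commute)
next
  case (le a b)
  hence ab: "a < b" "a \<in> S" "b \<in> S" by auto
  define \<tau> where "\<tau> = Transposition.transpose a b"
  have \<tau>S: "\<tau> i \<in> S \<longleftrightarrow> i \<in> S" for i using ab by (auto simp: \<tau>_def Transposition.transpose_def)
  have \<tau>\<tau>: "\<tau> (\<tau> i) = i" for i by (simp add: \<tau>_def)
  have \<tau>inj: "\<tau> i = \<tau> j \<longleftrightarrow> i = j" for i j using \<tau>\<tau> by metis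
  define P where "P = {(i, j). i \<in> S \<and> j \<in> S \<and> i < j}"
  have "P \<subseteq> S \<times> S" by (auto simp: P_def)
  hence P: "finite P" using S finite_subset by blast
  define G where "G = (\<lambda>(i, j). E (x i) (x j))"
  \<comment> \<open>\<open>f\<close> sorts the image of a pair under \<tau>, and \<open>s\<close>
    records the sign that sorting costs by antisymmetry.\<close>
  define s :: "nat \<times> nat \<Rightarrow> 'b" where "s = (\<lambda>(i, j). if \<tau> i < \<tau> j then 1 else - 1)"
  define f where "f = (\<lambda>(i, j). if \<tau> i < \<tau> j then (\<tau> i, \<tau> j) else (\<tau> j, \<tau> i))"
  have "alt_prod E S (x \<circ> \<tau>) = (\<Prod>z\<in>P. s z * G (f z))"
    unfolding alt_prod_pairs[OF S] P_def[symmetric]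
  proof (intro prod.cong refl)
    fix z assume z: "z \<in> P"
    obtain i j where ij: "z = (i, j)" by (cases z)
    have "E (x (\<tau> i)) (x (\<tau> j)) = - E (x (\<tau> j)) (x (\<tau> i))"
      using z by (intro antisym) (auto simp: ij P_def \<tau>S)
    thus "(case z of (i, j) \<Rightarrow> E ((x \<circ> \<tau>) i) ((x \<circ> \<tau>) j)) = s z * G (f z)"
      by (simp add: ij s_def G_def f_def)
  qed
  also have "\<dots> = prod s P * (\<Prod>z\<in>P. G (f z))" by (rule prod.distrib)
  also have "(\<Prod>z\<in>P. G (f z)) = prod G P"
  proof (rule prod.reindex_bij_witness[of _ f f])
    fix z assume z: "z \<in> P"
    obtain i j where ij: "z = (i, j)" by (cases z)
    have ne: "i < j" "\<tau> i \<noteq> \<tau> j" using z by (auto simp: ij P_def \<tau>inj)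
    show "f (f z) = z" using ne by (auto simp: ij f_def \<tau>\<tau>)
    thus "f (f z) = z" .
    show "f z \<in> P" using z ne by (auto simp: ij f_def P_def \<tau>S)
    thus "f z \<in> P" .
  qed auto
  also have "prod s P = - 1"
  proof -
    define M where "M = {l \<in> S. a < l \<and> l < b}"
    have M: "finite M" using S by (simp add: M_def)
    \<comment> \<open>The pairs inverted by \<tau> are (a, b) and, for each l strictly between, (a,
      l) and (l, b): an odd number.\<close>
    have "{z \<in> P. \<not> (case z of (i, j) \<Rightarrow> \<tau> i < \<tau> j)} = insert (a, b) (Pair a ` M \<union> (\<lambda>l. (l, b)) ` M)"
      using ab by (auto simp: P_def M_def \<tau>_def Transposition.transpose_def split: if_splits)
    moreover have "(a, b) \<notin> Pair a ` M \<union> (\<lambda>l. (l, b)) ` M" by (auto simp: M_def)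
    moreover have "Pair a ` M \<inter> (\<lambda>l. (l, b)) ` M = {}" by (auto simp: M_def)
    ultimately have "card {z \<in> P. \<not> (case z of (i, j) \<Rightarrow> \<tau> i < \<tau> j)} = Suc (card M + card M)"
      using M by (simp add: card_Un_disjoint card_image inj_on_def)
    moreover have "prod s P = (- 1) ^ card {z \<in> P. \<not> (case z of (i, j) \<Rightarrow> \<tau> i < \<tau> j)}"
    proof -
      have "prod s P = (\<Prod>z\<in>P. if \<not> (case z of (i, j) \<Rightarrow> \<tau> i < \<tau> j) then - 1 else 1)"
        by (intro prod.cong refl) (auto simp: s_def)
      also have "\<dots> = (\<Prod>z\<in>{z \<in> P. \<not> (case z of (i, j) \<Rightarrow> \<tau> i < \<tau> j)}. - 1)"
        using P by (rule prod.inter_filter[symmetric])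
      finally show ?thesis by simp
    qed
    ultimately show ?thesis by simp
  qed
  also have "- 1 * prod G P = - alt_prod E S x"
    unfolding alt_prod_pairs[OF S] P_def[symmetric] G_def by simp
  finally show ?case unfolding \<tau>_def .
qed

lemma alt_prod_permute:
  fixes E :: "'a \<Rightarrow> 'a \<Rightarrow> 'b :: comm_ring_1"
  assumes "finite S" "\<sigma> permutes S"
    and "\<And>i j. i \<in> S \<Longrightarrow> j \<in> S \<Longrightarrow> E (x j) (x i) = - E (x i) (x j)"
  shows "alt_prod E S (x \<circ> \<sigma>) = of_int (sign \<sigma>) * alt_prod E S x"
  using assms(2,1,3)
proof (induction arbitrary: x rule: permutes_induct)
  case id
  show ?case by simp
next
  case (swap a b p)
  define x' where "x' = x \<circ> Transposition.transpose a b"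
  have \<tau>S: "Transposition.transpose a b i \<in> S" if "i \<in> S" for i
    using swap.hyps(1,2) that by (auto simp: Transposition.transpose_def)
  have "E (x' j) (x' i) = - E (x' i) (x' j)" if "i \<in> S" "j \<in> S" for i j
    unfolding x'_def o_def by (rule swap.prems) (intro \<tau>S that)+
  hence "alt_prod E S (x' \<circ> p) = of_int (sign p) * alt_prod E S x'" by (rule swap.IH)
  also have "alt_prod E S x' = - alt_prod E S x"
    unfolding x'_def by (rule alt_prod_transpose[OF assms(1) swap.hyps(1,2,3)]) (rule swap.prems)
  also have "x' \<circ> p = x \<circ> (Transposition.transpose a b \<circ> p)" by (simp add: x'_def o_assoc)
  also have "of_int (sign p) * - alt_prod E S x = of_int (sign (Transposition.transpose a b \<circ> p)) * alt_prod E S x"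
  proof -
    have "permutation p" using assms(1) swap.hyps(4) by (rule permutes_imp_permutation)
    thus ?thesis using swap.hyps(3) by (simp add: sign_compose permutation_swap_id sign_swap_id)
  qed
  finally show ?case .
qed

section \<open>The Vandermonde determinant in Leibniz form\<close>

definition vdm :: "nat \<Rightarrow> (nat \<Rightarrow> complex) \<Rightarrow> complex" where
  "vdm n z = (\<Sum>\<sigma> | \<sigma> permutes {..n}. of_int (sign \<sigma>) * (\<Prod>i\<le>n. z i ^ \<sigma> i))"

lemma vdm_eq_0:
  assumes ab: "a \<le> n" "b \<le> n" "a \<noteq> b" and z: "z a = z b"
  shows "vdm n z = 0"
proof -
  define \<tau> where "\<tau> = Transposition.transpose a b"
  have \<tau>: "\<tau> permutes {..n}" unfolding \<tau>_def using ab by (intro permutes_swap_id) auto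
  have "vdm n z = (\<Sum>\<sigma> | \<sigma> permutes {..n}. of_int (sign (\<sigma> \<circ> \<tau>)) * (\<Prod>i\<le>n. z i ^ (\<sigma> \<circ> \<tau>) i))"
    unfolding vdm_def by (rule sum_permutations_compose_right[OF \<tau>])
  also have "\<dots> = (\<Sum>\<sigma> | \<sigma> permutes {..n}. - (of_int (sign \<sigma>) * (\<Prod>i\<le>n. z i ^ \<sigma> i)))"
  proof (intro sum.cong refl)
    fix \<sigma> assume "\<sigma> \<in> {\<sigma>. \<sigma> permutes {..n}}"
    hence "permutation \<sigma>" by (auto intro: permutes_imp_permutation)
    hence "sign (\<sigma> \<circ> \<tau>) = - sign \<sigma>"
      using ab by (simp add: \<tau>_def sign_compose permutation_swap_id sign_swap_id)
    moreover have "(\<Prod>i\<le>n. z i ^ (\<sigma> \<circ> \<tau>) i) = (\<Prod>i\<le>n. z i ^ \<sigma> i)"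
    proof -
      have "z (\<tau> i) = z i" for i using z by (auto simp: \<tau>_def Transposition.transpose_def)
      thus ?thesis using prod.permute[OF \<tau>, of "\<lambda>i. z i ^ \<sigma> i"] by (simp add: o_def)
    qed
    ultimately show "of_int (sign (\<sigma> \<circ> \<tau>)) * (\<Prod>i\<le>n. z i ^ (\<sigma> \<circ> \<tau>) i) = - (of_int (sign \<sigma>) * (\<Prod>i\<le>n. z i ^ \<sigma> i))"
      by simp
  qed
  also have "\<dots> = - vdm n z" by (simp add: vdm_def sum_negf)
  finally show ?thesis by simp
qed

lemma permutes_atMost_Suc_fixed:
  "{\<sigma>. \<sigma> permutes {..Suc m} \<and> \<sigma> (Suc m) = Suc m} = {\<sigma>. \<sigma> permutes {..m}}"
proof (intro equalityI subsetI CollectI; elim CollectE conjE)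
  fix \<sigma> assume s: "\<sigma> permutes {..Suc m}" "\<sigma> (Suc m) = Suc m"
  show "\<sigma> permutes {..m}"
    using s(1) by (rule permutes_superset) (use s(2) in \<open>auto simp: le_Suc_eq\<close>)
next
  fix \<sigma> assume s: "\<sigma> permutes {..m}"
  have "\<sigma> permutes {..Suc m}" using s by (rule permutes_subset) auto
  thus "\<sigma> permutes {..Suc m} \<and> \<sigma> (Suc m) = Suc m" using permutes_not_in[OF s, of "Suc m"] by auto
qed

text \<open>As a polynomial in the last variable, the determinant has the other variables as roots
  and the smaller determinant as leading coefficient. If the other variables are not distinct, both
  sides vanish.\<close>

theorem vandermonde_eq: "vdm n z = alt_prod (\<lambda>a b. b - a) {..n} z"
proof (induction n)
  case 0
  have "{\<sigma>. \<sigma> permutes {..0::nat}} = {id}" by (simp add: atMost_0)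
  thus ?case by (simp add: vdm_def alt_prod_def)
next
  case (Suc m)
  show ?case
  proof (cases "inj_on z {..m}")
    case False
    then obtain a b where ab: "a \<le> m" "b \<le> m" "a < b" "z a = z b"
      unfolding inj_on_def by (metis atMost_iff linorder_neqE_nat)
    have "alt_prod (\<lambda>a b. b - a) {..Suc m} z = 0"
      unfolding alt_prod_def using ab by (subst prod_zero_iff) (auto intro!: bexI[of _ b] exI[of _ a])
    thus ?thesis using vdm_eq_0[of a "Suc m" b z] ab by simp
  next
    case True
    define c where "c \<sigma> = of_int (sign \<sigma>) * (\<Prod>i\<le>m. z i ^ \<sigma> i)" for \<sigma> :: "nat \<Rightarrow> nat"
    define P where "P = (\<Sum>\<sigma> | \<sigma> permutes {..Suc m}. monom (c \<sigma>) (\<sigma> (Suc m)))"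
    \<comment> \<open>The leading terms cancel, so Q has degree at most m, yet it has m + 1 distinct
      roots.\<close>
    define Q where "Q = P - smult (vdm m z) (\<Prod>j\<le>m. [:- z j, 1:])"
    have fin: "finite {\<sigma>. \<sigma> permutes {..Suc m}}" by (intro finite_permutations) auto
    have poly_P: "poly P w = vdm (Suc m) (z(Suc m := w))" for w
    proof -
      have "(\<Prod>i\<le>m. (z(Suc m := w)) i ^ \<sigma> i) = (\<Prod>i\<le>m. z i ^ \<sigma> i)" for \<sigma> by (intro prod.cong) auto
      thus ?thesis by (simp add: P_def poly_sum poly_monom vdm_def c_def mult.assoc)
    qed
    have root: "poly Q (z j) = 0" if j: "j \<le> m" for j
    proof -
      have "vdm (Suc m) (z(Suc m := z j)) = 0" using j by (intro vdm_eq_0[of j _ "Suc m"]) auto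
      moreover have "(\<Prod>l\<le>m. poly [:- z l, 1:] (z j)) = 0" using j by (subst prod_zero_iff) (auto intro!: bexI[of _ j])
      ultimately show ?thesis by (simp add: Q_def poly_P poly_prod)
    qed
    have degP: "degree P \<le> Suc m"
      unfolding P_def
    proof (rule degree_sum_le[OF fin])
      fix \<sigma> assume "\<sigma> \<in> {\<sigma>. \<sigma> permutes {..Suc m}}"
      hence "\<sigma> (Suc m) \<le> Suc m" using permutes_in_image[of \<sigma> "{..Suc m}" "Suc m"] by auto
      thus "degree (monom (c \<sigma>) (\<sigma> (Suc m))) \<le> Suc m" using degree_monom_le order_trans by blast
    qed
    have degR: "degree (\<Prod>j\<le>m. [:- z j, 1:]) = Suc m" by (subst degree_prod_eq_sum_degree) auto
    have "lead_coeff (\<Prod>j\<le>m. [:- z j, 1:]) = 1" by (simp add: lead_coeff_prod)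
    hence cR: "coeff (\<Prod>j\<le>m. [:- z j, 1:]) (Suc m) = 1" using degR by simp
    have cP: "coeff P (Suc m) = vdm m z"
    proof -
      have "coeff P (Suc m) = (\<Sum>\<sigma> | \<sigma> permutes {..Suc m}. if \<sigma> (Suc m) = Suc m then c \<sigma> else 0)"
        by (simp add: P_def coeff_sum)
      also have "\<dots> = (\<Sum>\<sigma> | \<sigma> permutes {..Suc m} \<and> \<sigma> (Suc m) = Suc m. c \<sigma>)"
        using fin by (simp add: sum.inter_filter[symmetric])
      finally show ?thesis unfolding permutes_atMost_Suc_fixed by (simp add: vdm_def c_def)
    qed
    have "Q = 0"
    proof (rule ccontr)
      assume "Q \<noteq> 0"
      have "degree Q \<le> Suc m" unfolding Q_def using degP degR by (intro degree_diff_le) auto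
      moreover have "coeff Q (Suc m) = 0" by (simp add: Q_def cP cR)
      ultimately have "degree Q \<le> m"
        using \<open>Q \<noteq> 0\<close> by (metis le_SucE leading_coeff_0_iff)
      moreover have "card (z ` {..m}) \<le> card {w. poly Q w = 0}"
        using \<open>Q \<noteq> 0\<close> root by (intro card_mono poly_roots_finite) auto
      moreover have "card {w. poly Q w = 0} \<le> degree Q" using \<open>Q \<noteq> 0\<close> by (rule card_poly_roots_bound)
      ultimately show False using card_image[OF True] by simp
    qed
    hence "poly P (z (Suc m)) = vdm m z * (\<Prod>j\<le>m. z (Suc m) - z j)"
      by (simp add: Q_def poly_prod)
    hence "vdm (Suc m) z = alt_prod (\<lambda>a b. b - a) {..m} z * (\<Prod>j\<le>m. z (Suc m) - z j)"
      by (simp add: poly_P Suc.IH)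
    also have "\<dots> = alt_prod (\<lambda>a b. b - a) {..Suc m} z"
      unfolding atMost_Suc by (rule alt_prod_insert_max[symmetric]) auto
    finally show ?thesis .
  qed
qed

text \<open>The case of exponents \<open>1, \<dots>, m\<close> is obtained by setting the variable of index \<open>0\<close> to zero.\<close>

lemma vandermonde_from_1:
  fixes z :: "nat \<Rightarrow> complex"
  shows "(\<Sum>\<tau> | \<tau> permutes {1..m}. of_int (sign \<tau>) * (\<Prod>l=1..m. z l ^ \<tau> l)) =
    (\<Prod>l=1..m. z l) * alt_prod (\<lambda>a b. b - a) {1..m} z"
proof -
  define z' where "z' = z(0 := 0)"
  have split: "(\<Prod>i\<le>m. f i) = f 0 * (\<Prod>i=1..m. f i)" for f :: "nat \<Rightarrow> complex"
    by (simp add: atLeast0AtMost[symmetric] prod.atLeast_Suc_atMost)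
  have "vdm m z' = (\<Sum>\<sigma> | \<sigma> permutes {..m}. if \<sigma> 0 = 0 then of_int (sign \<sigma>) * (\<Prod>l=1..m. z l ^ \<sigma> l) else 0)"
    unfolding vdm_def
  proof (intro sum.cong refl)
    fix \<sigma> :: "nat \<Rightarrow> nat"
    have "(\<Prod>i=1..m. z' i ^ \<sigma> i) = (\<Prod>i=1..m. z i ^ \<sigma> i)" by (intro prod.cong) (auto simp: z'_def)
    thus "of_int (sign \<sigma>) * (\<Prod>i\<le>m. z' i ^ \<sigma> i) = (if \<sigma> 0 = 0 then of_int (sign \<sigma>) * (\<Prod>l=1..m. z l ^ \<sigma> l) else 0)"
      unfolding split by (simp add: z'_def power_0_left)
  qed
  also have "\<dots> = (\<Sum>\<sigma> | \<sigma> permutes {..m} \<and> \<sigma> 0 = 0. of_int (sign \<sigma>) * (\<Prod>l=1..m. z l ^ \<sigma> l))"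
    using finite_permutations[of "{..m}"] by (simp add: sum.inter_filter[symmetric])
  also have "{\<sigma>. \<sigma> permutes {..m} \<and> \<sigma> 0 = 0} = {\<sigma>. \<sigma> permutes {1..m}}"
  proof (intro equalityI subsetI CollectI; elim CollectE conjE)
    fix \<sigma> assume s: "\<sigma> permutes {..m}" "\<sigma> 0 = 0"
    show "\<sigma> permutes {1..m}"
    proof (rule permutes_superset[OF s(1)])
      fix l assume "l \<in> {..m} - {1..m}"
      hence "l = 0" by auto
      thus "\<sigma> l = l" using s(2) by simp
    qed
  next
    fix \<sigma> assume s: "\<sigma> permutes {1..m}"
    have "\<sigma> permutes {..m}" using s by (rule permutes_subset) auto
    thus "\<sigma> permutes {..m} \<and> \<sigma> 0 = 0" using permutes_not_in[OF s, of 0] by auto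
  qed
  finally have "(\<Sum>\<tau> | \<tau> permutes {1..m}. of_int (sign \<tau>) * (\<Prod>l=1..m. z l ^ \<tau> l)) = alt_prod (\<lambda>a b. b - a) {..m} z'"
    by (simp add: vandermonde_eq)
  also have "\<dots> = (\<Prod>l=1..m. z l) * alt_prod (\<lambda>a b. b - a) {1..m} z"
  proof (induction m)
    case (Suc m)
    have "{1..Suc m} = insert (Suc m) {1..m}" by auto
    hence "alt_prod (\<lambda>a b. b - a) {1..Suc m} z = alt_prod (\<lambda>a b. b - a) {1..m} z * (\<Prod>i=1..m. z (Suc m) - z i)"
      by (simp only:) (rule alt_prod_insert_max, auto)
    moreover have "alt_prod (\<lambda>a b. b - a) {..Suc m} z' = alt_prod (\<lambda>a b. b - a) {..m} z' * (\<Prod>i\<le>m. z' (Suc m) - z' i)"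
      unfolding atMost_Suc by (rule alt_prod_insert_max) auto
    moreover have "(\<Prod>i\<le>m. z' (Suc m) - z' i) = z (Suc m) * (\<Prod>i=1..m. z (Suc m) - z i)"
    proof -
      have "(\<Prod>i=1..m. z' (Suc m) - z' i) = (\<Prod>i=1..m. z (Suc m) - z i)"
        by (intro prod.cong) (auto simp: z'_def)
      moreover have "z' (Suc m) - z' 0 = z (Suc m)" by (simp add: z'_def)
      ultimately show ?thesis
        by (simp add: atLeast0AtMost[symmetric] prod.atLeast_Suc_atMost[of 0])
    qed
    ultimately show ?case using Suc by (simp add: mult_ac)
  qed (simp add: alt_prod_def)
  finally show ?thesis .
qed

subsection \<open>Summability over the index set\<close>

definition half_line :: "int \<Rightarrow> int set" where
  "half_line a = (if a \<le> 0 then {..0} else {1..})"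

text \<open>The union over J of the products \<open>int_vecs m J\<close> x
  \<open>int_vecs m J\<close>, fibred over k: for given k, the set \<open>half_line (k l)\<close> is
  the range of the geometric series that produces r l.\<close>

definition same_side :: "nat \<Rightarrow> ((nat \<Rightarrow> int) \<times> (nat \<Rightarrow> int)) set" where
  "same_side m = (SIGMA k:({1..m} \<rightarrow>\<^sub>E UNIV). (\<Pi>\<^sub>E l\<in>{1..m}. half_line (k l)))"

lemma half_line_iff: "b \<in> half_line a \<longleftrightarrow> (b \<le> 0 \<longleftrightarrow> a \<le> 0)"
  by (auto simp: half_line_def)

lemma same_side_iff:
  "(k, r) \<in> same_side m \<longleftrightarrow> k \<in> {1..m} \<rightarrow>\<^sub>E UNIV \<and> r \<in> {1..m} \<rightarrow>\<^sub>E UNIV \<and> (\<forall>l\<in>{1..m}. k l \<le> 0 \<longleftrightarrow> r l \<le> 0)"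
  by (auto simp: same_side_def half_line_iff PiE_iff)

lemma int_vecs_product: "int_vecs m J \<times> int_vecs m J \<subseteq> same_side m"
proof
  fix z assume "z \<in> int_vecs m J \<times> int_vecs m J"
  then obtain k r where z: "z = (k, r)" "k \<in> int_vecs m J" "r \<in> int_vecs m J" by (cases z) blast
  have "k l \<le> 0 \<longleftrightarrow> l \<in> J" "r l \<le> 0 \<longleftrightarrow> l \<in> J" if "l \<in> {1..m}" for l
    using z(2,3) that unfolding int_vecs_def by blast+
  thus "z \<in> same_side m" using z(2,3) unfolding z(1) same_side_iff int_vecs_def by blast
qed

lemma bij_betw_int_vecs:
  "bij_betw snd (SIGMA J:Pow {1..m}. int_vecs m J \<times> int_vecs m J) (same_side m)"
proof (rule bij_betw_imageI)
  show "inj_on snd (SIGMA J:Pow {1..m}. int_vecs m J \<times> int_vecs m J)"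
    by (auto simp: inj_on_def int_vecs_def)
  show "snd ` (SIGMA J:Pow {1..m}. int_vecs m J \<times> int_vecs m J) = same_side m"
  proof (intro equalityI subsetI)
    fix z assume "z \<in> snd ` (SIGMA J:Pow {1..m}. int_vecs m J \<times> int_vecs m J)"
    then obtain J where "J \<subseteq> {1..m}" "z \<in> int_vecs m J \<times> int_vecs m J" by auto
    thus "z \<in> same_side m" using int_vecs_product by blast
  next
    fix z assume z: "z \<in> same_side m"
    obtain k r where kr: "z = (k, r)" by (cases z)
    define J where "J = {j \<in> {1..m}. k j \<le> 0}"
    have "(k, r) \<in> int_vecs m J \<times> int_vecs m J"
      using z unfolding kr same_side_iff int_vecs_def J_def by auto
    thus "z \<in> snd ` (SIGMA J:Pow {1..m}. int_vecs m J \<times> int_vecs m J)"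
      unfolding kr by (intro image_eqI[of _ _ "(J, (k, r))"]) (auto simp: J_def)
  qed
qed

lemma infsum_same_side:
  fixes f :: "_ \<Rightarrow> complex"
  assumes "f summable_on same_side m"
  shows "infsum f (same_side m) = (\<Sum>J\<in>Pow {1..m}. infsum f (int_vecs m J \<times> int_vecs m J))"
proof -
  have "(f has_sum infsum f (same_side m)) (same_side m)" using assms by (rule has_sum_infsum)
  hence "((\<lambda>z. f (snd z)) has_sum infsum f (same_side m)) (SIGMA J:Pow {1..m}. int_vecs m J \<times> int_vecs m J)"
    using has_sum_reindex_bij_betw[OF bij_betw_int_vecs] by blast
  moreover have "((\<lambda>y. f (snd (J, y))) has_sum infsum f (int_vecs m J \<times> int_vecs m J)) (int_vecs m J \<times> int_vecs m J)"
    if "J \<in> Pow {1..m}" for J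
    unfolding snd_conv using that int_vecs_product by (intro has_sum_infsum summable_on_subset[OF assms]) auto
  ultimately have "((\<lambda>J. infsum f (int_vecs m J \<times> int_vecs m J)) has_sum infsum f (same_side m)) (Pow {1..m})"
    by (rule has_sum_SigmaD)
  thus ?thesis by (simp add: has_sum_finite_iff)
qed

section \<open>Majorants: polynomial growth against geometric decay\<close>

lemma summable_poly_geometric:
  fixes x :: real
  assumes "norm x < 1"
  shows "summable (\<lambda>n. (1 + real n) ^ M * x ^ n)"
  using assms
proof (induction M arbitrary: x)
  case 0
  thus ?case by simp
next
  case (Suc M)
  \<comment> \<open>Termwise differentiation keeps convergence in the unit disc, and
    \<open>diffs c n\<close> = (n + 1) (n + 2)^M dominates the coefficient for M + 1.\<close>
  define c where "c n = (1 + real n) ^ M" for n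
  have "summable (\<lambda>n. diffs c n * \<bar>x\<bar> ^ n)"
    by (rule termdiff_converges[of _ 1]) (use Suc in \<open>auto simp: c_def\<close>)
  thus ?case
  proof (rule summable_comparison_test'[of _ 0])
    fix n :: nat
    have "(1 + real n) ^ M \<le> (1 + real (Suc n)) ^ M" by (intro power_mono) auto
    hence "(1 + real n) * (1 + real n) ^ M * \<bar>x\<bar> ^ n \<le> (1 + real n) * (1 + real (Suc n)) ^ M * \<bar>x\<bar> ^ n"
      by (intro mult_right_mono mult_left_mono) auto
    thus "norm ((1 + real n) ^ Suc M * x ^ n) \<le> diffs c n * \<bar>x\<bar> ^ n"
      by (simp add: diffs_def c_def abs_mult power_abs)
  qed
qed

lemma prod_ge_sum:
  fixes a :: "'a \<Rightarrow> int"
  assumes "finite S" "\<And>l. l \<in> S \<Longrightarrow> a l \<ge> 0"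
  shows "1 + (\<Sum>l\<in>S. a l) \<le> (\<Prod>l\<in>S. 1 + a l)"
  using assms
proof (induction S rule: finite_induct)
  case (insert x S)
  have "1 + (\<Sum>l\<in>insert x S. a l) \<le> (1 + a x) * (1 + (\<Sum>l\<in>S. a l))"
    using insert by (simp add: algebra_simps sum_nonneg)
  also have "\<dots> \<le> (1 + a x) * (\<Prod>l\<in>S. 1 + a l)"
    using insert by (intro mult_left_mono) auto
  finally show ?case using insert by simp
qed simp

text \<open>A product rather than a sum of sizes, so that its powers factor over the coordinates; by
  \<open>prod_ge_sum\<close> it still dominates every linear form that occurs.\<close>

definition vsize :: "nat \<Rightarrow> (nat \<Rightarrow> int) \<Rightarrow> (nat \<Rightarrow> int) \<Rightarrow> int" where
  "vsize m k r = (\<Prod>l=1..m. 1 + \<bar>k l\<bar>) * (\<Prod>l=1..m. 1 + \<bar>r l\<bar>)"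

lemma abs_tri_coeff_le: "\<exists>N. \<forall>k r. \<bar>tri_coeff m k r\<bar> \<le> (2 * vsize m k r) ^ N"
proof -
  \<comment> \<open>m linear factors, and two more for each pair i < j; each is at most twice
    \<open>vsize\<close> in absolute value.\<close>
  define N where "N = m + (\<Sum>i=1..m. \<Sum>j\<in>{i<..m}. 2)"
  have "\<bar>tri_coeff m k r\<bar> \<le> (2 * vsize m k r) ^ N" for k r
  proof -
    define V where "V = vsize m k r"
    have pk: "1 + (\<Sum>l=1..m. \<bar>k l\<bar>) \<le> (\<Prod>l=1..m. 1 + \<bar>k l\<bar>)" and pr: "1 + (\<Sum>l=1..m. \<bar>r l\<bar>) \<le> (\<Prod>l=1..m. 1 + \<bar>r l\<bar>)"
      by (intro prod_ge_sum; simp)+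
    have nn: "(\<Sum>l=1..m. \<bar>k l\<bar>) \<ge> 0" "(\<Sum>l=1..m. \<bar>r l\<bar>) \<ge> 0" by (auto intro: sum_nonneg)
    have "(1 + (\<Sum>l=1..m. \<bar>k l\<bar>)) * (1 + (\<Sum>l=1..m. \<bar>r l\<bar>)) \<le> V"
      unfolding V_def vsize_def using pk pr nn by (intro mult_mono prod_nonneg) auto
    moreover have "(\<Sum>l=1..m. \<bar>k l\<bar>) * (\<Sum>l=1..m. \<bar>r l\<bar>) \<ge> 0" using nn by auto
    moreover have "(1 + a) * (1 + b) = 1 + a + b + a * b" for a b :: int by (simp add: algebra_simps)
    ultimately have V: "(\<Sum>l=1..m. \<bar>k l\<bar>) + (\<Sum>l=1..m. \<bar>r l\<bar>) \<le> V" by (smt (verit))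
    hence V0: "V \<ge> 0" using nn by linarith
    have ki: "\<bar>k i\<bar> \<le> (\<Sum>l=1..m. \<bar>k l\<bar>)" "\<bar>r i\<bar> \<le> (\<Sum>l=1..m. \<bar>r l\<bar>)" if "i \<in> {1..m}" for i
      using that by (auto intro!: member_le_sum)
    have b1: "\<bar>k i + r i + vec_total m k\<bar> \<le> 2 * V" if i: "i \<in> {1..m}" for i
    proof -
      have "\<bar>vec_total m k\<bar> \<le> (\<Sum>l=1..m. \<bar>k l\<bar>)" unfolding vec_total_def by (rule sum_abs)
      thus ?thesis using ki[OF i] V nn by linarith
    qed
    have b2: "\<bar>(k i + r i - k j - r j) * (r i - r j)\<bar> \<le> (2 * V) ^ 2" if i: "i \<in> {1..m}" and j: "j \<in> {i<..m}" for i j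
    proof -
      have j': "j \<in> {1..m}" using i j by auto
      have "\<bar>k i + r i - k j - r j\<bar> \<le> 2 * V" "\<bar>r i - r j\<bar> \<le> 2 * V"
        using ki[OF i] ki[OF j'] V nn by linarith+
      thus ?thesis unfolding abs_mult power2_eq_square by (intro mult_mono) (use V0 in auto)
    qed
    have "\<bar>tri_coeff m k r\<bar> = (\<Prod>i=1..m. \<bar>k i + r i + vec_total m k\<bar>) *
        (\<Prod>i=1..m. \<Prod>j\<in>{i<..m}. \<bar>(k i + r i - k j - r j) * (r i - r j)\<bar>)"
      by (simp add: tri_coeff_def abs_mult abs_prod)
    also have "\<dots> \<le> (\<Prod>i=1..m. 2 * V) * (\<Prod>i=1..m. \<Prod>j\<in>{i<..m}. (2 * V) ^ 2)"
      using b1 b2 V0 by (intro mult_mono prod_mono prod_nonneg conjI) auto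
    also have "\<dots> = (2 * V) ^ N"
      unfolding N_def power_add power_sum by simp
    finally show ?thesis unfolding V_def .
  qed
  thus ?thesis by blast
qed

lemma tri_exponent_quad: "tri_exponent m k r = 2 * quad m k + (\<Sum>j=1..m. (2 * k j - 1) * r j) - int (m * (m + 1) div 2)"
  by (simp add: tri_exponent_def quad_def)

text \<open>Here the condition of equal sides is essential: 2 k l - 1 is odd and has the sign of k l
  (minus for k l = 0), so its product with r l is at least |r l|. The quadratic part is at least the
  sum of |k l| by \<open>two_quad\<close>.\<close>

lemma tri_exponent_ge:
  assumes "(k, r) \<in> same_side m"
  shows "(\<Sum>l=1..m. \<bar>k l\<bar>) + (\<Sum>l=1..m. \<bar>r l\<bar>) - int (m * (m + 1) div 2) \<le> tri_exponent m k r"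
proof -
  have "(\<Sum>l=1..m. \<bar>k l\<bar>) \<le> (\<Sum>l=1..m. (k l)\<^sup>2)"
  proof (intro sum_mono)
    fix l
    have "\<bar>k l\<bar> * 1 \<le> \<bar>k l\<bar> * \<bar>k l\<bar>"
    proof (cases "k l = 0")
      case False thus ?thesis by (intro mult_left_mono) auto
    qed simp
    thus "\<bar>k l\<bar> \<le> (k l)\<^sup>2" by (simp add: power2_eq_square flip: abs_mult)
  qed
  hence "(\<Sum>l=1..m. \<bar>k l\<bar>) \<le> 2 * quad m k" unfolding two_quad by (simp add: add_increasing2)
  moreover have "(\<Sum>l=1..m. \<bar>r l\<bar>) \<le> (\<Sum>l=1..m. (2 * k l - 1) * r l)"
  proof (intro sum_mono)
    fix l assume l: "l \<in> {1..m}"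
    show "\<bar>r l\<bar> \<le> (2 * k l - 1) * r l"
    proof (cases "k l \<le> 0")
      case True
      hence "r l \<le> 0" using assms l by (auto simp: same_side_iff)
      hence "(1 - 2 * k l) * (- r l) \<ge> 1 * (- r l)" using True by (intro mult_right_mono) auto
      thus ?thesis using \<open>r l \<le> 0\<close> by (simp add: algebra_simps)
    next
      case False
      hence "r l > 0" using assms l by (auto simp: same_side_iff)
      hence "(2 * k l - 1) * r l \<ge> 1 * r l" using False by (intro mult_right_mono) auto
      thus ?thesis using \<open>r l > 0\<close> by simp
    qed
  qed
  ultimately show ?thesis unfolding tri_exponent_quad by linarith
qed

lemma summable_vsize:
  fixes \<rho> :: real
  assumes \<rho>: "0 < \<rho>" "\<rho> < 1"
  shows "(\<lambda>(k, r). \<rho> powi tri_exponent m k r * of_int (vsize m k r) ^ N) summable_on same_side m"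
proof -
  define g where "g n = (1 + of_int \<bar>n\<bar>) ^ N * \<rho> powi \<bar>n\<bar>" for n :: int
  have g0: "g n \<ge> 0" for n using \<rho> by (simp add: g_def)
  have "(\<lambda>n. (1 + real (nat \<bar>n\<bar>)) ^ N * \<rho> ^ (nat \<bar>n\<bar>)) summable_on UNIV"
    using \<rho> by (intro summable_on_int_abs summable_poly_geometric) auto
  also have "(\<lambda>n. (1 + real (nat \<bar>n\<bar>)) ^ N * \<rho> ^ (nat \<bar>n\<bar>)) = g"
    by (simp add: g_def fun_eq_iff power_int_def)
  finally have gs: "g summable_on UNIV" .
  define G where "G k = (\<Prod>l=1..m. g (k l))" for k
  have Gs: "G summable_on ({1..m} \<rightarrow>\<^sub>E UNIV)"
    unfolding G_def by (intro summable_on_prod_PiE_int gs g0) auto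
  have G0: "G k \<ge> 0" for k unfolding G_def by (intro prod_nonneg g0)
  define C where "C = \<rho> powi (- int (m * (m + 1) div 2))"
  have "(\<lambda>(k, r). G k * G r) summable_on (({1..m} \<rightarrow>\<^sub>E UNIV) \<times> ({1..m} \<rightarrow>\<^sub>E UNIV))"
    using G0 Gs by (intro summable_on_SigmaI[where g = "\<lambda>k. G k * infsum G ({1..m} \<rightarrow>\<^sub>E UNIV)"])
      (auto intro!: has_sum_cmult_right has_sum_infsum summable_on_cmult_left)
  hence "(\<lambda>(k, r). G k * G r) summable_on same_side m"
  proof (rule summable_on_subset)
    show "same_side m \<subseteq> ({1..m} \<rightarrow>\<^sub>E UNIV) \<times> ({1..m} \<rightarrow>\<^sub>E UNIV)"
      unfolding subset_iff split_paired_All same_side_iff mem_Times_iff by simp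
  qed
  hence "(\<lambda>z. C * (case z of (k, r) \<Rightarrow> G k * G r)) summable_on same_side m"
    by (rule summable_on_cmult_right)
  thus ?thesis
  proof (rule summable_on_comparison_test)
    fix z assume z: "z \<in> same_side m"
    obtain k r where kr: "z = (k, r)" by (cases z)
    have pw: "\<rho> powi (\<Sum>l=1..m. \<bar>u l\<bar>) = (\<Prod>l=1..m. \<rho> powi \<bar>u l\<bar>)" for u :: "nat \<Rightarrow> int"
      by (induction m) (use \<rho> in \<open>auto simp: power_int_add\<close>)
    have Gk: "G u = of_int (\<Prod>l=1..m. 1 + \<bar>u l\<bar>) ^ N * \<rho> powi (\<Sum>l=1..m. \<bar>u l\<bar>)" for u
      unfolding G_def g_def pw by (simp add: prod.distrib prod_power_distrib)
    have "\<rho> powi tri_exponent m k r \<le> \<rho> powi ((\<Sum>l=1..m. \<bar>k l\<bar>) + (\<Sum>l=1..m. \<bar>r l\<bar>) - int (m * (m + 1) div 2))"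
      using \<rho> tri_exponent_ge[of k r m] z kr by (intro power_int_decreasing) auto
    also have "\<dots> = C * (\<rho> powi (\<Sum>l=1..m. \<bar>k l\<bar>) * \<rho> powi (\<Sum>l=1..m. \<bar>r l\<bar>))"
      using \<rho> by (simp add: C_def power_int_add power_int_diff power_int_minus divide_inverse mult_ac)
    finally have le: "\<rho> powi tri_exponent m k r \<le> C * (\<rho> powi (\<Sum>l=1..m. \<bar>k l\<bar>) * \<rho> powi (\<Sum>l=1..m. \<bar>r l\<bar>))" .
    have v0: "vsize m k r \<ge> 0" by (simp add: vsize_def prod_nonneg)
    have "\<rho> powi tri_exponent m k r * of_int (vsize m k r) ^ N \<le>
        C * (\<rho> powi (\<Sum>l=1..m. \<bar>k l\<bar>) * \<rho> powi (\<Sum>l=1..m. \<bar>r l\<bar>)) * of_int (vsize m k r) ^ N"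
      using le v0 by (intro mult_right_mono) auto
    also have "\<dots> = C * (G k * G r)"
      by (simp add: Gk vsize_def power_mult_distrib)
    finally show "(case z of (k, r) \<Rightarrow> \<rho> powi tri_exponent m k r * of_int (vsize m k r) ^ N) \<le>
        C * (case z of (k, r) \<Rightarrow> G k * G r)" by (simp add: kr)
    show "0 \<le> (case z of (k, r) \<Rightarrow> \<rho> powi tri_exponent m k r * of_int (vsize m k r) ^ N)"
      using \<rho> v0 by (simp add: kr)
  qed
qed

lemma summable_tri_coeff:
  fixes \<rho> :: real
  assumes \<rho>: "0 < \<rho>" "\<rho> < 1"
  shows "(\<lambda>(k, r). \<rho> powi tri_exponent m k r * of_int \<bar>tri_coeff m k r\<bar>) summable_on same_side m"
proof -
  obtain N where N: "\<And>k r. \<bar>tri_coeff m k r\<bar> \<le> (2 * vsize m k r) ^ N" using abs_tri_coeff_le by blast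
  have "(\<lambda>z. 2 ^ N * (case z of (k, r) \<Rightarrow> \<rho> powi tri_exponent m k r * of_int (vsize m k r) ^ N)) summable_on same_side m"
    by (intro summable_on_cmult_right summable_vsize \<rho>)
  thus ?thesis
  proof (rule summable_on_comparison_test)
    fix z assume z: "z \<in> same_side m"
    obtain k r where kr: "z = (k, r)" by (cases z)
    have "real_of_int \<bar>tri_coeff m k r\<bar> \<le> of_int ((2 * vsize m k r) ^ N)" using N[of k r] by (simp only: of_int_le_iff)
    also have "\<dots> = 2 ^ N * of_int (vsize m k r) ^ N" by (simp add: power_mult_distrib)
    finally have "\<rho> powi tri_exponent m k r * of_int \<bar>tri_coeff m k r\<bar> \<le> \<rho> powi tri_exponent m k r * (2 ^ N * of_int (vsize m k r) ^ N)"
      using \<rho> by (intro mult_left_mono) auto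
    thus "(case z of (k, r) \<Rightarrow> \<rho> powi tri_exponent m k r * of_int \<bar>tri_coeff m k r\<bar>) \<le>
      2 ^ N * (case z of (k, r) \<Rightarrow> \<rho> powi tri_exponent m k r * of_int (vsize m k r) ^ N)" by (simp add: kr mult_ac)
    show "0 \<le> (case z of (k, r) \<Rightarrow> \<rho> powi tri_exponent m k r * of_int \<bar>tri_coeff m k r\<bar>)"
      using \<rho> by (simp add: kr)
  qed
qed

subsection \<open>Expansion into powers and antisymmetrization\<close>

text \<open>The sign of the geometric expansion of 1/(1-z) at 0 or at infinity; its product over l
  is (-1)^|J|.\<close>

definition side :: "int \<Rightarrow> complex" where
  "side a = (if a \<le> 0 then - 1 else 1)"

lemma norm_side [simp]: "norm (side a) = 1"
  by (simp add: side_def)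

text \<open>For a >= 1 one has |z| < 1 and expands in powers z^(r-1) with r >= 1. For a <= 0 one has
  |z| > 1 and expands in 1/z, which gives minus the sum over r <= 0. The shift r - 1 makes both
  ranges agree with the sign condition on a.\<close>

lemma has_sum_half_line:
  fixes z :: complex
  assumes \<rho>: "0 < \<rho>" "\<rho> < 1" and z: "norm z = \<rho> powi (2 * a - 1)"
  shows "((\<lambda>r. side a * z powi (r - 1)) has_sum 1 / (1 - z)) (half_line a)"
    and "(\<lambda>r. norm (side a * z powi (r - 1))) summable_on half_line a"
proof -
  have z0: "z \<noteq> 0" using z \<rho> by auto
  have "((\<lambda>r. side a * z powi (r - 1)) has_sum 1 / (1 - z)) (half_line a) \<and>
        (\<lambda>r. norm (side a * z powi (r - 1))) summable_on half_line a"
  proof (cases "a \<le> 0")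
    case False
    have "\<rho> powi (2 * a - 1) \<le> \<rho> powi 1" using False \<rho> by (intro power_int_decreasing) auto
    hence z1: "norm z < 1" using z \<rho> by simp
    have bij: "bij_betw (\<lambda>n. int n + 1) UNIV (half_line a)"
      by (rule bij_betw_byWitness[of _ "\<lambda>r. nat (r - 1)"]) (use False in \<open>auto simp: half_line_def\<close>)
    have s: "summable (\<lambda>n. norm (z ^ n))" using z1 by (simp add: norm_power summable_geometric)
    have "((\<lambda>n. z ^ n) has_sum 1 / (1 - z)) UNIV"
      using geometric_sums[OF z1] s by (intro norm_summable_imp_has_sum)
    hence "((\<lambda>n. side a * z powi (int n + 1 - 1)) has_sum 1 / (1 - z)) UNIV" using False by (simp add: side_def)
    moreover have "(\<lambda>n. norm (side a * z powi (int n + 1 - 1))) summable_on UNIV"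
      using s False by (simp add: side_def norm_summable_imp_summable_on summable_nonneg_imp_summable_on)
    ultimately show ?thesis
      using has_sum_reindex_bij_betw[OF bij, of "\<lambda>r. side a * z powi (r - 1)"]
        summable_on_reindex_bij_betw[OF bij, of "\<lambda>r. norm (side a * z powi (r - 1))"] by blast
  next
    case True
    have "\<rho> powi (-1) \<le> \<rho> powi (2 * a - 1)" using True \<rho> by (intro power_int_decreasing) auto
    hence "1 / \<rho> \<le> norm z" using z by (simp add: inverse_eq_divide)
    moreover have "1 < 1 / \<rho>" using \<rho> by simp
    ultimately have z1: "norm z > 1" by linarith
    hence iz: "norm (inverse z) < 1" by (simp add: norm_inverse inverse_less_1_iff)
    have bij: "bij_betw (\<lambda>n. - int n) UNIV (half_line a)"
      by (rule bij_betw_byWitness[of _ "\<lambda>r. nat (- r)"]) (use True in \<open>auto simp: half_line_def\<close>)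
    have eq: "side a * z powi (- int n - 1) = - inverse z * inverse z ^ n" for n
    proof -
      have "- int n - 1 = - int (Suc n)" by simp
      hence "z powi (- int n - 1) = z powi (- int (Suc n))" by (simp only:)
      also have "\<dots> = inverse z ^ Suc n" by (simp only: power_int_minus power_int_of_nat power_inverse)
      finally show ?thesis using True by (simp add: side_def)
    qed
    have s: "summable (\<lambda>n. norm (inverse z ^ n))" using iz by (simp only: norm_power) (rule summable_geometric, simp)
    have "((\<lambda>n. inverse z ^ n) has_sum 1 / (1 - inverse z)) UNIV"
      using geometric_sums[OF iz] s by (intro norm_summable_imp_has_sum)
    hence "((\<lambda>n. - inverse z * inverse z ^ n) has_sum - inverse z * (1 / (1 - inverse z))) UNIV"
      by (rule has_sum_cmult_right)
    also have "- inverse z * (1 / (1 - inverse z)) = 1 / (1 - z)"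
    proof -
      have "1 - z \<noteq> 0" "z - 1 \<noteq> 0" using z1 by auto
      thus ?thesis using z0 by (simp add: divide_simps)
    qed
    finally have "((\<lambda>n. side a * z powi (- int n - 1)) has_sum 1 / (1 - z)) UNIV" unfolding eq .
    moreover have "(\<lambda>n. norm (side a * z powi (- int n - 1))) summable_on UNIV"
      unfolding eq norm_mult using s by (intro summable_on_cmult_right summable_nonneg_imp_summable_on) auto
    ultimately show ?thesis
      using has_sum_reindex_bij_betw[OF bij, of "\<lambda>r. side a * z powi (r - 1)"]
        summable_on_reindex_bij_betw[OF bij, of "\<lambda>r. norm (side a * z powi (r - 1))"] by blast
  qed
  thus "((\<lambda>r. side a * z powi (r - 1)) has_sum 1 / (1 - z)) (half_line a)"
    and "(\<lambda>r. norm (side a * z powi (r - 1))) summable_on half_line a" by auto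
qed

lemma has_sum_prod_PiE:
  fixes f :: "'a \<Rightarrow> 'b :: countable \<Rightarrow> complex"
  assumes "finite S" "\<And>l. l \<in> S \<Longrightarrow> (f l has_sum g l) (B l)" "\<And>l. l \<in> S \<Longrightarrow> (\<lambda>r. norm (f l r)) summable_on B l"
  shows "((\<lambda>r. \<Prod>l\<in>S. f l (r l)) has_sum (\<Prod>l\<in>S. g l)) (PiE S B)"
proof -
  have "infsum (\<lambda>r. \<Prod>l\<in>S. f l (r l)) (PiE S B) = (\<Prod>l\<in>S. infsum (f l) (B l))"
    by (rule infsum_prod_PiE_abs) (use assms in auto)
  also have "\<dots> = (\<Prod>l\<in>S. g l)" by (intro prod.cong refl infsumI assms)
  finally have "infsum (\<lambda>r. \<Prod>l\<in>S. f l (r l)) (PiE S B) = (\<Prod>l\<in>S. g l)" .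
  moreover have "Infinite_Set_Sum.abs_summable_on (\<lambda>r. \<Prod>l\<in>S. f l (r l)) (PiE S B)"
    by (rule Infinite_Set_Sum.abs_summable_on_prod_PiE)
       (use assms in \<open>auto intro!: abs_summable_equivalent[THEN iffD1]\<close>)
  hence "(\<lambda>r. \<Prod>l\<in>S. f l (r l)) summable_on PiE S B"
    by (rule Infinite_Sum.abs_summable_summable[OF abs_summable_equivalent[THEN iffD2]])
  ultimately show ?thesis using has_sum_infsum by force
qed

text \<open>One term after the geometric expansion, without the theta denominators. The additional
  exponent m(m+1) is absorbed at the very end by the limit of the theta product, see
  \<open>theta_inverse_power\<close>.\<close>

definition wterm :: "complex \<Rightarrow> nat \<Rightarrow> (nat \<Rightarrow> complex) \<Rightarrow> (nat \<Rightarrow> complex) \<Rightarrow> (nat \<Rightarrow> int) \<Rightarrow> (nat \<Rightarrow> int) \<Rightarrow> complex" where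
  "wterm q m x y k r = (\<Prod>l=1..m. side (k l)) * q powi (tri_exponent m k r + int (m * (m + 1))) *
     ((\<Prod>l=1..m. x l powi (k l + r l)) * x 0 powi (- vec_total m k)) * (\<Prod>l=1..m. y l powi (r l - 1))"

text \<open>This explains the choice c = 0: the linear term 2|k| of \<open>gexp\<close> then cancels
  the -2|k| coming from the exponents r l - 1.\<close>

lemma wterm_eq:
  assumes q0: "q \<noteq> 0" and x0: "\<And>l. l \<le> m \<Longrightarrow> x l \<noteq> 0"
  shows "q powi gexp m 0 k * (\<Prod>l=1..m. x l powi (1 + k l)) * x 0 powi (- vec_total m k) *
      (\<Prod>l=1..m. side (k l) * (q powi (2 * k l - 1) * x l * y l) powi (r l - 1)) = wterm q m x y k r"
proof -
  have 1: "(\<Prod>l=1..m. side (k l) * (q powi (2 * k l - 1) * x l * y l) powi (r l - 1)) =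
      (\<Prod>l=1..m. side (k l)) * (\<Prod>l=1..m. q powi ((2 * k l - 1) * (r l - 1))) * (\<Prod>l=1..m. x l powi (r l - 1)) * (\<Prod>l=1..m. y l powi (r l - 1))"
    unfolding prod.distrib[symmetric]
    by (intro prod.cong refl) (simp add: power_int_mult_distrib power_int_mult)
  have 2: "(\<Prod>l\<in>S. q powi e l) = q powi (\<Sum>l\<in>S. e l)" if "finite S" for S :: "nat set" and e
    using that by induction (use q0 in \<open>auto simp: power_int_add\<close>)
  have 3: "(\<Prod>l=1..m. x l powi (1 + k l)) * (\<Prod>l=1..m. x l powi (r l - 1)) = (\<Prod>l=1..m. x l powi (k l + r l))"
    unfolding prod.distrib[symmetric]
    by (intro prod.cong refl, subst power_int_add[symmetric]) (use x0 in auto)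
  have "gexp m 0 k + (\<Sum>l=1..m. (2 * k l - 1) * (r l - 1)) = tri_exponent m k r + int (m * (m + 1))"
  proof -
    have "(\<Sum>l=1..m. (2 * k l - 1) * (r l - 1)) = (\<Sum>l=1..m. (2 * k l - 1) * r l - 2 * k l + 1)"
      by (intro sum.cong refl) (simp add: algebra_simps)
    also have "\<dots> = (\<Sum>l=1..m. (2 * k l - 1) * r l) - 2 * vec_total m k + int m"
      by (simp add: sum.distrib sum_subtractf vec_total_def sum_distrib_left)
    finally have a: "(\<Sum>l=1..m. (2 * k l - 1) * (r l - 1)) = (\<Sum>l=1..m. (2 * k l - 1) * r l) - 2 * vec_total m k + int m" .
    have "even (m * (m + 1))" by simp
    moreover have "m * (m - 1) div 2 + m = m * (m + 1) div 2" by (cases m) (auto simp: algebra_simps)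
    ultimately have "int (m * (m - 1) div 2) + int m = int (m * (m + 1)) - int (m * (m + 1) div 2)"
      by (metis add_diff_cancel_left' dvd_div_mult_self mult_2_right of_nat_add)
    thus ?thesis unfolding a gexp_def tri_exponent_quad by simp
  qed
  hence 4: "q powi gexp m 0 k * (\<Prod>l=1..m. q powi ((2 * k l - 1) * (r l - 1))) = q powi (tri_exponent m k r + int (m * (m + 1)))"
    using q0 by (simp add: 2 flip: power_int_add)
  show ?thesis unfolding 1 wterm_def 3[symmetric] 4[symmetric] by (simp only: mult_ac)
qed

lemma norm_wterm:
  assumes "\<And>l. l \<le> m \<Longrightarrow> norm (x l) = 1" "\<And>l. l \<in> {1..m} \<Longrightarrow> norm (y l) = 1"
  shows "norm (wterm q m x y k r) = norm q powi (tri_exponent m k r + int (m * (m + 1)))"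
proof -
  have "(\<Prod>l=1..m. norm (x l powi (k l + r l))) = 1" "(\<Prod>l=1..m. norm (y l powi (r l - 1))) = 1"
    by (intro prod.neutral ballI; use assms in \<open>auto simp: norm_power_int\<close>)+
  thus ?thesis unfolding wterm_def norm_mult prod_norm[symmetric] norm_power_int norm_side using assms(1)[of 0] by simp
qed

lemma alt_prod_tdiff_nonzero:
  assumes "q \<noteq> 0" "norm q < 1" "\<And>i. i \<in> S \<Longrightarrow> norm (x i) = 1" "inj_on x S" "finite S"
  shows "alt_prod (tdiff (q\<^sup>2)) S x \<noteq> 0"
  unfolding alt_prod_def
proof (subst prod_zero_iff[OF assms(5)], intro notI, elim bexE)
  fix j assume j: "j \<in> S" and "(\<Prod>i\<in>{i \<in> S. i < j}. tdiff (q\<^sup>2) (x i) (x j)) = 0"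
  then obtain i where i: "i \<in> S" "i < j" "tdiff (q\<^sup>2) (x i) (x j) = 0" using assms(5) by (auto simp: prod_zero_iff)
  have "x j \<noteq> 0" using assms(3)[OF j] by auto
  moreover have "theta (q\<^sup>2) (x i / x j) \<noteq> 0"
  proof (rule theta_nonzero_of_norm_1[OF assms(1,2)])
    show "norm (x i / x j) = 1" using assms(3) i j by (simp add: norm_divide)
    show "x i / x j \<noteq> 1" using \<open>x j \<noteq> 0\<close> inj_onD[OF assms(4), of i j] i j by auto
  qed
  ultimately show False using i by (simp add: tdiff_def)
qed

text \<open>For fixed k, the sum over r is a product of geometric series and gives
  \<open>gterm\<close> times its theta denominator. Joint summability comes from
  \<open>summable_vsize\<close> with exponent 0, since all variables have modulus 1.\<close>

lemma has_sum_wterm: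
  assumes q0: "q \<noteq> 0" and q1: "norm q < 1"
    and x: "\<And>l. l \<le> m \<Longrightarrow> norm (x l) = 1" and inj: "inj_on x {..m}" and y: "\<And>l. l \<in> {1..m} \<Longrightarrow> norm (y l) = 1"
    and G: "(gterm q m 0 x y has_sum G) ({1..m} \<rightarrow>\<^sub>E UNIV)"
  shows "((\<lambda>(k, r). wterm q m x y k r) has_sum qpoch (q\<^sup>2) (q\<^sup>2) ^ (2 * m) * alt_prod (tdiff (q\<^sup>2)) {..m} x * G) (same_side m)"
proof -
  define D where "D = qpoch (q\<^sup>2) (q\<^sup>2) ^ (2 * m) * alt_prod (tdiff (q\<^sup>2)) {..m} x"
  have "norm (q\<^sup>2) < 1" using q1 by (simp add: norm_power power_less_one_iff)
  hence D0: "D \<noteq> 0" unfolding D_def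
    using alt_prod_tdiff_nonzero[OF q0 q1, of "{..m}" x] x inj by (auto simp: qpoch_nonzero)
  have x0: "x l \<noteq> 0" if "l \<le> m" for l using x[OF that] by auto
  have inner: "((\<lambda>r. (\<lambda>(k, r). wterm q m x y k r) (k, r)) has_sum D * gterm q m 0 x y k) (\<Pi>\<^sub>E l\<in>{1..m}. half_line (k l))" for k :: "nat \<Rightarrow> int"
  proof -
    have "((\<lambda>r. \<Prod>l=1..m. side (k l) * (q powi (2 * k l - 1) * x l * y l) powi (r l - 1)) has_sum
        (\<Prod>l=1..m. 1 / (1 - q powi (2 * k l - 1) * x l * y l))) (\<Pi>\<^sub>E l\<in>{1..m}. half_line (k l))"
    proof (rule has_sum_prod_PiE)
      fix l assume l: "l \<in> {1..m}"
      have n: "norm (q powi (2 * k l - 1) * x l * y l) = norm q powi (2 * k l - 1)"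
        using x[of l] y[OF l] l by (simp add: norm_mult norm_power_int)
      show "((\<lambda>r. side (k l) * (q powi (2 * k l - 1) * x l * y l) powi (r - 1)) has_sum
          1 / (1 - q powi (2 * k l - 1) * x l * y l)) (half_line (k l))"
        and "(\<lambda>r. norm (side (k l) * (q powi (2 * k l - 1) * x l * y l) powi (r - 1))) summable_on half_line (k l)"
        using has_sum_half_line[OF _ _ n] q0 q1 by auto
    qed auto
    hence "((\<lambda>r. q powi gexp m 0 k * (\<Prod>l=1..m. x l powi (1 + k l)) * x 0 powi (- vec_total m k) *
        (\<Prod>l=1..m. side (k l) * (q powi (2 * k l - 1) * x l * y l) powi (r l - 1))) has_sum
        q powi gexp m 0 k * (\<Prod>l=1..m. x l powi (1 + k l)) * x 0 powi (- vec_total m k) *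
        (\<Prod>l=1..m. 1 / (1 - q powi (2 * k l - 1) * x l * y l))) (\<Pi>\<^sub>E l\<in>{1..m}. half_line (k l))"
      by (rule has_sum_cmult_right)
    also have "q powi gexp m 0 k * (\<Prod>l=1..m. x l powi (1 + k l)) * x 0 powi (- vec_total m k) *
        (\<Prod>l=1..m. 1 / (1 - q powi (2 * k l - 1) * x l * y l)) = D * gterm q m 0 x y k"
      using D0 unfolding gterm_def D_def[symmetric] by simp
    also have "(\<lambda>r. q powi gexp m 0 k * (\<Prod>l=1..m. x l powi (1 + k l)) * x 0 powi (- vec_total m k) *
        (\<Prod>l=1..m. side (k l) * (q powi (2 * k l - 1) * x l * y l) powi (r l - 1))) = wterm q m x y k"
      by (rule ext, rule wterm_eq[OF q0]) (rule x0)
    finally show ?thesis by simp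
  qed
  have outer: "((\<lambda>k. D * gterm q m 0 x y k) has_sum D * G) ({1..m} \<rightarrow>\<^sub>E UNIV)"
    using G by (rule has_sum_cmult_right)
  have "(\<lambda>(k, r). wterm q m x y k r) summable_on same_side m"
  proof (rule Infinite_Sum.abs_summable_summable)
    have "(\<lambda>z. norm q powi int (m * (m + 1)) * (case z of (k, r) \<Rightarrow> norm q powi tri_exponent m k r * of_int (vsize m k r) ^ 0)) summable_on same_side m"
      using q0 q1 by (intro summable_on_cmult_right summable_vsize) auto
    also have "(\<lambda>z. norm q powi int (m * (m + 1)) * (case z of (k, r) \<Rightarrow> norm q powi tri_exponent m k r * of_int (vsize m k r) ^ 0)) =
      (\<lambda>z. norm (case z of (k, r) \<Rightarrow> wterm q m x y k r))"
    proof
      fix z :: "(nat \<Rightarrow> int) \<times> (nat \<Rightarrow> int)"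
      obtain k r where z: "z = (k, r)" by (cases z)
      have "norm (wterm q m x y k r) = norm q powi (tri_exponent m k r + int (m * (m + 1)))" by (rule norm_wterm[OF x y])
      also have "\<dots> = norm q powi tri_exponent m k r * norm q powi int (m * (m + 1))" using q0 by (intro power_int_add) auto
      finally show "norm q powi int (m * (m + 1)) * (case z of (k, r) \<Rightarrow> norm q powi tri_exponent m k r * of_int (vsize m k r) ^ 0) =
        norm (case z of (k, r) \<Rightarrow> wterm q m x y k r)" unfolding z prod.case by simp
    qed
    finally show "(\<lambda>z. norm (case z of (k, r) \<Rightarrow> wterm q m x y k r)) summable_on same_side m" .
  qed
  hence "((\<lambda>(k, r). wterm q m x y k r) has_sum D * G) (same_side m)"
    unfolding same_side_def by (rule has_sum_SigmaI[OF inner outer])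
  thus ?thesis unfolding D_def .
qed

lemma has_sum_finite_sum:
  fixes f :: "'a \<Rightarrow> 'b \<Rightarrow> complex"
  assumes "finite S" "\<And>i. i \<in> S \<Longrightarrow> (f i has_sum g i) A"
  shows "((\<lambda>z. \<Sum>i\<in>S. f i z) has_sum (\<Sum>i\<in>S. g i)) A"
  using assms by (induction S rule: finite_induct) (auto intro!: has_sum_add)

lemma power_powi_commute: "(t ^ n) powi e = (t powi e :: complex) ^ n"
  by (metis mult.commute power_int_mult power_int_of_nat)

text \<open>The exponent of x l in \<open>wterm\<close>, with l = 0 included. Its differences are
  the factors of \<open>tri_coeff\<close>: subtracting the weight at 0 gives k l + r l +
  |k|.\<close>

definition weight :: "nat \<Rightarrow> (nat \<Rightarrow> int) \<Rightarrow> (nat \<Rightarrow> int) \<Rightarrow> nat \<Rightarrow> int" where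
  "weight m k r l = (if l = 0 then - vec_total m k else k l + r l)"

text \<open>The theta product in the denominator of \<open>gterm\<close> is alternating in x, so
  clearing it from \<open>theta_expansion\<close> puts the sign of \<sigma> in front of each term.
  At x i = t^i the sum over \<sigma> is a Vandermonde determinant.\<close>

lemma has_sum_antisym_x:
  assumes q0: "q \<noteq> 0" and q1: "norm q < 1" and t: "norm t = 1" and inj: "inj_on (\<lambda>i. t ^ i) {..m}"
    and y: "\<And>l. l \<in> {1..m} \<Longrightarrow> norm (y l) = 1"
  shows "((\<lambda>(k, r). (\<Prod>l=1..m. side (k l)) * q powi (tri_exponent m k r + int (m * (m + 1))) *
            alt_prod (\<lambda>a b. b - a) {..m} (\<lambda>l. t powi weight m k r l) * (\<Prod>l=1..m. y l powi (r l - 1)))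
          has_sum qpoch (q\<^sup>2) (q\<^sup>2) ^ (2 * m) * alt_prod (tdiff (q\<^sup>2)) {..m} (\<lambda>i. t ^ i) *
            (alt_prod (tdiff (q\<^sup>2)) {1..m} y / (\<Prod>i\<le>m. \<Prod>j=1..m. theta (q\<^sup>2) (t ^ i * y j / q)))) (same_side m)"
proof -
  define x where "x = (\<lambda>i. t ^ i)"
  define p where "p = q\<^sup>2"
  have p: "norm p < 1" using q1 by (simp add: p_def norm_power power_less_one_iff)
  have x: "norm (x i) = 1" for i using t by (simp add: x_def norm_power)
  have x0: "x i \<noteq> 0" for i using x[of i] by auto
  define Perm where "Perm = {\<sigma> :: nat \<Rightarrow> nat. \<sigma> permutes {..m}}"
  have fin: "finite Perm" unfolding Perm_def by (intro finite_permutations) auto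
  define F where "F = alt_prod (tdiff p) {1..m} y / (\<Prod>i\<le>m. \<Prod>j=1..m. theta p (x i * y j / q))"
  have H: "((\<lambda>(\<sigma>, k). gterm q m 0 (x \<circ> \<sigma>) y k) has_sum F) (Perm \<times> ({1..m} \<rightarrow>\<^sub>E UNIV))"
    using theta_expansion[OF q0 q1 x inj[folded x_def] y, where c = 0] by (simp add: F_def p_def Perm_def)
  define G where "G \<sigma> = infsum (gterm q m 0 (x \<circ> \<sigma>) y) ({1..m} \<rightarrow>\<^sub>E UNIV)" for \<sigma>
  have G: "(gterm q m 0 (x \<circ> \<sigma>) y has_sum G \<sigma>) ({1..m} \<rightarrow>\<^sub>E UNIV)" if "\<sigma> \<in> Perm" for \<sigma>
    unfolding G_def using summable_on_SigmaD1[OF has_sum_imp_summable[OF H] that] by (rule has_sum_infsum)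
  have "(G has_sum F) Perm" by (rule has_sum_SigmaD[OF H]) (use G in simp)
  hence FG: "F = (\<Sum>\<sigma>\<in>Perm. G \<sigma>)" using fin by (simp add: has_sum_finite_iff)
  define D where "D = qpoch p p ^ (2 * m) * alt_prod (tdiff p) {..m} x"
  have "((\<lambda>z. \<Sum>\<sigma>\<in>Perm. of_int (sign \<sigma>) * (case z of (k, r) \<Rightarrow> wterm q m (x \<circ> \<sigma>) y k r)) has_sum (\<Sum>\<sigma>\<in>Perm. D * G \<sigma>)) (same_side m)"
  proof (rule has_sum_finite_sum[OF fin])
    fix \<sigma> assume \<sigma>: "\<sigma> \<in> Perm"
    hence \<sigma>': "\<sigma> permutes {..m}" by (simp add: Perm_def)
    have "inj_on (x \<circ> \<sigma>) {..m}"
      using permutes_inj_on[OF \<sigma>'] permutes_image[OF \<sigma>'] inj by (intro comp_inj_on) (auto simp: x_def)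
    from has_sum_cmult_right[OF has_sum_wterm[OF q0 q1 _ this y G[OF \<sigma>]], of "of_int (sign \<sigma>)"] x
    have "((\<lambda>z. of_int (sign \<sigma>) * (case z of (k, r) \<Rightarrow> wterm q m (x \<circ> \<sigma>) y k r)) has_sum
        of_int (sign \<sigma>) * (qpoch p p ^ (2 * m) * alt_prod (tdiff p) {..m} (x \<circ> \<sigma>) * G \<sigma>)) (same_side m)"
      by (simp add: p_def)
    also have "alt_prod (tdiff p) {..m} (x \<circ> \<sigma>) = of_int (sign \<sigma>) * alt_prod (tdiff p) {..m} x"
      by (rule alt_prod_permute[OF _ \<sigma>']) (auto intro!: tdiff_antisym p x0)
    \<comment> \<open>One sign was inserted by hand and the other comes from the alternating
      product, so they cancel.\<close>
    also have "of_int (sign \<sigma>) * (qpoch p p ^ (2 * m) * (of_int (sign \<sigma>) * alt_prod (tdiff p) {..m} x) * G \<sigma>) =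
        of_int (sign \<sigma> * sign \<sigma>) * (D * G \<sigma>)"
      by (simp only: D_def of_int_mult mult_ac)
    finally show "((\<lambda>z. of_int (sign \<sigma>) * (case z of (k, r) \<Rightarrow> wterm q m (x \<circ> \<sigma>) y k r)) has_sum D * G \<sigma>) (same_side m)"
      by (simp add: o_def)
  qed
  also have "(\<Sum>\<sigma>\<in>Perm. D * G \<sigma>) = D * F" by (simp add: FG sum_distrib_left)
  also have "(\<lambda>z. \<Sum>\<sigma>\<in>Perm. of_int (sign \<sigma>) * (case z of (k, r) \<Rightarrow> wterm q m (x \<circ> \<sigma>) y k r)) =
     (\<lambda>(k, r). (\<Prod>l=1..m. side (k l)) * q powi (tri_exponent m k r + int (m * (m + 1))) *
            alt_prod (\<lambda>a b. b - a) {..m} (\<lambda>l. t powi weight m k r l) * (\<Prod>l=1..m. y l powi (r l - 1)))"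
  proof (rule ext, clarify)
    fix k r
    \<comment> \<open>Base and exponent trade places: (t^(\<sigma> l))^w = (t^w)^(\<sigma> l), so
      the powers of t with the weights as exponents become the nodes.\<close>
    have mono: "(\<Prod>l=1..m. (x \<circ> \<sigma>) l powi (k l + r l)) * (x \<circ> \<sigma>) 0 powi (- vec_total m k) = (\<Prod>l\<le>m. (t powi weight m k r l) ^ \<sigma> l)" for \<sigma>
    proof -
      have "(\<Prod>l\<le>m. (t powi weight m k r l) ^ \<sigma> l) = (\<Prod>l\<le>m. (x \<circ> \<sigma>) l powi weight m k r l)"
        by (simp add: x_def power_powi_commute)
      also have "\<dots> = (x \<circ> \<sigma>) 0 powi weight m k r 0 * (\<Prod>l=1..m. (x \<circ> \<sigma>) l powi weight m k r l)"
        by (simp add: atLeast0AtMost[symmetric] prod.atLeast_Suc_atMost)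
      also have "(\<Prod>l=1..m. (x \<circ> \<sigma>) l powi weight m k r l) = (\<Prod>l=1..m. (x \<circ> \<sigma>) l powi (k l + r l))"
        by (intro prod.cong) (auto simp: weight_def)
      finally show ?thesis by (simp add: weight_def)
    qed
    have "(\<Sum>\<sigma>\<in>Perm. of_int (sign \<sigma>) * wterm q m (x \<circ> \<sigma>) y k r) =
      (\<Prod>l=1..m. side (k l)) * q powi (tri_exponent m k r + int (m * (m + 1))) * vdm m (\<lambda>l. t powi weight m k r l) * (\<Prod>l=1..m. y l powi (r l - 1))"
      unfolding wterm_def mono vdm_def Perm_def[symmetric] sum_distrib_left sum_distrib_right
      by (intro sum.cong refl) (simp only: mult_ac)
    thus "(\<Sum>\<sigma>\<in>Perm. of_int (sign \<sigma>) * wterm q m (x \<circ> \<sigma>) y k r) =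
      (\<Prod>l=1..m. side (k l)) * q powi (tri_exponent m k r + int (m * (m + 1))) * alt_prod (\<lambda>a b. b - a) {..m} (\<lambda>l. t powi weight m k r l) * (\<Prod>l=1..m. y l powi (r l - 1))"
      unfolding vandermonde_eq .
  qed
  finally show ?thesis unfolding D_def F_def p_def x_def .
qed

text \<open>\<open>theta_expansion\<close> has no sum over permutations of y, so the identity is
  applied to every permuted y and summed with signs. Its right side is alternating in y and produces
  m! equal copies.\<close>

theorem has_sum_antisym:
  assumes q0: "q \<noteq> 0" and q1: "norm q < 1" and t: "norm t = 1" and inj: "inj_on (\<lambda>i. t ^ i) {..m}"
  shows "((\<lambda>(k, r). (\<Prod>l=1..m. side (k l)) * q powi (tri_exponent m k r + int (m * (m + 1))) *
            alt_prod (\<lambda>a b. b - a) {..m} (\<lambda>l. t powi weight m k r l) *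
            ((\<Prod>l=1..m. t powi (r l - 1)) * alt_prod (\<lambda>a b. b - a) {1..m} (\<lambda>l. t powi (r l - 1))))
          has_sum fact m * (qpoch (q\<^sup>2) (q\<^sup>2) ^ (2 * m) * alt_prod (tdiff (q\<^sup>2)) {..m} (\<lambda>i. t ^ i) *
            (alt_prod (tdiff (q\<^sup>2)) {1..m} (\<lambda>i. t ^ i) / (\<Prod>i\<le>m. \<Prod>j=1..m. theta (q\<^sup>2) (t ^ i * t ^ j / q))))) (same_side m)"
proof -
  define y where "y = (\<lambda>i. t ^ i)"
  define p where "p = q\<^sup>2"
  have p: "norm p < 1" using q1 by (simp add: p_def norm_power power_less_one_iff)
  have y: "norm (y i) = 1" for i using t by (simp add: y_def norm_power)
  have y0: "y i \<noteq> 0" for i using y[of i] by auto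
  define Perm where "Perm = {\<tau> :: nat \<Rightarrow> nat. \<tau> permutes {1..m}}"
  have fin: "finite Perm" unfolding Perm_def by (intro finite_permutations) auto
  define W where "W k r = (\<Prod>l=1..m. side (k l)) * q powi (tri_exponent m k r + int (m * (m + 1))) *
            alt_prod (\<lambda>a b. b - a) {..m} (\<lambda>l. t powi weight m k r l)" for k r
  define D where "D = qpoch p p ^ (2 * m) * alt_prod (tdiff p) {..m} y *
      (alt_prod (tdiff p) {1..m} y / (\<Prod>i\<le>m. \<Prod>j=1..m. theta p (y i * y j / q)))"
  have "((\<lambda>z. \<Sum>\<tau>\<in>Perm. of_int (sign \<tau>) * (case z of (k, r) \<Rightarrow> W k r * (\<Prod>l=1..m. (y \<circ> \<tau>) l powi (r l - 1)))) has_sum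
      (\<Sum>\<tau>\<in>Perm. D)) (same_side m)"
  proof (rule has_sum_finite_sum[OF fin])
    fix \<tau> assume \<tau>: "\<tau> \<in> Perm"
    hence \<tau>': "\<tau> permutes {1..m}" by (simp add: Perm_def)
    have a: "alt_prod (tdiff p) {1..m} (y \<circ> \<tau>) = of_int (sign \<tau>) * alt_prod (tdiff p) {1..m} y"
      by (rule alt_prod_permute[OF _ \<tau>']) (auto intro!: tdiff_antisym p y0)
    have b: "(\<Prod>j=1..m. theta p (y i * (y \<circ> \<tau>) j / q)) = (\<Prod>j=1..m. theta p (y i * y j / q))" for i
      using prod.permute[OF \<tau>', of "\<lambda>j. theta p (y i * y j / q)"] by (simp add: o_def)
    have "((\<lambda>z. case z of (k, r) \<Rightarrow> W k r * (\<Prod>l=1..m. (y \<circ> \<tau>) l powi (r l - 1))) has_sum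
      qpoch p p ^ (2 * m) * alt_prod (tdiff p) {..m} y *
      (alt_prod (tdiff p) {1..m} (y \<circ> \<tau>) / (\<Prod>i\<le>m. \<Prod>j=1..m. theta p (y i * (y \<circ> \<tau>) j / q)))) (same_side m)"
      unfolding W_def p_def y_def by (rule has_sum_antisym_x[OF q0 q1 t inj]) (simp add: norm_power t)
    from has_sum_cmult_right[OF this, of "of_int (sign \<tau>)"]
    have "((\<lambda>z. of_int (sign \<tau>) * (case z of (k, r) \<Rightarrow> W k r * (\<Prod>l=1..m. (y \<circ> \<tau>) l powi (r l - 1)))) has_sum
      of_int (sign \<tau>) * (qpoch p p ^ (2 * m) * alt_prod (tdiff p) {..m} y *
      (of_int (sign \<tau>) * alt_prod (tdiff p) {1..m} y / (\<Prod>i\<le>m. \<Prod>j=1..m. theta p (y i * y j / q))))) (same_side m)"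
      unfolding a b .
    also have "of_int (sign \<tau>) * (qpoch p p ^ (2 * m) * alt_prod (tdiff p) {..m} y *
      (of_int (sign \<tau>) * alt_prod (tdiff p) {1..m} y / (\<Prod>i\<le>m. \<Prod>j=1..m. theta p (y i * y j / q)))) = of_int (sign \<tau> * sign \<tau>) * D"
      by (simp only: D_def of_int_mult mult_ac times_divide_eq_left times_divide_eq_right)
    finally show "((\<lambda>z. of_int (sign \<tau>) * (case z of (k, r) \<Rightarrow> W k r * (\<Prod>l=1..m. (y \<circ> \<tau>) l powi (r l - 1)))) has_sum D) (same_side m)"
      by simp
  qed
  also have "(\<Sum>\<tau>\<in>Perm. D) = fact m * D"
    using card_permutations[of "{1..m}" m] by (simp add: Perm_def)
  also have "(\<lambda>z. \<Sum>\<tau>\<in>Perm. of_int (sign \<tau>) * (case z of (k, r) \<Rightarrow> W k r * (\<Prod>l=1..m. (y \<circ> \<tau>) l powi (r l - 1)))) =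
    (\<lambda>(k, r). W k r * ((\<Prod>l=1..m. t powi (r l - 1)) * alt_prod (\<lambda>a b. b - a) {1..m} (\<lambda>l. t powi (r l - 1))))"
  proof (rule ext, clarify)
    fix k r :: "nat \<Rightarrow> int"
    have "(\<Sum>\<tau>\<in>Perm. of_int (sign \<tau>) * (W k r * (\<Prod>l=1..m. (y \<circ> \<tau>) l powi (r l - 1)))) =
      W k r * (\<Sum>\<tau>\<in>Perm. of_int (sign \<tau>) * (\<Prod>l=1..m. (t powi (r l - 1)) ^ \<tau> l))"
      unfolding sum_distrib_left by (intro sum.cong refl) (simp add: y_def power_powi_commute mult_ac)
    also have "(\<Sum>\<tau>\<in>Perm. of_int (sign \<tau>) * (\<Prod>l=1..m. (t powi (r l - 1)) ^ \<tau> l)) =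
      (\<Prod>l=1..m. t powi (r l - 1)) * alt_prod (\<lambda>a b. b - a) {1..m} (\<lambda>l. t powi (r l - 1))"
      unfolding Perm_def by (rule vandermonde_from_1)
    finally show "(\<Sum>\<tau>\<in>Perm. of_int (sign \<tau>) * (W k r * (\<Prod>l=1..m. (y \<circ> \<tau>) l powi (r l - 1)))) =
      W k r * ((\<Prod>l=1..m. t powi (r l - 1)) * alt_prod (\<lambda>a b. b - a) {1..m} (\<lambda>l. t powi (r l - 1)))" .
  qed
  finally show ?thesis unfolding D_def W_def p_def y_def .
qed

subsection \<open>The limit in which all variables coincide\<close>

text \<open>Dominated convergence for unordered sums along an arbitrary filter: by the M-test the
  finite partial sums converge uniformly on S, so the two limits may be interchanged.\<close>

lemma tendsto_infsum_dominated:
  fixes f :: "'b \<Rightarrow> 'a \<Rightarrow> complex"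
  assumes le: "\<And>w s. w \<in> A \<Longrightarrow> s \<in> S \<Longrightarrow> norm (f s w) \<le> g w" and g: "g summable_on A"
    and lim: "\<And>w. w \<in> A \<Longrightarrow> ((\<lambda>s. f s w) \<longlongrightarrow> h w) G"
    and ev: "\<forall>\<^sub>F s in G. s \<in> S" and G: "G \<noteq> bot"
  shows "((\<lambda>s. infsum (f s) A) \<longlongrightarrow> infsum h A) G"
proof (rule swap_uniform_limit'[where F = "finite_subsets_at_top A" and S = S])
  show "uniform_limit S (\<lambda>X s. \<Sum>w\<in>X. f s w) (\<lambda>s. infsum (f s) A) (finite_subsets_at_top A)"
    by (rule Weierstrass_m_test_general[where f = "\<lambda>w s. f s w" and M = g]) (use le g in auto)
  show "\<forall>\<^sub>F X in finite_subsets_at_top A. ((\<lambda>s. \<Sum>w\<in>X. f s w) \<longlongrightarrow> (\<Sum>w\<in>X. h w)) G"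
    by (rule eventually_finite_subsets_at_top_weakI) (use lim in \<open>auto intro!: tendsto_sum\<close>)
  have "norm (h w) \<le> g w" if w: "w \<in> A" for w
  proof (rule tendsto_upperbound[OF tendsto_norm[OF lim[OF w]] _ G])
    show "\<forall>\<^sub>F s in G. norm (f s w) \<le> g w" using ev by eventually_elim (use le w in auto)
  qed
  hence "h summable_on A"
    by (intro Infinite_Sum.abs_summable_summable[OF Infinite_Sum.abs_summable_on_comparison_test'[OF g]])
  thus "((\<lambda>X. \<Sum>w\<in>X. h w) \<longlongrightarrow> infsum h A) (finite_subsets_at_top A)"
    using has_sum_infsum unfolding has_sum_def by blast
qed (use ev in auto)

lemma norm_powi_diff_le:
  fixes t :: complex
  assumes t: "norm t = 1"
  shows "norm (t powi b - t powi a) \<le> of_int \<bar>b - a\<bar> * norm (t - 1)"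
proof -
  have pow: "norm (t ^ n - 1) \<le> real n * norm (t - 1)" for n
  proof (induction n)
    case (Suc n)
    have e: "t ^ Suc n - 1 = t * (t ^ n - 1) + (t - 1)" by (simp add: algebra_simps)
    have "norm (t ^ Suc n - 1) \<le> norm (t * (t ^ n - 1)) + norm (t - 1)"
      unfolding e by (rule norm_triangle_ineq)
    also have "norm (t * (t ^ n - 1)) = norm (t ^ n - 1)" using t by (simp add: norm_mult)
    finally show ?case using Suc by (simp add: algebra_simps)
  qed simp
  have t0: "t \<noteq> 0" using t by auto
  have le: "norm (t powi b - t powi a) \<le> of_int \<bar>b - a\<bar> * norm (t - 1)" if "a \<le> b" for a b
  proof -
    have "t powi b = t powi a * t powi int (nat (b - a))" using that t0 by (simp flip: power_int_add)
    hence "t powi b - t powi a = t powi a * (t ^ nat (b - a) - 1)" unfolding power_int_of_nat by (simp add: algebra_simps)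
    hence "norm (t powi b - t powi a) = norm (t ^ nat (b - a) - 1)" using t by (simp add: norm_mult norm_power_int)
    thus ?thesis using pow[of "nat (b - a)"] that by simp
  qed
  show ?thesis
  proof (cases "a \<le> b")
    case False
    thus ?thesis using le[of b a] by (simp add: norm_minus_commute abs_minus_commute)
  qed (rule le)
qed

section \<open>Difference quotients at t = 1 along the unit circle\<close>

lemma filterlim_cis: "filterlim cis (at 1) (at_right 0)"
proof (rule filterlim_atI)
  have "(cis \<longlongrightarrow> cis 0) (at_right 0)" by (intro tendsto_cis tendsto_ident_at)
  thus "(cis \<longlongrightarrow> 1) (at_right 0)" by simp
  have "\<forall>\<^sub>F \<phi> in at_right 0. \<phi> \<in> {0<..<1::real}" by (rule eventually_at_right_real) simp
  thus "\<forall>\<^sub>F \<phi> in at_right 0. cis \<phi> \<noteq> 1"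
  proof eventually_elim
    case (elim \<phi>)
    have "sin \<phi> > 0" using elim pi_gt3 by (intro sin_gt_zero) auto
    thus ?case by (auto simp: complex_eq_iff)
  qed
qed

lemma tendsto_powi_diff_quotient:
  "((\<lambda>\<phi>. (cis \<phi> powi b - cis \<phi> powi a) / (cis \<phi> - 1)) \<longlongrightarrow> of_int b - of_int a) (at_right 0)"
proof -
  have d: "((\<lambda>t. (t powi n - 1) / (t - 1)) \<longlongrightarrow> of_int n) (at (1::complex))" for n
  proof -
    have "((\<lambda>t. t powi n) has_field_derivative of_int n) (at (1::complex))"
      by (auto intro!: derivative_eq_intros)
    thus ?thesis by (simp add: has_field_derivative_iff)
  qed
  have "((\<lambda>t. (t powi b - 1) / (t - 1) - (t powi a - 1) / (t - 1)) \<longlongrightarrow> of_int b - of_int a) (at (1::complex))"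
    by (intro tendsto_diff d)
  hence "((\<lambda>t. (t powi b - t powi a) / (t - 1)) \<longlongrightarrow> of_int b - of_int a) (at (1::complex))"
    by (simp add: diff_divide_distrib)
  thus ?thesis using filterlim_cis by (rule filterlim_compose)
qed

lemma tendsto_tdiff_quotient:
  assumes p: "norm p < 1"
  shows "((\<lambda>\<phi>. tdiff p (cis \<phi> ^ i) (cis \<phi> ^ j) / (cis \<phi> - 1)) \<longlongrightarrow> (of_nat j - of_nat i) * (qpoch p p)\<^sup>2) (at_right 0)"
proof -
  have c1: "(cis \<longlongrightarrow> 1) (at_right 0)" using filterlim_cis by (simp add: filterlim_at)
  have "((\<lambda>\<phi>. (cis \<phi> powi int j - cis \<phi> powi int i) / (cis \<phi> - 1) *
      (qpoch p (p * (cis \<phi> ^ i / cis \<phi> ^ j)) * qpoch p (p / (cis \<phi> ^ i / cis \<phi> ^ j)))) \<longlongrightarrow>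
      (of_int (int j) - of_int (int i)) * (qpoch p (p * (1 ^ i / 1 ^ j)) * qpoch p (p / (1 ^ i / 1 ^ j)))) (at_right 0)"
    by (intro tendsto_mult tendsto_powi_diff_quotient tendsto_qpoch p tendsto_divide tendsto_power c1 tendsto_const) auto
  moreover have "tdiff p (cis \<phi> ^ i) (cis \<phi> ^ j) = (cis \<phi> powi int j - cis \<phi> powi int i) *
      (qpoch p (p * (cis \<phi> ^ i / cis \<phi> ^ j)) * qpoch p (p / (cis \<phi> ^ i / cis \<phi> ^ j)))" for \<phi>
    unfolding tdiff_def theta_eq[OF p] power_int_of_nat by (simp add: right_diff_distrib)
  ultimately show ?thesis by (simp add: power2_eq_square)
qed

lemma alt_prod_divide:
  fixes E :: "'a \<Rightarrow> 'a \<Rightarrow> complex"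
  shows "alt_prod (\<lambda>a b. E a b / d) S x = alt_prod E S x / (\<Prod>j\<in>S. \<Prod>i\<in>{i \<in> S. i < j}. d)"
  unfolding alt_prod_def prod_dividef ..

text \<open>The pairs (0, i) supply the factors k i + r i + |k|. For 1 <= i < j both differences
  appear reversed, so the signs cancel.\<close>

lemma tri_coeff_alt_prod:
  "tri_coeff m k r = alt_prod (\<lambda>a b. b - a) {..m} (weight m k r) * alt_prod (\<lambda>a b. b - a) {1..m} r"
proof -
  have A: "alt_prod (\<lambda>a b. b - a) {..n} w = (\<Prod>i=1..n. w i - w 0) * alt_prod (\<lambda>a b. b - a) {1..n} w" for w :: "nat \<Rightarrow> int" and n
  proof (induction n)
    case 0 thus ?case by (simp add: alt_prod_def)
  next
    case (Suc n)
    have "{1..Suc n} = insert (Suc n) {1..n}" by auto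
    hence "alt_prod (\<lambda>a b. b - a) {1..Suc n} w = alt_prod (\<lambda>a b. b - a) {1..n} w * (\<Prod>i=1..n. w (Suc n) - w i)"
      by (simp only:) (rule alt_prod_insert_max, auto)
    moreover have "alt_prod (\<lambda>a b. b - a) {..Suc n} w = alt_prod (\<lambda>a b. b - a) {..n} w * (\<Prod>i\<le>n. w (Suc n) - w i)"
      unfolding atMost_Suc by (rule alt_prod_insert_max) auto
    moreover have "(\<Prod>i\<le>n. w (Suc n) - w i) = (w (Suc n) - w 0) * (\<Prod>i=1..n. w (Suc n) - w i)"
      by (simp add: atLeast0AtMost[symmetric] prod.atLeast_Suc_atMost[of 0])
    ultimately show ?case using Suc by (simp add: mult_ac)
  qed
  have B: "(\<Prod>i=1..m. \<Prod>j\<in>{i<..m}. f i j) = (\<Prod>j=1..m. \<Prod>i\<in>{i \<in> {1..m}. i < j}. f i j)" for f :: "nat \<Rightarrow> nat \<Rightarrow> int"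
  proof -
    have "(\<Prod>i=1..m. \<Prod>j\<in>{i<..m}. f i j) = (\<Prod>i=1..m. \<Prod>j\<in>{j \<in> {1..m}. i < j}. f i j)"
      by (intro prod.cong refl) auto
    also have "\<dots> = (\<Prod>j=1..m. \<Prod>i\<in>{i \<in> {1..m}. i < j}. f i j)"
      by (rule prod.swap_restrict) auto
    finally show ?thesis .
  qed
  have "(\<Prod>i=1..m. \<Prod>j\<in>{i<..m}. (k i + r i - k j - r j) * (r i - r j)) =
      alt_prod (\<lambda>a b. b - a) {1..m} (weight m k r) * alt_prod (\<lambda>a b. b - a) {1..m} r"
    unfolding B alt_prod_def prod.distrib[symmetric]
    by (intro prod.cong refl) (auto simp: weight_def algebra_simps)
  moreover have "(\<Prod>i=1..m. weight m k r i - weight m k r 0) = (\<Prod>i=1..m. k i + r i + vec_total m k)"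
    by (intro prod.cong refl) (auto simp: weight_def)
  ultimately show ?thesis unfolding tri_coeff_def A by simp
qed

section \<open>Values of the limiting products\<close>

lemma alt_prod_nat_atMost:
  fixes c :: complex
  shows "alt_prod (\<lambda>i j. (of_nat j - of_nat i) * c) {..m} id = (\<Prod>i=1..m. fact i) * c ^ (m * (m + 1) div 2)"
proof (induction m)
  case 0 show ?case by (simp add: alt_prod_def)
next
  case (Suc m)
  have f: "(\<Prod>i\<le>m. of_nat (Suc m) - of_nat i :: complex) = fact (Suc m)"
  proof -
    have "(\<Prod>i\<le>m. of_nat (Suc m) - of_nat i :: complex) = (\<Prod>i\<le>m. of_nat (Suc m - i))"
      by (intro prod.cong refl) (auto simp: of_nat_diff)
    also have "\<dots> = (\<Prod>i=1..Suc m. of_nat i)"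
      by (rule prod.reindex_bij_witness[of _ "\<lambda>i. Suc m - i" "\<lambda>i. Suc m - i"]) auto
    finally show ?thesis by (simp only: fact_prod of_nat_prod)
  qed
  have "Suc m * (Suc m + 1) = m * (m + 1) + 2 * (m + 1)" by simp
  hence e: "Suc m * (Suc m + 1) div 2 = m * (m + 1) div 2 + Suc m" by simp
  have "alt_prod (\<lambda>i j. (of_nat j - of_nat i) * c) {..Suc m} id =
      alt_prod (\<lambda>i j. (of_nat j - of_nat i) * c) {..m} id * (\<Prod>i\<le>m. (of_nat (id (Suc m)) - of_nat (id i)) * c)"
    unfolding atMost_Suc by (rule alt_prod_insert_max) auto
  also have "(\<Prod>i\<le>m. (of_nat (id (Suc m)) - of_nat (id i)) * c) = fact (Suc m) * c ^ Suc m"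
    unfolding prod.distrib id_apply f by simp
  finally show ?case unfolding Suc e power_add by (simp add: mult_ac)
qed

text \<open>Over 1, ..., m the differences j - i multiply to 1! 2! ... (m-1)!; the factor m!,
  supplied by \<open>has_sum_antisym\<close>, completes the product.\<close>

lemma alt_prod_nat_from_1:
  fixes c :: complex
  shows "fact m * alt_prod (\<lambda>i j. (of_nat j - of_nat i) * c) {1..m} id = (\<Prod>i=1..m. fact i) * c ^ (m * (m - 1) div 2)"
proof (induction m)
  case 0 show ?case by (simp add: alt_prod_def)
next
  case (Suc m)
  have f: "(\<Prod>i=1..m. of_nat (Suc m) - of_nat i :: complex) = fact m"
  proof -
    have "(\<Prod>i=1..m. of_nat (Suc m) - of_nat i :: complex) = (\<Prod>i=1..m. of_nat (Suc m - i))"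
      by (intro prod.cong refl) (auto simp: of_nat_diff)
    also have "\<dots> = (\<Prod>i=1..m. of_nat i)"
      by (rule prod.reindex_bij_witness[of _ "\<lambda>i. Suc m - i" "\<lambda>i. Suc m - i"]) auto
    finally show ?thesis by (simp only: fact_prod of_nat_prod)
  qed
  have e: "Suc m * (Suc m - 1) div 2 = m * (m - 1) div 2 + m" by (cases m) (auto simp: algebra_simps)
  have "{1..Suc m} = insert (Suc m) {1..m}" by auto
  hence "alt_prod (\<lambda>i j. (of_nat j - of_nat i) * c) {1..Suc m} id =
      alt_prod (\<lambda>i j. (of_nat j - of_nat i) * c) {1..m} id * (\<Prod>i=1..m. (of_nat (id (Suc m)) - of_nat (id i)) * c)"
    by (simp only:) (rule alt_prod_insert_max, auto)
  also have "(\<Prod>i=1..m. (of_nat (id (Suc m)) - of_nat (id i)) * c) = fact m * c ^ m"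
    unfolding prod.distrib id_apply f by simp
  finally have "fact (Suc m) * alt_prod (\<lambda>i j. (of_nat j - of_nat i) * c) {1..Suc m} id =
     fact (Suc m) * ((fact m * alt_prod (\<lambda>i j. (of_nat j - of_nat i) * c) {1..m} id) * c ^ m)" by (simp only: mult_ac)
  moreover have "(\<Prod>i=1..Suc m. fact i :: complex) = (\<Prod>i=1..m. fact i) * fact (Suc m)" by simp
  ultimately show ?case unfolding Suc e power_add by (simp only: mult_ac)
qed

text \<open>By \<open>theta_inverse\<close>, q theta(1/q) = - theta(q) = - (q;p)^2, and m(m+1) is
  even.\<close>

lemma theta_inverse_power:
  assumes q0: "q \<noteq> 0" and q1: "norm q < 1"
  shows "theta (q\<^sup>2) (1 / q) ^ (m * (m + 1)) * q ^ (m * (m + 1)) = qpoch (q\<^sup>2) q ^ (2 * m * (m + 1))"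
proof -
  have p: "norm (q\<^sup>2) < 1" using q1 by (simp add: norm_power power_less_one_iff)
  have "theta (q\<^sup>2) (1 / q) * q = - theta (q\<^sup>2) q" using theta_inverse[OF p q0] q0 by simp
  also have "theta (q\<^sup>2) q = qpoch (q\<^sup>2) q ^ 2" using q0 by (simp add: theta_def power2_eq_square)
  finally have "(theta (q\<^sup>2) (1 / q) * q) ^ (m * (m + 1)) = (- (qpoch (q\<^sup>2) q ^ 2)) ^ (m * (m + 1))" by simp
  also have "\<dots> = (qpoch (q\<^sup>2) q ^ 2) ^ (m * (m + 1))" by (rule power_minus_even) simp
  finally show ?thesis by (simp only: power_mult_distrib power_mult[symmetric] mult.assoc)
qed

lemma inj_on_cis_power:
  assumes "\<phi> \<in> {0<..<1 / (real m + 1)}"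
  shows "inj_on (\<lambda>i. cis \<phi> ^ i) {..m}"
proof -
  have neq: "cis \<phi> ^ i \<noteq> cis \<phi> ^ j" if "i < j" "j \<le> m" for i j
  proof
    assume eq: "cis \<phi> ^ i = cis \<phi> ^ j"
    have "cis \<phi> ^ j = cis \<phi> ^ i * cis \<phi> ^ (j - i)" using that by (simp flip: power_add)
    hence "cis \<phi> ^ (j - i) = 1" using eq by simp
    hence "cis (real (j - i) * \<phi>) = 1" by (simp only: Complex.DeMoivre)
    hence "sin (real (j - i) * \<phi>) = 0" by (simp add: complex_eq_iff)
    moreover have "0 < real (j - i) * \<phi>" using assms that by auto
    \<comment> \<open>The bound on \<phi> keeps all differences of arguments below pi, where the
      sine is positive.\<close>
    moreover have "real (j - i) * \<phi> < pi"
    proof -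
      have "real (j - i) * \<phi> \<le> (real m + 1) * \<phi>" using assms that by (intro mult_right_mono) auto
      also have "\<dots> < 1" using assms by (simp add: field_simps)
      finally show ?thesis using pi_gt3 by linarith
    qed
    ultimately show False using sin_gt_zero[of "real (j - i) * \<phi>"] by (metis less_irrefl)
  qed
  show ?thesis
    by (rule inj_onI) (metis atMost_iff linorder_neqE_nat neq)
qed

lemma infsum_same_side_tri:
  assumes q0: "q \<noteq> 0" and q1: "norm q < 1"
  shows "infsum (\<lambda>(k, r). (\<Prod>l=1..m. side (k l)) * (q powi tri_exponent m k r * of_int (tri_coeff m k r))) (same_side m) =
    (\<Prod>i=1..m. fact i)\<^sup>2 * triangle_gf q ^ (2 * m * (m + 1))"
proof -
  define p where "p = q\<^sup>2"
  have p: "norm p < 1" using q1 by (simp add: p_def norm_power power_less_one_iff)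
  define Q where "Q = qpoch p p"
  have Q0: "Q \<noteq> 0" unfolding Q_def using p by (intro qpoch_nonzero)
  define S where "S = {0<..<1 / (real m + 1)}"
  have ev: "\<forall>\<^sub>F \<phi> in at_right 0. \<phi> \<in> S" unfolding S_def by (rule eventually_at_right_real) simp
  define \<delta> where "\<delta> \<phi> = cis \<phi> - 1" for \<phi>
  have \<delta>0: "\<delta> \<phi> \<noteq> 0" if "\<phi> \<in> S" for \<phi>
  proof -
    have "1 / (real m + 1) \<le> 1" by simp
    hence "0 < \<phi>" "\<phi> < pi" using that pi_gt3 unfolding S_def by (auto simp del: divide_le_eq_1_pos)
    hence "sin \<phi> > 0" by (intro sin_gt_zero)
    thus ?thesis by (auto simp: \<delta>_def complex_eq_iff)
  qed
  define a where "a k r = (\<Prod>l=1..m. side (k l)) * q powi (tri_exponent m k r + int (m * (m + 1)))" for k r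
  define f where "f \<phi> = (\<lambda>(k, r). a k r * alt_prod (\<lambda>a b. (b - a) / \<delta> \<phi>) {..m} (\<lambda>l. cis \<phi> powi weight m k r l) *
      ((\<Prod>l=1..m. cis \<phi> powi (r l - 1)) * alt_prod (\<lambda>a b. (b - a) / \<delta> \<phi>) {1..m} (\<lambda>l. cis \<phi> powi (r l - 1))))" for \<phi>
  define h where "h = (\<lambda>(k, r). a k r * of_int (tri_coeff m k r))"
  define L where "L \<phi> = fact m * (Q ^ (2 * m) * alt_prod (\<lambda>a b. tdiff p a b / \<delta> \<phi>) {..m} (\<lambda>i. cis \<phi> ^ i) *
      (alt_prod (\<lambda>a b. tdiff p a b / \<delta> \<phi>) {1..m} (\<lambda>i. cis \<phi> ^ i) / (\<Prod>i\<le>m. \<Prod>j=1..m. theta p (cis \<phi> ^ i * cis \<phi> ^ j / q))))" for \<phi>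
  have fL: "infsum (f \<phi>) (same_side m) = L \<phi>" if \<phi>: "\<phi> \<in> S" for \<phi>
  proof -
    \<comment> \<open>Powers of \<open>cis \<phi> - 1\<close> with m(m+1)/2 and m(m-1)/2 factors,
      kept as products in the shape that \<open>alt_prod_divide\<close> yields on both
      sides.\<close>
    define d1 where "d1 = (\<Prod>j\<in>{..m}. \<Prod>i\<in>{i \<in> {..m}. i < j}. \<delta> \<phi>)"
    define d2 where "d2 = (\<Prod>j\<in>{1..m}. \<Prod>i\<in>{i \<in> {1..m}. i < j}. \<delta> \<phi>)"
    have "((\<lambda>z. 1 / (d1 * d2) * (case z of (k, r) \<Rightarrow> a k r *
            alt_prod (\<lambda>a b. b - a) {..m} (\<lambda>l. cis \<phi> powi weight m k r l) *
            ((\<Prod>l=1..m. cis \<phi> powi (r l - 1)) * alt_prod (\<lambda>a b. b - a) {1..m} (\<lambda>l. cis \<phi> powi (r l - 1)))))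
          has_sum 1 / (d1 * d2) * (fact m * (Q ^ (2 * m) * alt_prod (tdiff p) {..m} (\<lambda>i. cis \<phi> ^ i) *
            (alt_prod (tdiff p) {1..m} (\<lambda>i. cis \<phi> ^ i) / (\<Prod>i\<le>m. \<Prod>j=1..m. theta p (cis \<phi> ^ i * cis \<phi> ^ j / q)))))) (same_side m)"
      unfolding Q_def p_def a_def
      by (rule has_sum_cmult_right[OF has_sum_antisym[OF q0 q1]]) (use inj_on_cis_power \<phi> in \<open>auto simp: S_def\<close>)
    also have "1 / (d1 * d2) * (fact m * (Q ^ (2 * m) * alt_prod (tdiff p) {..m} (\<lambda>i. cis \<phi> ^ i) *
            (alt_prod (tdiff p) {1..m} (\<lambda>i. cis \<phi> ^ i) / (\<Prod>i\<le>m. \<Prod>j=1..m. theta p (cis \<phi> ^ i * cis \<phi> ^ j / q))))) = L \<phi>"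
      unfolding L_def alt_prod_divide d1_def[symmetric] d2_def[symmetric] by (simp add: mult_ac)
    also have "(\<lambda>z. 1 / (d1 * d2) * (case z of (k, r) \<Rightarrow> a k r *
            alt_prod (\<lambda>a b. b - a) {..m} (\<lambda>l. cis \<phi> powi weight m k r l) *
            ((\<Prod>l=1..m. cis \<phi> powi (r l - 1)) * alt_prod (\<lambda>a b. b - a) {1..m} (\<lambda>l. cis \<phi> powi (r l - 1))))) = f \<phi>"
      unfolding f_def alt_prod_divide d1_def[symmetric] d2_def[symmetric] by (simp add: fun_eq_iff mult_ac)
    finally show ?thesis by (rule infsumI)
  qed
  have quot: "alt_prod (\<lambda>a b. (b - a) / \<delta> \<phi>) A (\<lambda>l. cis \<phi> powi w l) =
      (\<Prod>j\<in>A. \<Prod>i\<in>{i \<in> A. i < j}. (cis \<phi> powi w j - cis \<phi> powi w i) / (cis \<phi> - 1))" for A w \<phi>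
    by (simp add: alt_prod_def \<delta>_def)
  have qlim: "((\<lambda>\<phi>. alt_prod (\<lambda>a b. (b - a) / \<delta> \<phi>) A (\<lambda>l. cis \<phi> powi w l)) \<longlongrightarrow> of_int (alt_prod (\<lambda>a b. b - a) A w)) (at_right 0)" for A w
  proof -
    have "((\<lambda>\<phi>. \<Prod>j\<in>A. \<Prod>i\<in>{i \<in> A. i < j}. (cis \<phi> powi w j - cis \<phi> powi w i) / (cis \<phi> - 1)) \<longlongrightarrow>
        (\<Prod>j\<in>A. \<Prod>i\<in>{i \<in> A. i < j}. of_int (w j) - of_int (w i))) (at_right 0)"
      by (intro tendsto_prod tendsto_powi_diff_quotient)
    thus ?thesis unfolding quot by (simp add: alt_prod_def)
  qed
  have qle: "norm (alt_prod (\<lambda>a b. (b - a) / \<delta> \<phi>) A (\<lambda>l. cis \<phi> powi w l)) \<le> of_int \<bar>alt_prod (\<lambda>a b. b - a) A w\<bar>"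
    if "\<phi> \<in> S" for A w \<phi>
  proof -
    have "norm (alt_prod (\<lambda>a b. (b - a) / \<delta> \<phi>) A (\<lambda>l. cis \<phi> powi w l)) =
        (\<Prod>j\<in>A. \<Prod>i\<in>{i \<in> A. i < j}. norm ((cis \<phi> powi w j - cis \<phi> powi w i) / (cis \<phi> - 1)))"
      unfolding quot by (simp add: prod_norm)
    also have "\<dots> \<le> (\<Prod>j\<in>A. \<Prod>i\<in>{i \<in> A. i < j}. of_int \<bar>w j - w i\<bar>)"
    proof (intro prod_mono conjI prod_nonneg norm_ge_zero ballI)
      fix j i
      have "norm (cis \<phi> powi w j - cis \<phi> powi w i) \<le> of_int \<bar>w j - w i\<bar> * norm (cis \<phi> - 1)"
        by (rule norm_powi_diff_le) simp
      moreover have "norm (cis \<phi> - 1) > 0" using \<delta>0[OF that] by (simp add: \<delta>_def)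
      ultimately show "norm ((cis \<phi> powi w j - cis \<phi> powi w i) / (cis \<phi> - 1)) \<le> of_int \<bar>w j - w i\<bar>"
        by (simp only: norm_divide pos_divide_le_eq)
    qed
    also have "\<dots> = of_int \<bar>alt_prod (\<lambda>a b. b - a) A w\<bar>" by (simp add: alt_prod_def abs_prod)
    finally show ?thesis .
  qed
  have c1: "(cis \<longlongrightarrow> 1) (at_right 0)" using filterlim_cis by (simp add: filterlim_at)
  have na: "norm (a k r) = norm q powi int (m * (m + 1)) * norm q powi tri_exponent m k r" for k r
  proof -
    have "norm (a k r) = norm q powi (tri_exponent m k r + int (m * (m + 1)))"
      unfolding a_def norm_mult prod_norm[symmetric] norm_power_int norm_side by simp
    also have "\<dots> = norm q powi tri_exponent m k r * norm q powi int (m * (m + 1))" using q0 by (intro power_int_add) auto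
    finally show ?thesis by (simp only: mult.commute)
  qed
  \<comment> \<open>By \<open>qle\<close> each difference quotient is bounded by the integer
    difference it tends to, so the limiting coefficient \<open>tri_coeff\<close> is itself the
    majorant.\<close>
  have "((\<lambda>\<phi>. infsum (f \<phi>) (same_side m)) \<longlongrightarrow> infsum h (same_side m)) (at_right 0)"
  proof (rule tendsto_infsum_dominated[where S = S and g = "\<lambda>z. norm q powi int (m * (m + 1)) *
      (case z of (k, r) \<Rightarrow> norm q powi tri_exponent m k r * of_int \<bar>tri_coeff m k r\<bar>)"])
    show "(\<lambda>z. norm q powi int (m * (m + 1)) *
      (case z of (k, r) \<Rightarrow> norm q powi tri_exponent m k r * of_int \<bar>tri_coeff m k r\<bar>)) summable_on same_side m"
      using q0 q1 by (intro summable_on_cmult_right summable_tri_coeff) auto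
    fix z :: "(nat \<Rightarrow> int) \<times> (nat \<Rightarrow> int)"
    obtain k r where z: "z = (k, r)" by (cases z)
    have sh: "alt_prod (\<lambda>a b. b - a) {1..m} (\<lambda>l. r l - 1) = alt_prod (\<lambda>a b. b - a) {1..m} r"
      by (simp add: alt_prod_def)
    show "norm (f \<phi> z) \<le> norm q powi int (m * (m + 1)) *
      (case z of (k, r) \<Rightarrow> norm q powi tri_exponent m k r * of_int \<bar>tri_coeff m k r\<bar>)" if \<phi>: "\<phi> \<in> S" for \<phi>
    proof -
      have "(\<Prod>l=1..m. norm (cis \<phi> powi (r l - 1))) = 1" by (intro prod.neutral) (simp add: norm_power_int)
      hence "norm (f \<phi> z) = norm (a k r) * (norm (alt_prod (\<lambda>a b. (b - a) / \<delta> \<phi>) {..m} (\<lambda>l. cis \<phi> powi weight m k r l)) *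
        norm (alt_prod (\<lambda>a b. (b - a) / \<delta> \<phi>) {1..m} (\<lambda>l. cis \<phi> powi (r l - 1))))"
        unfolding z f_def prod.case norm_mult prod_norm[symmetric] by simp
      also have "\<dots> \<le> norm (a k r) * (of_int \<bar>alt_prod (\<lambda>a b. b - a) {..m} (weight m k r)\<bar> *
          of_int \<bar>alt_prod (\<lambda>a b. b - a) {1..m} (\<lambda>l. r l - 1)\<bar>)"
        by (intro mult_left_mono mult_mono qle \<phi>) auto
      also have "\<dots> = norm (a k r) * of_int \<bar>tri_coeff m k r\<bar>"
        unfolding sh tri_coeff_alt_prod abs_mult of_int_mult ..
      finally show ?thesis unfolding z prod.case na by (simp only: mult.assoc)
    qed
    show "((\<lambda>\<phi>. f \<phi> z) \<longlongrightarrow> h z) (at_right 0)"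
    proof -
      have "((\<lambda>\<phi>. f \<phi> z) \<longlongrightarrow> a k r * of_int (alt_prod (\<lambda>a b. b - a) {..m} (weight m k r)) *
        ((\<Prod>l=1..m. 1 powi (r l - 1)) * of_int (alt_prod (\<lambda>a b. b - a) {1..m} (\<lambda>l. r l - 1)))) (at_right 0)"
        unfolding z f_def prod.case
        by (intro tendsto_mult tendsto_const qlim tendsto_prod tendsto_power_int c1) auto
      thus ?thesis unfolding sh z h_def prod.case tri_coeff_alt_prod by (simp add: mult.assoc)
    qed
  qed (use ev in auto)
  hence lim1: "(L \<longlongrightarrow> infsum h (same_side m)) (at_right 0)"
    by (rule Lim_transform_eventually) (use ev fL in \<open>auto elim!: eventually_mono\<close>)
  have alim: "((\<lambda>\<phi>. alt_prod (\<lambda>a b. tdiff p a b / \<delta> \<phi>) A (\<lambda>i. cis \<phi> ^ i)) \<longlongrightarrow>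
      alt_prod (\<lambda>i j. (of_nat j - of_nat i) * Q\<^sup>2) A id) (at_right 0)" for A
    unfolding alt_prod_def \<delta>_def Q_def id_apply by (intro tendsto_prod tendsto_tdiff_quotient p)
  define N where "N = m * (m + 1)"
  have thq: "theta p (1 / q) \<noteq> 0"
    unfolding p_def by (rule theta_nonzero_of_norm_odd[OF q0 q1, of _ "-1"]) (auto simp: norm_divide inverse_eq_divide)
  have thlim: "((\<lambda>\<phi>. \<Prod>i\<le>m. \<Prod>j=1..m. theta p (cis \<phi> ^ i * cis \<phi> ^ j / q)) \<longlongrightarrow> theta p (1 / q) ^ N) (at_right 0)"
  proof -
    have "((\<lambda>\<phi>. \<Prod>i\<le>m. \<Prod>j=1..m. theta p (cis \<phi> ^ i * cis \<phi> ^ j / q)) \<longlongrightarrow> (\<Prod>i\<le>m. \<Prod>j=1..m. theta p (1 ^ i * 1 ^ j / q))) (at_right 0)"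
      by (intro tendsto_prod tendsto_theta p tendsto_divide tendsto_mult tendsto_power c1 tendsto_const q0) (use q0 in auto)
    also have "(\<Prod>i\<le>m. \<Prod>j=1..m. theta p (1 ^ i * 1 ^ j / q)) = theta p (1 / q) ^ N"
      by (simp add: N_def power_mult[symmetric] power_add)
    finally show ?thesis .
  qed
  have "(L \<longlongrightarrow> fact m * (Q ^ (2 * m) * alt_prod (\<lambda>i j. (of_nat j - of_nat i) * Q\<^sup>2) {..m} id *
      (alt_prod (\<lambda>i j. (of_nat j - of_nat i) * Q\<^sup>2) {1..m} id / theta p (1 / q) ^ N))) (at_right 0)"
    unfolding L_def using thq by (intro tendsto_mult tendsto_const alim tendsto_divide thlim) auto
  from tendsto_unique[OF _ lim1 this]
  have "infsum h (same_side m) = fact m * (Q ^ (2 * m) * alt_prod (\<lambda>i j. (of_nat j - of_nat i) * Q\<^sup>2) {..m} id *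
      (alt_prod (\<lambda>i j. (of_nat j - of_nat i) * Q\<^sup>2) {1..m} id / theta p (1 / q) ^ N))" by simp
  also have "\<dots> = Q ^ (2 * m) * alt_prod (\<lambda>i j. (of_nat j - of_nat i) * Q\<^sup>2) {..m} id *
      (fact m * alt_prod (\<lambda>i j. (of_nat j - of_nat i) * Q\<^sup>2) {1..m} id) / theta p (1 / q) ^ N"
    by (simp only: mult_ac times_divide_eq_left times_divide_eq_right)
  also have "\<dots> = (\<Prod>i=1..m. fact i)\<^sup>2 * (Q ^ (2 * m) * (Q\<^sup>2) ^ (m * (m + 1) div 2) * (Q\<^sup>2) ^ (m * (m - 1) div 2)) / theta p (1 / q) ^ N"
    unfolding alt_prod_nat_atMost alt_prod_nat_from_1 by (simp only: power2_eq_square[of "prod fact {1..m}"] mult_ac)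
  \<comment> \<open>The exponents add up to 2m + m(m+1) + m(m-1) = 2m(m+1).\<close>
  also have "Q ^ (2 * m) * (Q\<^sup>2) ^ (m * (m + 1) div 2) * (Q\<^sup>2) ^ (m * (m - 1) div 2) = Q ^ (2 * N)"
  proof -
    have "2 * (m * (m + 1) div 2) = m * (m + 1)" "2 * (m * (m - 1) div 2) = m * (m - 1)"
      by (cases m; simp)+
    hence "2 * m + 2 * (m * (m + 1) div 2) + 2 * (m * (m - 1) div 2) = 2 * N"
      unfolding N_def by (cases m) (auto simp: algebra_simps)
    thus ?thesis by (simp only: power_mult[symmetric] power_add[symmetric])
  qed
  finally have I: "infsum h (same_side m) = (\<Prod>i=1..m. fact i)\<^sup>2 * Q ^ (2 * N) / theta p (1 / q) ^ N" .
  \<comment> \<open>Extracting q^N, the shift in the exponents of \<open>wterm\<close>, leaves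
    exactly what theta(1/q)^N needs to become (q;p)^(2N).\<close>
  have "h = (\<lambda>z. q ^ N * (case z of (k, r) \<Rightarrow> (\<Prod>l=1..m. side (k l)) * (q powi tri_exponent m k r * of_int (tri_coeff m k r))))"
  proof (rule ext, clarify)
    fix k r
    have "q powi (tri_exponent m k r + int (m * (m + 1))) = q powi tri_exponent m k r * q powi int (m * (m + 1))"
      using q0 by (intro power_int_add) auto
    thus "h (k, r) = q ^ N * ((\<Prod>l=1..m. side (k l)) * (q powi tri_exponent m k r * of_int (tri_coeff m k r)))"
      unfolding h_def a_def prod.case power_int_of_nat N_def by (simp only: mult_ac)
  qed
  hence "infsum h (same_side m) = q ^ N * infsum (\<lambda>(k, r). (\<Prod>l=1..m. side (k l)) * (q powi tri_exponent m k r * of_int (tri_coeff m k r))) (same_side m)"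
    by (simp only: infsum_cmult_right')
  hence "q ^ N * infsum (\<lambda>(k, r). (\<Prod>l=1..m. side (k l)) * (q powi tri_exponent m k r * of_int (tri_coeff m k r))) (same_side m) =
     (\<Prod>i=1..m. fact i)\<^sup>2 * Q ^ (2 * N) / theta p (1 / q) ^ N" using I by simp
  also have "\<dots> = q ^ N * ((\<Prod>i=1..m. fact i)\<^sup>2 * (Q ^ (2 * N) / (theta p (1 / q) ^ N * q ^ N)))"
    using q0 by simp
  also have "theta p (1 / q) ^ N * q ^ N = qpoch p q ^ (2 * N)"
    using theta_inverse_power[OF q0 q1, of m] by (simp add: p_def N_def mult.assoc)
  also have "Q ^ (2 * N) / qpoch p q ^ (2 * N) = triangle_gf q ^ (2 * N)"
    unfolding triangle_gf_eq[OF q1] p_def[symmetric] Q_def[symmetric] by (rule power_divide[symmetric])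
  finally show ?thesis using q0 by (simp add: N_def mult.assoc)
qed

text \<open>\<open>infsum\<close> returns 0 for a family that is not summable; the first conjunct
  excludes this for every inner sum.\<close>

theorem theorem5p10:
  fixes m :: nat and q :: complex
  assumes "m \<ge> 1" and "0 < norm q" and "norm q < 1"
  shows "(\<forall>J \<subseteq> {1..m}. (\<lambda>(k, r). q powi tri_exponent m k r * of_int (tri_coeff m k r))
            summable_on (int_vecs m J \<times> int_vecs m J)) \<and>
         triangle_gf q ^ (2 * m * (m + 1)) =
           1 / (\<Prod>i=1..m. fact i)\<^sup>2 *
           (\<Sum>J\<in>Pow {1..m}. (-1) ^ card J *
              (\<Sum>\<^sub>\<infinity>(k, r)\<in>int_vecs m J \<times> int_vecs m J.
                 q powi tri_exponent m k r * of_int (tri_coeff m k r)))"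
proof
  have q0: "q \<noteq> 0" using assms(2) by auto
  define c where "c = (\<lambda>(k, r). q powi tri_exponent m k r * complex_of_int (tri_coeff m k r))"
  define s where "s k = (\<Prod>l=1..m. side (k l))" for k :: "nat \<Rightarrow> int"
  have norm_c: "norm (c z) = (case z of (k, r) \<Rightarrow> norm q powi tri_exponent m k r * of_int \<bar>tri_coeff m k r\<bar>)" for z
    by (simp add: c_def split_beta norm_mult norm_power_int)
  have abs: "(\<lambda>z. norm (c z)) summable_on same_side m"
    unfolding norm_c using assms by (intro summable_tri_coeff)
  hence "c summable_on same_side m" by (rule Infinite_Sum.abs_summable_summable)
  thus "\<forall>J \<subseteq> {1..m}. (\<lambda>(k, r). q powi tri_exponent m k r * of_int (tri_coeff m k r))
            summable_on (int_vecs m J \<times> int_vecs m J)"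
    unfolding c_def using int_vecs_product by (blast intro: summable_on_subset)
  have norm_s: "norm (s k) = 1" for k unfolding s_def prod_norm[symmetric] by simp
  have "(\<lambda>z. norm (s (fst z) * c z)) summable_on same_side m"
    using abs by (simp add: norm_mult norm_s)
  hence "(\<lambda>z. s (fst z) * c z) summable_on same_side m" by (rule Infinite_Sum.abs_summable_summable)
  hence "infsum (\<lambda>z. s (fst z) * c z) (same_side m) = (\<Sum>J\<in>Pow {1..m}. infsum (\<lambda>z. s (fst z) * c z) (int_vecs m J \<times> int_vecs m J))"
    by (rule infsum_same_side)
  also have "\<dots> = (\<Sum>J\<in>Pow {1..m}. (-1) ^ card J * infsum c (int_vecs m J \<times> int_vecs m J))"
  proof (rule sum.cong[OF refl])
    fix J assume "J \<in> Pow {1..m}"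
    have "s k = (-1) ^ card J" if "k \<in> int_vecs m J" for k
    proof -
      have J: "J = {j \<in> {1..m}. k j \<le> 0}" using that by (simp add: int_vecs_def)
      have "s k = (\<Prod>l\<in>{1..m}. if k l \<le> 0 then - 1 else 1)" by (simp add: s_def side_def)
      also have "\<dots> = (\<Prod>l\<in>J. - 1)" unfolding J by (rule prod.inter_filter[symmetric]) simp
      finally show ?thesis by simp
    qed
    hence "infsum (\<lambda>z. s (fst z) * c z) (int_vecs m J \<times> int_vecs m J) = infsum (\<lambda>z. (-1) ^ card J * c z) (int_vecs m J \<times> int_vecs m J)"
      by (intro infsum_cong) auto
    thus "infsum (\<lambda>z. s (fst z) * c z) (int_vecs m J \<times> int_vecs m J) = (-1) ^ card J * infsum c (int_vecs m J \<times> int_vecs m J)"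
      by (simp only: infsum_cmult_right')
  qed
  also have "infsum (\<lambda>z. s (fst z) * c z) (same_side m) = (\<Prod>i=1..m. fact i)\<^sup>2 * triangle_gf q ^ (2 * m * (m + 1))"
    using infsum_same_side_tri[OF q0 assms(3), of m] by (simp add: s_def c_def case_prod_unfold)
  finally have "(\<Prod>i=1..m. fact i)\<^sup>2 * triangle_gf q ^ (2 * m * (m + 1)) =
    (\<Sum>J\<in>Pow {1..m}. (-1) ^ card J * infsum c (int_vecs m J \<times> int_vecs m J))" .
  moreover have "(\<Prod>i=1..m. fact i :: complex)\<^sup>2 \<noteq> 0" by simp
  ultimately show "triangle_gf q ^ (2 * m * (m + 1)) =
           1 / (\<Prod>i=1..m. fact i)\<^sup>2 *
           (\<Sum>J\<in>Pow {1..m}. (-1) ^ card J *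
              (\<Sum>\<^sub>\<infinity>(k, r)\<in>int_vecs m J \<times> int_vecs m J.
                 q powi tri_exponent m k r * of_int (tri_coeff m k r)))"
    unfolding c_def by (simp add: eq_divide_eq mult.commute)
qed

end
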